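(* Let $R$ be a commutative ring, $n\ge 0$ an integer, and $\delta\in R$ an invertible element. Then the homology of the Brauer algebra is isomorphic to the homology of the symmetric group: $\operatorname{Tor}_*^{\mathrm{Br}_n(R,\delta)}(\mathbb{1},\mathbb{1})\cong H_*(\mathfrak S_n;\mathbb{1})$. Indeed, the inclusion and projection maps $R\mathfrak S_n\xrightarrow{\iota}\mathrm{Br}_n(R,\delta)\xrightarrow{\pi}R\mathfrak S_n$ induce mutually inverse isomorphisms $$\operatorname{Tor}_*^{R\mathfrak S_n}(\mathbb{1},\mathbb{1})\xrightarrow{\ \iota_*\ }\operatorname{Tor}_*^{\mathrm{Br}_n(R,\delta)}(\mathbb{1},\mathbb{1})\xrightarrow{\ \pi_*\ }\operatorname{Tor}_*^{R\mathfrak S_n}(\mathbb{1},\mathbb{1}).$$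
   Context: The Brauer algebra $\mathrm{Br}_n(R,\delta)$ is the $R$-algebra that is free as an $R$-module on the set of perfect matchings ("diagrams") of $\{-n,\dots,-1\}\cup\{1,\dots,n\}$, where the negative elements are drawn as nodes on the left, the positive ones as nodes on the right, and matched nodes are joined by an arc. The product $b_1b_2$ of two diagrams is obtained by placing $b_1$ to the left of $b_2$, identifying right node $i$ of $b_1$ with left node $-i$ of $b_2$ for each $i$, and concatenating arcs; each closed loop formed in the middle is removed and replaced by a factor $\delta$. $\iota\colon R\mathfrak S_n\to \mathrm{Br}_n(R,\delta)$ is the algebra map sending $g\in\mathfrak S_n$ to the permutation diagram joining $-g(i)$ to $i$ for all $i$. $\pi\colon \mathrm{Br}_n(R,\delta)\to R\mathfrak S_n$ is the algebra map sending each permutation diagram to the corresponding permutation and every other diagram to $0$. The trivial module $\mathbb{1}$ over $\mathrm{Br}_n(R,\delta)$ is $R$, with permutation diagrams acting (on the left and on the right) as the identity and all other diagrams acting as $0$; over a group ring, $\mathbb{1}$ is $R$ with trivial action. $H_*(\mathfrak S_n;\mathbb{1})=\operatorname{Tor}_*^{R\mathfrak S_n}(\mathbb{1},\mathbb{1})$. The maps $\iota_*,\pi_*$ are the maps on Tor induced by the ring maps $\iota,\pi$ together with the identity on $\mathbb{1}$ in both variables. *)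

theory Defs
  imports
    "HOL-Algebra.Module"
    "HOL-Algebra.Sym_Groups"
    "HOL-Algebra.Free_Abelian_Groups"
    "HOL-Library.Disjoint_Sets"
begin

section \<open>Right modules over a noncommutative ring\<close>

text \<open>
  The library locale \<^locale>\<open>module\<close> needs a commutative scalar ring.  For noncommutative
  scalars the record type of that locale is reused (its fields \<open>mult\<close> and \<open>one\<close> are ignored);
  in a right module, \<open>a \<odot> m\<close> stands for the product written \<open>m \<cdot> a\<close> on paper, and in a left
  module for \<open>a \<cdot> m\<close>.
\<close>

locale right_module = M?: abelian_group M
  for A :: "('a, 'c) ring_scheme" (structure) and M :: "('a, 'm, 'd) module_scheme" (structure) +
  assumes act_closed: "\<lbrakk>a \<in> carrier A; x \<in> carrier M\<rbrakk> \<Longrightarrow> a \<odot>\<^bsub>M\<^esub> x \<in> carrier M"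
    and act_add_scalar: "\<lbrakk>a \<in> carrier A; b \<in> carrier A; x \<in> carrier M\<rbrakk> \<Longrightarrow>
      (a \<oplus>\<^bsub>A\<^esub> b) \<odot>\<^bsub>M\<^esub> x = a \<odot>\<^bsub>M\<^esub> x \<oplus>\<^bsub>M\<^esub> b \<odot>\<^bsub>M\<^esub> x"
    and act_add: "\<lbrakk>a \<in> carrier A; x \<in> carrier M; y \<in> carrier M\<rbrakk> \<Longrightarrow>
      a \<odot>\<^bsub>M\<^esub> (x \<oplus>\<^bsub>M\<^esub> y) = a \<odot>\<^bsub>M\<^esub> x \<oplus>\<^bsub>M\<^esub> a \<odot>\<^bsub>M\<^esub> y"
    and act_mult: "\<lbrakk>a \<in> carrier A; b \<in> carrier A; x \<in> carrier M\<rbrakk> \<Longrightarrow>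
      (a \<otimes>\<^bsub>A\<^esub> b) \<odot>\<^bsub>M\<^esub> x = b \<odot>\<^bsub>M\<^esub> (a \<odot>\<^bsub>M\<^esub> x)"
    and act_one: "x \<in> carrier M \<Longrightarrow> \<one>\<^bsub>A\<^esub> \<odot>\<^bsub>M\<^esub> x = x"

text \<open>Additive maps \<open>f\<close> with \<open>f (m \<cdot> a) = f m \<cdot> \<phi> a\<close>.\<close>

definition semilinear ::
  "('a, 'c) ring_scheme \<Rightarrow> ('a \<Rightarrow> 'b) \<Rightarrow> ('a, 'm, 'd) module_scheme \<Rightarrow> ('b, 'n, 'e) module_scheme
    \<Rightarrow> ('m \<Rightarrow> 'n) set" where
  "semilinear A \<phi> M N =
    {f \<in> carrier M \<rightarrow> carrier N.
      (\<forall>x\<in>carrier M. \<forall>y\<in>carrier M. f (x \<oplus>\<^bsub>M\<^esub> y) = f x \<oplus>\<^bsub>N\<^esub> f y) \<and>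
      (\<forall>a\<in>carrier A. \<forall>x\<in>carrier M. f (a \<odot>\<^bsub>M\<^esub> x) = \<phi> a \<odot>\<^bsub>N\<^esub> f x)}"

abbreviation linear_maps ::
  "('a, 'c) ring_scheme \<Rightarrow> ('a, 'm, 'd) module_scheme \<Rightarrow> ('a, 'n, 'e) module_scheme
    \<Rightarrow> ('m \<Rightarrow> 'n) set" where
  "linear_maps A M N \<equiv> semilinear A (\<lambda>a. a) M N"

definition fin_supp :: "('a, 'c) ring_scheme \<Rightarrow> 'x set \<Rightarrow> ('x \<Rightarrow> 'a) set" where
  "fin_supp A X =
    {f. (\<forall>x. f x \<in> carrier A) \<and> (\<forall>x. x \<notin> X \<longrightarrow> f x = \<zero>\<^bsub>A\<^esub>) \<and> finite {x. f x \<noteq> \<zero>\<^bsub>A\<^esub>}}"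

definition free_right_module :: "('a, 'c) ring_scheme \<Rightarrow> 'x set \<Rightarrow> ('a, 'x \<Rightarrow> 'a) module" where
  "free_right_module A X =
    \<lparr>carrier = fin_supp A X, monoid.mult = undefined, one = undefined,
     ring.zero = (\<lambda>_. \<zero>\<^bsub>A\<^esub>), add = (\<lambda>f g x. f x \<oplus>\<^bsub>A\<^esub> g x), smult = (\<lambda>a f x. f x \<otimes>\<^bsub>A\<^esub> a)\<rparr>"

text \<open>
  Projective modules are the direct summands (retracts) of free modules.  It is no restriction
  that the basis \<open>X\<close> has elements of the type of \<open>M\<close>: if \<open>M\<close> is projective, then the canonical
  map onto \<open>M\<close> from the free module on the set \<open>carrier M\<close> splits.
\<close>

definition projective_right_module ::
  "('a, 'c) ring_scheme \<Rightarrow> ('a, 'm, 'd) module_scheme \<Rightarrow> bool" where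
  "projective_right_module A M \<longleftrightarrow> right_module A M \<and>
    (\<exists>(X :: 'm set) s r.
      s \<in> linear_maps A M (free_right_module A X) \<and>
      r \<in> linear_maps A (free_right_module A X) M \<and>
      (\<forall>m\<in>carrier M. r (s m) = m))"


section \<open>Tensor products\<close>

definition induced_map ::
  "('g, 'c) monoid_scheme \<Rightarrow> 'g set \<Rightarrow> ('f \<Rightarrow> 'g) \<Rightarrow> 'f set \<Rightarrow> 'g set" where
  "induced_map G K h C = (\<Union>x\<in>C. K #>\<^bsub>G\<^esub> h x)"
  \<comment> \<open>the map into \<open>G Mod K\<close> that sends the coset of \<open>x\<close> to the coset of \<open>h x\<close>\<close>

definition tensor_relations ::
  "('a, 'c) ring_scheme \<Rightarrow> ('a, 'm, 'd) module_scheme \<Rightarrow> ('a, 'n, 'e) module_scheme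
    \<Rightarrow> ('m \<times> 'n \<Rightarrow>\<^sub>0 int) set" where
  "tensor_relations A M N = generate (free_Abelian_group (carrier M \<times> carrier N))
    ({frag_of (x \<oplus>\<^bsub>M\<^esub> x', y) - frag_of (x, y) - frag_of (x', y) | x x' y.
        x \<in> carrier M \<and> x' \<in> carrier M \<and> y \<in> carrier N} \<union>
     {frag_of (x, y \<oplus>\<^bsub>N\<^esub> y') - frag_of (x, y) - frag_of (x, y') | x y y'.
        x \<in> carrier M \<and> y \<in> carrier N \<and> y' \<in> carrier N} \<union>
     {frag_of (a \<odot>\<^bsub>M\<^esub> x, y) - frag_of (x, a \<odot>\<^bsub>N\<^esub> y) | a x y.
        a \<in> carrier A \<and> x \<in> carrier M \<and> y \<in> carrier N})"

text \<open>The abelian group \<open>M \<otimes>\<^sub>A N\<close> for a right module \<open>M\<close> and a left module \<open>N\<close>.\<close>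

definition tensor ::
  "('a, 'c) ring_scheme \<Rightarrow> ('a, 'm, 'd) module_scheme \<Rightarrow> ('a, 'n, 'e) module_scheme
    \<Rightarrow> ('m \<times> 'n \<Rightarrow>\<^sub>0 int) set monoid" where
  "tensor A M N =
    free_Abelian_group (carrier M \<times> carrier N) Mod tensor_relations A M N"

text \<open>The map \<open>f \<otimes> h\<close> into \<open>M \<otimes>\<^sub>A N\<close>.\<close>

definition tensor_map ::
  "('a, 'c) ring_scheme \<Rightarrow> ('a, 'm, 'd) module_scheme \<Rightarrow> ('a, 'n, 'e) module_scheme
    \<Rightarrow> ('p \<Rightarrow> 'm) \<Rightarrow> ('q \<Rightarrow> 'n) \<Rightarrow> ('p \<times> 'q \<Rightarrow>\<^sub>0 int) set \<Rightarrow> ('m \<times> 'n \<Rightarrow>\<^sub>0 int) set" where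
  "tensor_map A M N f h =
    induced_map (free_Abelian_group (carrier M \<times> carrier N)) (tensor_relations A M N)
      (frag_extend (\<lambda>(x, y). frag_of (f x, h y)))"


section \<open>Homology of complexes of abelian groups\<close>

text \<open>In a complex \<open>C\<close>, the differential \<open>d k\<close> goes from \<open>C (Suc k)\<close> to \<open>C k\<close>.\<close>

definition cycles :: "(nat \<Rightarrow> 'g monoid) \<Rightarrow> (nat \<Rightarrow> 'g \<Rightarrow> 'g) \<Rightarrow> nat \<Rightarrow> 'g monoid" where
  "cycles C d k = (C k)\<lparr>carrier :=
    (case k of 0 \<Rightarrow> carrier (C 0) | Suc j \<Rightarrow> kernel (C (Suc j)) (C j) (d j))\<rparr>"

definition boundaries :: "(nat \<Rightarrow> 'g monoid) \<Rightarrow> (nat \<Rightarrow> 'g \<Rightarrow> 'g) \<Rightarrow> nat \<Rightarrow> 'g set" where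
  "boundaries C d k = d k ` carrier (C (Suc k))"

definition homology :: "(nat \<Rightarrow> 'g monoid) \<Rightarrow> (nat \<Rightarrow> 'g \<Rightarrow> 'g) \<Rightarrow> nat \<Rightarrow> 'g set monoid" where
  "homology C d k = cycles C d k Mod boundaries C d k"


section \<open>Projective resolutions and Tor\<close>

record ('a, 'p, 'm) resolution =
  res_obj :: "nat \<Rightarrow> ('a, 'p) module"
  res_diff :: "nat \<Rightarrow> 'p \<Rightarrow> 'p"  \<comment> \<open>\<open>res_diff P k\<close> goes from degree \<open>Suc k\<close> to degree \<open>k\<close>\<close>
  res_aug :: "'p \<Rightarrow> 'm"

definition projective_resolution ::
  "('a, 'c) ring_scheme \<Rightarrow> ('a, 'm, 'd) module_scheme \<Rightarrow> ('a, 'p, 'm) resolution \<Rightarrow> bool" where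
  "projective_resolution A M P \<longleftrightarrow>
    (\<forall>k. projective_right_module A (res_obj P k)) \<and>
    (\<forall>k. res_diff P k \<in> linear_maps A (res_obj P (Suc k)) (res_obj P k)) \<and>
    res_aug P \<in> linear_maps A (res_obj P 0) M \<and>
    res_aug P ` carrier (res_obj P 0) = carrier M \<and>
    res_diff P 0 ` carrier (res_obj P (Suc 0)) =
      {x \<in> carrier (res_obj P 0). res_aug P x = \<zero>\<^bsub>M\<^esub>} \<and>
    (\<forall>k. res_diff P (Suc k) ` carrier (res_obj P (Suc (Suc k))) =
      {x \<in> carrier (res_obj P (Suc k)). res_diff P k x = \<zero>\<^bsub>res_obj P k\<^esub>})"

definition tensor_complex ::
  "('a, 'c) ring_scheme \<Rightarrow> ('a, 'p, 'm) resolution \<Rightarrow> ('a, 'n, 'e) module_scheme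
    \<Rightarrow> nat \<Rightarrow> ('p \<times> 'n \<Rightarrow>\<^sub>0 int) set monoid" where
  "tensor_complex A P N k = tensor A (res_obj P k) N"

definition tensor_diff ::
  "('a, 'c) ring_scheme \<Rightarrow> ('a, 'p, 'm) resolution \<Rightarrow> ('a, 'n, 'e) module_scheme
    \<Rightarrow> nat \<Rightarrow> ('p \<times> 'n \<Rightarrow>\<^sub>0 int) set \<Rightarrow> ('p \<times> 'n \<Rightarrow>\<^sub>0 int) set" where
  "tensor_diff A P N k = tensor_map A (res_obj P k) N (res_diff P k) (\<lambda>y. y)"

text \<open>
  \<open>Tor A P N k\<close> is the group \<open>Tor\<^sub>k\<close> over \<open>A\<close> of \<open>(M, N)\<close>, computed from a projective resolution
  \<open>P\<close> of the right module \<open>M\<close>.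
\<close>

definition Tor ::
  "('a, 'c) ring_scheme \<Rightarrow> ('a, 'p, 'm) resolution \<Rightarrow> ('a, 'n, 'e) module_scheme
    \<Rightarrow> nat \<Rightarrow> ('p \<times> 'n \<Rightarrow>\<^sub>0 int) set set monoid" where
  "Tor A P N = homology (tensor_complex A P N) (tensor_diff A P N)"

text \<open>
  Chain maps \<open>f\<close> from a resolution \<open>P\<close> of an \<open>A\<close>-module to a resolution \<open>Q\<close> of a \<open>B\<close>-module that
  are semilinear over \<open>\<phi> : A \<rightarrow> B\<close> and cover the map \<open>g\<close> between the resolved modules.
\<close>

definition covers ::
  "('a, 'c) ring_scheme \<Rightarrow> ('a \<Rightarrow> 'b) \<Rightarrow> ('m \<Rightarrow> 'm')
    \<Rightarrow> ('a, 'p, 'm) resolution \<Rightarrow> ('b, 'q, 'm') resolution \<Rightarrow> (nat \<Rightarrow> 'p \<Rightarrow> 'q) \<Rightarrow> bool" where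
  "covers A \<phi> g P Q f \<longleftrightarrow>
    (\<forall>k. f k \<in> semilinear A \<phi> (res_obj P k) (res_obj Q k)) \<and>
    (\<forall>k. \<forall>x\<in>carrier (res_obj P (Suc k)). f k (res_diff P k x) = res_diff Q k (f (Suc k) x)) \<and>
    (\<forall>x\<in>carrier (res_obj P 0). res_aug Q (f 0 x) = g (res_aug P x))"

text \<open>
  The map on Tor given by a chain map \<open>f\<close> of resolutions and a map \<open>h\<close> in the second variable;
  \<open>B\<close>, \<open>Q\<close>, \<open>N\<close> are the data of the target.
\<close>

definition Tor_map ::
  "('b, 'c) ring_scheme \<Rightarrow> ('b, 'q, 'm) resolution \<Rightarrow> ('b, 'n, 'e) module_scheme
    \<Rightarrow> (nat \<Rightarrow> 'p \<Rightarrow> 'q) \<Rightarrow> ('n' \<Rightarrow> 'n) \<Rightarrow> nat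
    \<Rightarrow> ('p \<times> 'n' \<Rightarrow>\<^sub>0 int) set set \<Rightarrow> ('q \<times> 'n \<Rightarrow>\<^sub>0 int) set set" where
  "Tor_map B Q N f h k =
    induced_map (cycles (tensor_complex B Q N) (tensor_diff B Q N) k)
      (boundaries (tensor_complex B Q N) (tensor_diff B Q N) k)
      (tensor_map B (res_obj Q k) N (f k) h)"

text \<open>If \<open>A\<close> is an \<open>R\<close>-algebra, then \<open>r \<in> R\<close> acts on Tor through \<open>p \<mapsto> p \<cdot> (r \<cdot> 1)\<close>.\<close>

definition Tor_scale ::
  "('r, 'a, 'c) module_scheme \<Rightarrow> ('a, 'p, 'm) resolution \<Rightarrow> ('a, 'n, 'e) module_scheme
    \<Rightarrow> 'r \<Rightarrow> nat \<Rightarrow> ('p \<times> 'n \<Rightarrow>\<^sub>0 int) set set \<Rightarrow> ('p \<times> 'n \<Rightarrow>\<^sub>0 int) set set" where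
  "Tor_scale A P N r =
    Tor_map A P N (\<lambda>k x. (r \<odot>\<^bsub>A\<^esub> \<one>\<^bsub>A\<^esub>) \<odot>\<^bsub>res_obj P k\<^esub> x) (\<lambda>y. y)"

definition Tor_module_iso ::
  "('r, 's) ring_scheme \<Rightarrow>
    ('r, 'a, 'c) module_scheme \<Rightarrow> ('a, 'p, 'm) resolution \<Rightarrow> ('a, 'n, 'e) module_scheme \<Rightarrow>
    ('r, 'b, 'd) module_scheme \<Rightarrow> ('b, 'q, 'm') resolution \<Rightarrow> ('b, 'n', 'e') module_scheme \<Rightarrow>
    nat \<Rightarrow> (('p \<times> 'n \<Rightarrow>\<^sub>0 int) set set \<Rightarrow> ('q \<times> 'n' \<Rightarrow>\<^sub>0 int) set set) \<Rightarrow> bool" where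
  "Tor_module_iso R A P N B Q N' k F \<longleftrightarrow>
    F \<in> iso (Tor A P N k) (Tor B Q N' k) \<and>
    (\<forall>r\<in>carrier R. \<forall>x\<in>carrier (Tor A P N k).
      F (Tor_scale A P N r k x) = Tor_scale B Q N' r k (F x))"


section \<open>The group algebra of a symmetric group\<close>

text \<open>
  An algebra over \<open>R\<close> is represented by its ring structure and the scalar multiplication by \<open>R\<close>;
  elements of an algebra that is free over \<open>R\<close> on a set are the functions giving the coefficients.
\<close>

definition sym_group_algebra ::
  "('r, 's) ring_scheme \<Rightarrow> nat \<Rightarrow> ('r, (nat \<Rightarrow> nat) \<Rightarrow> 'r) module" where
  "sym_group_algebra R n =
    \<lparr>carrier = fin_supp R (carrier (sym_group n)),
     monoid.mult = (\<lambda>x y u. finsum R (\<lambda>(g, h). x g \<otimes>\<^bsub>R\<^esub> y h)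
       {(g, h). g \<in> carrier (sym_group n) \<and> h \<in> carrier (sym_group n) \<and>
                g \<otimes>\<^bsub>sym_group n\<^esub> h = u}),
     one = (\<lambda>u. if u = \<one>\<^bsub>sym_group n\<^esub> then \<one>\<^bsub>R\<^esub> else \<zero>\<^bsub>R\<^esub>),
     ring.zero = (\<lambda>_. \<zero>\<^bsub>R\<^esub>), add = (\<lambda>x y u. x u \<oplus>\<^bsub>R\<^esub> y u), smult = (\<lambda>r x u. r \<otimes>\<^bsub>R\<^esub> x u)\<rparr>"


section \<open>The Brauer algebra\<close>

definition nodes :: "nat \<Rightarrow> int set" where
  "nodes n = {- int n .. -1} \<union> {1 .. int n}"

definition diagrams :: "nat \<Rightarrow> int set set set" where
  "diagrams n = {b. partition_on (nodes n) b \<and> (\<forall>e\<in>b. card e = 2)}"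

definition perm_diagram :: "nat \<Rightarrow> (nat \<Rightarrow> nat) \<Rightarrow> int set set" where
  "perm_diagram n g = (\<lambda>i. {- int (g i), int i}) ` {1..n}"

definition perm_diagrams :: "nat \<Rightarrow> int set set set" where
  "perm_diagrams n = perm_diagram n ` carrier (sym_group n)"

text \<open>
  To compose \<open>b\<close> and \<open>c\<close>, the diagrams are drawn in three columns: \<open>b\<close> between \<open>Lft\<close> and \<open>Mid\<close>,
  and \<open>c\<close> between \<open>Mid\<close> and \<open>Rgt\<close>.
\<close>

datatype column = Lft | Mid | Rgt

definition place :: "column \<Rightarrow> column \<Rightarrow> int \<Rightarrow> column \<times> int" where
  "place p q v = (if v < 0 then (p, - v) else (q, v))"

definition glued_arcs :: "int set set \<Rightarrow> int set set \<Rightarrow> (column \<times> int) set set" where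
  "glued_arcs b c = (\<lambda>e. place Lft Mid ` e) ` b \<union> (\<lambda>e. place Mid Rgt ` e) ` c"

definition joined :: "int set set \<Rightarrow> int set set \<Rightarrow> ((column \<times> int) \<times> (column \<times> int)) set" where
  "joined b c = {(x, y). {x, y} \<in> glued_arcs b c}\<^sup>*"

definition compose_diagrams :: "nat \<Rightarrow> int set set \<Rightarrow> int set set \<Rightarrow> int set set" where
  "compose_diagrams n b c =
    {{u, v} | u v. u \<in> nodes n \<and> v \<in> nodes n \<and> u \<noteq> v \<and>
      (place Lft Rgt u, place Lft Rgt v) \<in> joined b c}"

text \<open>Closed loops are the connected components all of whose nodes lie in the middle column.\<close>

definition loops :: "nat \<Rightarrow> int set set \<Rightarrow> int set set \<Rightarrow> nat" where
  "loops n b c =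
    card {joined b c `` {(Mid, i)} | i.
      i \<in> {1 .. int n} \<and> joined b c `` {(Mid, i)} \<subseteq> {Mid} \<times> UNIV}"

definition brauer_algebra ::
  "('r, 's) ring_scheme \<Rightarrow> nat \<Rightarrow> 'r \<Rightarrow> ('r, int set set \<Rightarrow> 'r) module" where
  "brauer_algebra R n \<delta> =
    \<lparr>carrier = fin_supp R (diagrams n),
     monoid.mult = (\<lambda>x y d. finsum R
       (\<lambda>(b, c). x b \<otimes>\<^bsub>R\<^esub> y c \<otimes>\<^bsub>R\<^esub> (\<delta> [^]\<^bsub>R\<^esub> loops n b c))
       {(b, c). b \<in> diagrams n \<and> c \<in> diagrams n \<and> compose_diagrams n b c = d}),
     one = (\<lambda>d. if d = perm_diagram n id then \<one>\<^bsub>R\<^esub> else \<zero>\<^bsub>R\<^esub>),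
     ring.zero = (\<lambda>_. \<zero>\<^bsub>R\<^esub>), add = (\<lambda>x y d. x d \<oplus>\<^bsub>R\<^esub> y d), smult = (\<lambda>r x d. r \<otimes>\<^bsub>R\<^esub> x d)\<rparr>"

definition brauer_incl ::
  "('r, 's) ring_scheme \<Rightarrow> nat \<Rightarrow> ((nat \<Rightarrow> nat) \<Rightarrow> 'r) \<Rightarrow> (int set set \<Rightarrow> 'r)" where
  "brauer_incl R n x =
    (\<lambda>d. \<Oplus>\<^bsub>R\<^esub>g\<in>{g \<in> carrier (sym_group n). perm_diagram n g = d}. x g)"

definition brauer_proj ::
  "('r, 's) ring_scheme \<Rightarrow> nat \<Rightarrow> (int set set \<Rightarrow> 'r) \<Rightarrow> ((nat \<Rightarrow> nat) \<Rightarrow> 'r)" where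
  "brauer_proj R n x =
    (\<lambda>g. if g \<in> carrier (sym_group n) then x (perm_diagram n g) else \<zero>\<^bsub>R\<^esub>)"


section \<open>The trivial modules\<close>

text \<open>
  Since \<open>R\<close> is commutative, the same record describes the trivial left and the trivial right
  module.
\<close>

definition triv_sym :: "('r, 's) ring_scheme \<Rightarrow> nat \<Rightarrow> ((nat \<Rightarrow> nat) \<Rightarrow> 'r, 'r) module" where
  "triv_sym R n =
    \<lparr>carrier = carrier R, monoid.mult = undefined, one = undefined,
     ring.zero = \<zero>\<^bsub>R\<^esub>, add = (\<lambda>s t. s \<oplus>\<^bsub>R\<^esub> t),
     smult = (\<lambda>x t. (\<Oplus>\<^bsub>R\<^esub>g\<in>carrier (sym_group n). x g) \<otimes>\<^bsub>R\<^esub> t)\<rparr>"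

definition triv_brauer :: "('r, 's) ring_scheme \<Rightarrow> nat \<Rightarrow> (int set set \<Rightarrow> 'r, 'r) module" where
  "triv_brauer R n =
    \<lparr>carrier = carrier R, monoid.mult = undefined, one = undefined,
     ring.zero = \<zero>\<^bsub>R\<^esub>, add = (\<lambda>s t. s \<oplus>\<^bsub>R\<^esub> t),
     smult = (\<lambda>x t. (\<Oplus>\<^bsub>R\<^esub>d\<in>perm_diagrams n. x d) \<otimes>\<^bsub>R\<^esub> t)\<rparr>"

end

theory Submission
  imports Defs
begin

text \<open>
  Let \<open>I\<close> be the kernel of \<open>\<pi>\<close>, spanned by the diagrams that are not permutations, and let \<open>Q\<close> be
  a projective resolution of the trivial right module over the Brauer algebra \<open>B\<close>.  Since
  \<open>\<pi> \<circ> \<iota> = id\<close>, the composite \<open>g \<circ> f\<close> is homotopic to the identity.  For \<open>f \<circ> g\<close> the key point is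
  that \<open>Q I\<close> is acyclic.  For a nonempty set \<open>T\<close> of arcs between right nodes, let \<open>L\<^sub>T\<close> be the left
  ideal spanned by the diagrams containing \<open>T\<close>.  If \<open>L\<^sub>T \<noteq> 0\<close>, let \<open>u\<close> be the symmetric diagram
  with arcs \<open>T\<close> on the right, \<open>-T\<close> on the left, and straight lines elsewhere; then \<open>b u = \<delta>\<^sup>k b\<close>
  with \<open>k = |T|\<close> for every diagram \<open>b\<close> containing \<open>T\<close>, so \<open>L\<^sub>T\<close> is generated by the
  idempotent \<open>\<delta>\<^sup>-\<^sup>k u\<close>, which acts as \<open>0\<close> on the trivial module, and \<open>Q L\<^sub>T\<close> is acyclic.  As
  \<open>I\<close> is the sum of the \<open>L\<^sub>T\<close> with \<open>|T| = 1\<close> and \<open>L\<^sub>T \<inter> L\<^sub>U = L\<^sub>T\<^sub>\<union>\<^sub>U\<close>, repeated Mayer--Vietoris arguments give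
  the claim.  Hence \<open>Q / Q I\<close> is exact in positive degrees, \<open>f \<circ> g\<close> is homotopic to the identity
  modulo \<open>Q I\<close>, and \<open>Q I\<close> vanishes in the tensor product with the trivial module.
\<close>

subsection \<open>Maps between quotient groups\<close>

text \<open>Here \<open>f\<close> and \<open>g\<close> are chain maps over \<open>\<iota>\<close>
  and \<open>\<pi>\<close>. Conceptually, \<open>Q / Q I\<close> is the base change of
  \<open>Q\<close> along \<open>\<pi>\<close>, and the acyclicity of \<open>Q I\<close> says that it
  resolves the trivial module over the group algebra.

  The ideal \<open>I\<close> does not come with an idempotent generator; only the pieces
  \<open>L_T\<close> do, once the factor \<open>\<delta>^k\<close> contributed by \<open>k\<close>
  closed loops is divided out. These pieces overlap. Since gluing acyclic pieces requires their
  intersections to be acyclic too, sets of several arcs enter although single arcs already span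
  \<open>I\<close>. The gluing also requires \<open>Q X \<inter> Q Y = Q (X \<inter> Y)\<close>,
  which fails for general modules and holds here because membership in \<open>Q X\<close> can be
  read off coordinates of a projective module.

  The composite \<open>f \<circ> g\<close> is semilinear over \<open>\<iota> \<circ> \<pi>\<close>,
  which is not the identity of \<open>B\<close>, so the usual comparison of resolutions does not
  apply to it. Instead of forming the quotient \<open>Q / Q I\<close>, the lifting arguments are
  carried out up to a congruence, which covers equality and congruence modulo \<open>Q I\<close> at
  once.\<close>

text \<open>The union in \<open>induced_map\<close> runs over all representatives of the coset.
  Since \<open>h\<close> maps \<open>L\<close> into \<open>K\<close>, they all contribute the same
  coset of \<open>K\<close>, and the union collapses to it.\<close>

lemma induced_map_coset:
  assumes "group H" "normal K G" "normal L H" "h \<in> hom H G" "h ` L \<subseteq> K" "x \<in> carrier H"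
  shows "induced_map G K h (L #>\<^bsub>H\<^esub> x) = K #>\<^bsub>G\<^esub> h x"
proof -
  interpret H: group H by fact
  interpret K: normal K G by fact
  interpret L: normal L H by fact
  have *: "K #>\<^bsub>G\<^esub> h (l \<otimes>\<^bsub>H\<^esub> x) = K #>\<^bsub>G\<^esub> h x" if "l \<in> L" for l
  proof -
    have l: "l \<in> carrier H" "h l \<in> K" "h l \<in> carrier G" "h x \<in> carrier G"
      using that assms(4,5,6) by (auto simp: hom_def)
    then have "K #>\<^bsub>G\<^esub> h (l \<otimes>\<^bsub>H\<^esub> x) = (K #>\<^bsub>G\<^esub> h l) #>\<^bsub>G\<^esub> h x"
      using assms(4,6) K.subset by (simp add: K.coset_mult_assoc hom_mult)
    also have "K #>\<^bsub>G\<^esub> h l = K"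
      using l K.rcos_const by blast
    finally show ?thesis .
  qed
  have "x = \<one>\<^bsub>H\<^esub> \<otimes>\<^bsub>H\<^esub> x" "\<one>\<^bsub>H\<^esub> \<in> L"
    using assms(6) by auto
  then show ?thesis
    using * unfolding induced_map_def r_coset_def [of H] by blast
qed

lemma induced_map_hom:
  assumes "group H" "normal K G" "normal L H" "h \<in> hom H G" "h ` L \<subseteq> K"
  shows "induced_map G K h \<in> hom (H Mod L) (G Mod K)"
proof -
  interpret H: group H by fact
  interpret K: normal K G by fact
  interpret L: normal L H by fact
  have c: "h x \<in> carrier G" if "x \<in> carrier H" for x
    using that assms(4) by (auto simp: hom_def)
  show ?thesis
    using assms(4) c
    by (auto intro!: homI simp: carrier_FactGroup induced_map_coset [OF assms] L.rcos_sum K.rcos_sum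
        hom_mult)
qed

subsection \<open>Homology of complexes of abelian groups\<close>

locale group_complex =
  fixes C :: "nat \<Rightarrow> 'g monoid" and d :: "nat \<Rightarrow> 'g \<Rightarrow> 'g"
  assumes comm: "comm_group (C k)"
    and d_hom: "d k \<in> hom (C (Suc k)) (C k)"
    and d_d: "x \<in> carrier (C (Suc (Suc k))) \<Longrightarrow> d k (d (Suc k) x) = \<one>\<^bsub>C k\<^esub>"
begin

lemma grp: "group (C k)"
  using comm comm_group_def by blast

lemma cycles_subgroup: "subgroup (carrier (cycles C d k)) (C k)"
proof (cases k)
  case 0
  then show ?thesis
    using group.subgroup_self [OF grp] by (simp add: cycles_def)
next
  case (Suc j)
  then have "group_hom (C k) (C j) (d j)"
    using grp d_hom by (auto simp: group_hom_def group_hom_axioms_def)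
  then show ?thesis
    using Suc group_hom.subgroup_kernel by (fastforce simp: cycles_def)
qed

lemma cycles_eq: "cycles C d k = (C k)\<lparr>carrier := carrier (cycles C d k)\<rparr>"
  by (simp add: cycles_def)

lemma cycles_comm: "comm_group (cycles C d k)"
proof (rule group.group_comm_groupI)
  show "Group.group (cycles C d k)"
    using subgroup.subgroup_is_group [OF cycles_subgroup grp] cycles_eq by metis
  show "x \<otimes>\<^bsub>cycles C d k\<^esub> y = y \<otimes>\<^bsub>cycles C d k\<^esub> x"
    if "x \<in> carrier (cycles C d k)" "y \<in> carrier (cycles C d k)" for x y
    using that comm_group.axioms(1) [OF comm] subgroup.subset [OF cycles_subgroup]
    by (auto simp: cycles_def intro: comm_monoid.m_comm)
qed

lemma cycles_carrier: "x \<in> carrier (cycles C d k) \<Longrightarrow> x \<in> carrier (C k)"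
  using subgroup.subset [OF cycles_subgroup] by blast

lemma cycles_mult [simp]: "monoid.mult (cycles C d k) = monoid.mult (C k)"
  by (simp add: cycles_def)

lemma boundaries_subgroup: "subgroup (boundaries C d k) (cycles C d k)"
proof -
  have h: "group_hom (C (Suc k)) (C k) (d k)"
    using grp d_hom by (auto simp: group_hom_def group_hom_axioms_def)
  have "subgroup (boundaries C d k) (C k)"
    unfolding boundaries_def
    by (rule group_hom.subgroup_img_is_subgroup [OF h group.subgroup_self [OF grp]])
  moreover have "boundaries C d k \<subseteq> carrier (cycles C d k)"
    using d_hom d_d by (auto simp: boundaries_def cycles_def kernel_def hom_def split: nat.split)
  ultimately show ?thesis
    using group.subgroup_incl [OF grp _ cycles_subgroup] cycles_eq by metis
qed

lemma boundaries_normal: "normal (boundaries C d k) (cycles C d k)"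
  using comm_group.normal_iff_subgroup [OF cycles_comm] boundaries_subgroup by blast

lemma homology_cases:
  assumes "x \<in> carrier (homology C d k)"
  obtains z where "z \<in> carrier (cycles C d k)" "x = boundaries C d k #>\<^bsub>cycles C d k\<^esub> z"
  using assms by (auto simp: homology_def carrier_FactGroup)

end

section \<open>Maps on homology\<close>

definition homology_map ::
  "(nat \<Rightarrow> 'g monoid) \<Rightarrow> (nat \<Rightarrow> 'g \<Rightarrow> 'g) \<Rightarrow> (nat \<Rightarrow> 'f \<Rightarrow> 'g) \<Rightarrow> nat \<Rightarrow> 'f set \<Rightarrow> 'g set" where
  "homology_map C d \<phi> k = induced_map (cycles C d k) (boundaries C d k) (\<phi> k)"

locale group_complex_map = X: group_complex C d + Y: group_complex C' d'
  for C :: "nat \<Rightarrow> 'g monoid" and d and C' :: "nat \<Rightarrow> 'h monoid" and d' +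
  fixes \<phi> :: "nat \<Rightarrow> 'g \<Rightarrow> 'h"
  assumes map_hom: "\<phi> k \<in> hom (C k) (C' k)"
    and map_d: "x \<in> carrier (C (Suc k)) \<Longrightarrow> \<phi> k (d k x) = d' k (\<phi> (Suc k) x)"
begin

lemma map_closed: "x \<in> carrier (C k) \<Longrightarrow> \<phi> k x \<in> carrier (C' k)"
  using map_hom by (auto simp: hom_def)

lemma map_one: "\<phi> k \<one>\<^bsub>C k\<^esub> = \<one>\<^bsub>C' k\<^esub>"
  using hom_one [OF map_hom X.grp Y.grp] .

lemma map_cycles:
  assumes "z \<in> carrier (cycles C d k)" shows "\<phi> k z \<in> carrier (cycles C' d' k)"
proof (cases k)
  case 0
  with assms show ?thesis by (simp add: cycles_def map_closed)
next
  case (Suc j)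
  then have "z \<in> carrier (C k)" "d j z = \<one>\<^bsub>C j\<^esub>"
    using assms by (auto simp: cycles_def kernel_def)
  then show ?thesis
    using Suc map_d [of z j] by (simp add: cycles_def kernel_def map_closed map_one)
qed

lemma map_cycles_hom: "\<phi> k \<in> hom (cycles C d k) (cycles C' d' k)"
  using map_cycles map_hom X.cycles_carrier by (auto simp: hom_def)

lemma map_boundaries: "\<phi> k ` boundaries C d k \<subseteq> boundaries C' d' k"
  by (auto simp: boundaries_def map_d intro!: imageI map_closed)

lemmas coset_prems = comm_group.axioms(2) [OF X.cycles_comm] Y.boundaries_normal
  X.boundaries_normal map_cycles_hom map_boundaries

lemma homology_map_hom: "homology_map C' d' \<phi> k \<in> hom (homology C d k) (homology C' d' k)"
  unfolding homology_map_def homology_def by (rule induced_map_hom [OF coset_prems])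

lemma homology_map_coset:
  assumes "z \<in> carrier (cycles C d k)"
  shows "homology_map C' d' \<phi> k (boundaries C d k #>\<^bsub>cycles C d k\<^esub> z)
    = boundaries C' d' k #>\<^bsub>cycles C' d' k\<^esub> \<phi> k z"
  unfolding homology_map_def by (rule induced_map_coset [OF coset_prems assms])

end

lemma homology_map_comp:
  assumes "group_complex_map C d C' d' \<phi>" "group_complex_map C' d' C'' d'' \<psi>"
    and "x \<in> carrier (homology C d k)"
  shows "homology_map C'' d'' \<psi> k (homology_map C' d' \<phi> k x)
    = homology_map C'' d'' (\<lambda>j c. \<psi> j (\<phi> j c)) k x"
proof -
  interpret f: group_complex_map C d C' d' \<phi> by fact
  interpret g: group_complex_map C' d' C'' d'' \<psi> by fact
  interpret gf: group_complex_map C d C'' d'' "\<lambda>j c. \<psi> j (\<phi> j c)"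
  proof
    show "(\<lambda>c. \<psi> j (\<phi> j c)) \<in> hom (C j) (C'' j)" for j
      using hom_compose [OF f.map_hom g.map_hom] by (simp add: comp_def)
  qed (simp add: f.map_d g.map_d f.map_closed)
  from assms(3) obtain z
    where "z \<in> carrier (cycles C d k)" "x = boundaries C d k #>\<^bsub>cycles C d k\<^esub> z"
    by (rule f.X.homology_cases)
  then show ?thesis
    by (simp add: f.homology_map_coset g.homology_map_coset gf.homology_map_coset f.map_cycles)
qed

text \<open>For a chain homotopy \<open>\<phi> - id = d s + s d\<close> the term \<open>s d\<close>
  vanishes on cycles, so all that has to be supplied is one element \<open>w\<close> for each cycle
  of the given degree.\<close>

lemma (in group_complex) homology_map_homotopic_id:
  assumes "group_complex_map C d C d \<phi>"
    and "\<And>z. z \<in> carrier (cycles C d k) \<Longrightarrow> \<exists>w\<in>carrier (C (Suc k)). \<phi> k z = d k w \<otimes>\<^bsub>C k\<^esub> z"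
    and "x \<in> carrier (homology C d k)"
  shows "homology_map C d \<phi> k x = x"
proof -
  interpret f: group_complex_map C d C d \<phi> by fact
  interpret cyc: comm_group "cycles C d k" by (rule cycles_comm)
  interpret b: normal "boundaries C d k" "cycles C d k" by (rule boundaries_normal)
  from assms(3) obtain z
    where z: "z \<in> carrier (cycles C d k)" "x = boundaries C d k #>\<^bsub>cycles C d k\<^esub> z"
    by (rule homology_cases)
  obtain w where w: "w \<in> carrier (C (Suc k))" "\<phi> k z = d k w \<otimes>\<^bsub>C k\<^esub> z"
    using assms(2) [OF z(1)] by blast
  have "d k w \<in> boundaries C d k"
    using w by (simp add: boundaries_def)
  then have "boundaries C d k #>\<^bsub>cycles C d k\<^esub> (d k w \<otimes>\<^bsub>cycles C d k\<^esub> z)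
      = boundaries C d k #>\<^bsub>cycles C d k\<^esub> z"
    using cyc.coset_mult_assoc [OF b.subset b.mem_carrier z(1)] b.rcos_const by simp
  then show ?thesis
    using z w by (simp add: f.homology_map_coset)
qed

text \<open>Chain maps that are equal on paper are HOL functions that may differ outside the
  carriers; this lemma bridges the gap.\<close>

lemma homology_map_cong:
  assumes "group_complex_map C d C' d' \<phi>" "group_complex_map C d C' d' \<psi>"
    and "\<And>z. z \<in> carrier (C k) \<Longrightarrow> \<phi> k z = \<psi> k z"
    and "x \<in> carrier (homology C d k)"
  shows "homology_map C' d' \<phi> k x = homology_map C' d' \<psi> k x"
proof -
  interpret f: group_complex_map C d C' d' \<phi> by fact
  interpret g: group_complex_map C d C' d' \<psi> by fact
  from assms(4) obtain z
    where "z \<in> carrier (cycles C d k)" "x = boundaries C d k #>\<^bsub>cycles C d k\<^esub> z"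
    by (rule f.X.homology_cases)
  then show ?thesis
    by (simp add: f.homology_map_coset g.homology_map_coset assms(3) f.X.cycles_carrier)
qed

subsection \<open>Tensor products\<close>

lemma keys_add_subset:
  "\<lbrakk>Poly_Mapping.keys a \<subseteq> S; Poly_Mapping.keys b \<subseteq> S\<rbrakk> \<Longrightarrow> Poly_Mapping.keys (a + b) \<subseteq> S"
  using keys_add [of a b] by blast

lemma keys_diff_subset:
  "\<lbrakk>Poly_Mapping.keys a \<subseteq> S; Poly_Mapping.keys b \<subseteq> S\<rbrakk> \<Longrightarrow> Poly_Mapping.keys (a - b) \<subseteq> S"
  using keys_diff [of a b] by blast

definition pure_tensor ::
  "('a, 'c) ring_scheme \<Rightarrow> ('a, 'm, 'd) module_scheme \<Rightarrow> ('a, 'n, 'e) module_scheme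
    \<Rightarrow> 'm \<Rightarrow> 'n \<Rightarrow> ('m \<times> 'n \<Rightarrow>\<^sub>0 int) set" where
  "pure_tensor A M N x y =
    tensor_relations A M N #>\<^bsub>free_Abelian_group (carrier M \<times> carrier N)\<^esub> frag_of (x, y)"

text \<open>The closure conditions on \<open>N\<close> keep the defining relations inside the free
  abelian group on \<open>carrier M \<times> carrier N\<close>.\<close>

locale tensor_pair = M: right_module A M
  for A :: "('a, 'c) ring_scheme" and M :: "('a, 'm, 'd) module_scheme" +
  fixes N :: "('a, 'n, 'e) module_scheme"
  assumes N_monoid: "abelian_monoid N"
    and N_act: "\<lbrakk>a \<in> carrier A; y \<in> carrier N\<rbrakk> \<Longrightarrow> a \<odot>\<^bsub>N\<^esub> y \<in> carrier N"
begin

sublocale N: abelian_monoid N by (rule N_monoid)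

abbreviation "F \<equiv> free_Abelian_group (carrier M \<times> carrier N)"
abbreviation "K \<equiv> tensor_relations A M N"

sublocale F: comm_group F by (rule abelian_free_Abelian_group)

lemma relations_subgroup: "subgroup K F"
  unfolding tensor_relations_def
proof (rule F.generate_is_subgroup, intro Un_least subsetI, goal_cases)
  case (1 z)
  then show ?case by (elim CollectE exE conjE) (simp add: keys_diff_subset)
next
  case (2 z)
  then show ?case by (elim CollectE exE conjE) (simp add: keys_diff_subset)
next
  case (3 z)
  then show ?case by (elim CollectE exE conjE) (simp add: M.act_closed N_act keys_diff_subset)
qed

sublocale K: normal K F
  using relations_subgroup F.normal_iff_subgroup by blast

lemma tensor_comm_group: "comm_group (tensor A M N)"
  unfolding tensor_def using relations_subgroup by (rule F.abelian_FactGroup)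

lemma tensor_cases:
  assumes "c \<in> carrier (tensor A M N)"
  obtains z where "z \<in> carrier F" "c = K #>\<^bsub>F\<^esub> z"
  using assms by (auto simp: tensor_def carrier_FactGroup)

lemma coset_hom: "(\<lambda>z. K #>\<^bsub>F\<^esub> z) \<in> hom F (tensor A M N)"
  unfolding tensor_def by (rule K.r_coset_hom_Mod)

lemma coset_eqI:
  assumes "x \<in> carrier F" "y \<in> carrier F" "x - y \<in> K"
  shows "K #>\<^bsub>F\<^esub> x = K #>\<^bsub>F\<^esub> y"
proof -
  have "K #>\<^bsub>F\<^esub> x = K #>\<^bsub>F\<^esub> ((x - y) \<otimes>\<^bsub>F\<^esub> y)"
    by simp
  also have "\<dots> = (K #>\<^bsub>F\<^esub> (x - y)) #>\<^bsub>F\<^esub> y"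
    by (rule F.coset_mult_assoc [symmetric]) (use assms K.subset in \<open>simp_all add: keys_diff_subset\<close>)
  also have "\<dots> = K #>\<^bsub>F\<^esub> y"
    using assms K.rcos_const by simp
  finally show ?thesis .
qed

lemma pure_closed:
  "\<lbrakk>x \<in> carrier M; y \<in> carrier N\<rbrakk> \<Longrightarrow> pure_tensor A M N x y \<in> carrier (tensor A M N)"
  unfolding pure_tensor_def using coset_hom by (auto simp: hom_def)

lemma coset_mult:
  "\<lbrakk>x \<in> carrier F; y \<in> carrier F\<rbrakk> \<Longrightarrow>
    (K #>\<^bsub>F\<^esub> x) \<otimes>\<^bsub>tensor A M N\<^esub> (K #>\<^bsub>F\<^esub> y) = K #>\<^bsub>F\<^esub> (x + y)"
  using hom_mult [OF coset_hom] by force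

lemma pure_add_left:
  assumes "x \<in> carrier M" "x' \<in> carrier M" "y \<in> carrier N"
  shows "pure_tensor A M N (x \<oplus>\<^bsub>M\<^esub> x') y
    = pure_tensor A M N x y \<otimes>\<^bsub>tensor A M N\<^esub> pure_tensor A M N x' y"
proof -
  have "frag_of (x \<oplus>\<^bsub>M\<^esub> x', y) - frag_of (x, y) - frag_of (x', y) \<in> K"
    unfolding tensor_relations_def by (rule generate.incl) (use assms in blast)
  then show ?thesis
    unfolding pure_tensor_def using assms
    by (simp add: coset_mult coset_eqI diff_diff_eq keys_add_subset)
qed

lemma pure_add_right:
  assumes "x \<in> carrier M" "y \<in> carrier N" "y' \<in> carrier N"
  shows "pure_tensor A M N x (y \<oplus>\<^bsub>N\<^esub> y')
    = pure_tensor A M N x y \<otimes>\<^bsub>tensor A M N\<^esub> pure_tensor A M N x y'"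
proof -
  have "frag_of (x, y \<oplus>\<^bsub>N\<^esub> y') - frag_of (x, y) - frag_of (x, y') \<in> K"
    unfolding tensor_relations_def by (rule generate.incl) (use assms in blast)
  then show ?thesis
    unfolding pure_tensor_def using assms
    by (simp add: coset_mult coset_eqI diff_diff_eq keys_add_subset)
qed

lemma pure_act:
  assumes "a \<in> carrier A" "x \<in> carrier M" "y \<in> carrier N"
  shows "pure_tensor A M N (a \<odot>\<^bsub>M\<^esub> x) y = pure_tensor A M N x (a \<odot>\<^bsub>N\<^esub> y)"
proof -
  have "frag_of (a \<odot>\<^bsub>M\<^esub> x, y) - frag_of (x, a \<odot>\<^bsub>N\<^esub> y) \<in> K"
    unfolding tensor_relations_def by (rule generate.incl) (use assms in blast)
  then show ?thesis
    unfolding pure_tensor_def using assms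
    by (intro coset_eqI) (auto simp: M.act_closed N_act)
qed

lemma pure_zero_left:
  assumes "y \<in> carrier N"
  shows "pure_tensor A M N \<zero>\<^bsub>M\<^esub> y = \<one>\<^bsub>tensor A M N\<^esub>"
proof -
  interpret T: comm_group "tensor A M N" by (rule tensor_comm_group)
  show ?thesis
    using pure_add_left [of "\<zero>\<^bsub>M\<^esub>" "\<zero>\<^bsub>M\<^esub>" y] pure_closed [of "\<zero>\<^bsub>M\<^esub>" y] assms by simp
qed

lemma pure_zero_right:
  assumes "x \<in> carrier M"
  shows "pure_tensor A M N x \<zero>\<^bsub>N\<^esub> = \<one>\<^bsub>tensor A M N\<^esub>"
proof -
  interpret T: comm_group "tensor A M N" by (rule tensor_comm_group)
  show ?thesis
    using pure_add_right [of x "\<zero>\<^bsub>N\<^esub>" "\<zero>\<^bsub>N\<^esub>"] pure_closed [of x "\<zero>\<^bsub>N\<^esub>"] assms by simp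
qed

text \<open>Pure tensors generate the tensor product. Identities between maps of tensored complexes
  are checked through this lemma and not on representatives.\<close>

lemma tensor_hom_eqI:
  assumes G: "group G" and \<phi>: "\<phi> \<in> hom (tensor A M N) G" and \<psi>: "\<psi> \<in> hom (tensor A M N) G"
    and eq: "\<And>x y. \<lbrakk>x \<in> carrier M; y \<in> carrier N\<rbrakk> \<Longrightarrow>
      \<phi> (pure_tensor A M N x y) = \<psi> (pure_tensor A M N x y)"
    and c: "c \<in> carrier (tensor A M N)"
  shows "\<phi> c = \<psi> c"
proof -
  obtain z where z: "z \<in> carrier F" "c = K #>\<^bsub>F\<^esub> z"
    using c by (rule tensor_cases)
  interpret G: group G by (rule G)
  interpret f: group_hom F G "\<lambda>z. \<phi> (K #>\<^bsub>F\<^esub> z)"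
    using hom_compose [OF coset_hom \<phi>] by unfold_locales (simp add: comp_def)
  interpret g: group_hom F G "\<lambda>z. \<psi> (K #>\<^bsub>F\<^esub> z)"
    using hom_compose [OF coset_hom \<psi>] by unfold_locales (simp add: comp_def)
  have "\<phi> (K #>\<^bsub>F\<^esub> z) = \<psi> (K #>\<^bsub>F\<^esub> z)"
    if "Poly_Mapping.keys z \<subseteq> carrier M \<times> carrier N" for z
    using that
  proof (induction rule: free_Abelian_group_induct [consumes 1, case_names zero diff of])
    case zero
    show ?case using f.hom_one g.hom_one by simp
  next
    case (diff x y)
    then have "x - y = x \<otimes>\<^bsub>F\<^esub> inv\<^bsub>F\<^esub> y" "x \<in> carrier F" "y \<in> carrier F" "inv\<^bsub>F\<^esub> y \<in> carrier F"
      by auto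
    then show ?case
      using diff f.hom_mult [of x "inv\<^bsub>F\<^esub> y"] g.hom_mult [of x "inv\<^bsub>F\<^esub> y"]
      by (metis f.hom_inv g.hom_inv)
  next
    case (of a)
    then show ?case using eq by (cases a) (auto simp: pure_tensor_def)
  qed
  then show ?thesis using z by auto
qed

end

section \<open>Functoriality of the tensor product under change of rings\<close>

locale tensor_pair_map = S: tensor_pair A M N + T: tensor_pair B M' N'
  for A :: "('a, 'c) ring_scheme" and M :: "('a, 'm, 'd) module_scheme"
    and N :: "('a, 'n, 'e) module_scheme"
    and B :: "('b, 'c') ring_scheme" and M' :: "('b, 'm', 'd') module_scheme"
    and N' :: "('b, 'n', 'e') module_scheme" +
  fixes \<phi> :: "'a \<Rightarrow> 'b" and f :: "'m \<Rightarrow> 'm'" and h :: "'n \<Rightarrow> 'n'"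
  assumes \<phi>_closed: "a \<in> carrier A \<Longrightarrow> \<phi> a \<in> carrier B"
    and f_semilinear: "f \<in> semilinear A \<phi> M M'"
    and h_closed: "y \<in> carrier N \<Longrightarrow> h y \<in> carrier N'"
    and h_add: "\<lbrakk>y \<in> carrier N; y' \<in> carrier N\<rbrakk> \<Longrightarrow> h (y \<oplus>\<^bsub>N\<^esub> y') = h y \<oplus>\<^bsub>N'\<^esub> h y'"
    and h_act: "\<lbrakk>a \<in> carrier A; y \<in> carrier N\<rbrakk> \<Longrightarrow> h (a \<odot>\<^bsub>N\<^esub> y) = \<phi> a \<odot>\<^bsub>N'\<^esub> h y"
begin

lemma f_closed: "x \<in> carrier M \<Longrightarrow> f x \<in> carrier M'"
  and f_add: "\<lbrakk>x \<in> carrier M; x' \<in> carrier M\<rbrakk> \<Longrightarrow> f (x \<oplus>\<^bsub>M\<^esub> x') = f x \<oplus>\<^bsub>M'\<^esub> f x'"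
  and f_act: "\<lbrakk>a \<in> carrier A; x \<in> carrier M\<rbrakk> \<Longrightarrow> f (a \<odot>\<^bsub>M\<^esub> x) = \<phi> a \<odot>\<^bsub>M'\<^esub> f x"
  using f_semilinear by (auto simp: semilinear_def)

abbreviation "e \<equiv> frag_extend (\<lambda>(x, y). frag_of (f x, h y))"

lemma e_closed: "z \<in> carrier S.F \<Longrightarrow> e z \<in> carrier T.F"
  by (auto dest!: subsetD [OF keys_frag_extend] simp: f_closed h_closed dest: subsetD split: prod.splits)

lemma e_hom: "e \<in> hom S.F T.F"
  using e_closed by (auto intro!: homI simp: frag_extend_add)

text \<open>The preimage of \<open>T.K\<close> is a subgroup, so the generators of
  \<open>S.K\<close> suffice, and each of them goes to a relation of the same kind. For the third
  kind it matters that \<open>f\<close> and \<open>h\<close> are semilinear over the same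
  \<open>\<phi>\<close>.\<close>

lemma e_relations: "e ` S.K \<subseteq> T.K"
proof -
  interpret e: group_hom S.F T.F e
    using e_hom by unfold_locales
  have mem: "r \<in> T.K" if "r \<in>
    ({frag_of (x \<oplus>\<^bsub>M'\<^esub> x', y) - frag_of (x, y) - frag_of (x', y) | x x' y.
        x \<in> carrier M' \<and> x' \<in> carrier M' \<and> y \<in> carrier N'} \<union>
     {frag_of (x, y \<oplus>\<^bsub>N'\<^esub> y') - frag_of (x, y) - frag_of (x, y') | x y y'.
        x \<in> carrier M' \<and> y \<in> carrier N' \<and> y' \<in> carrier N'} \<union>
     {frag_of (a \<odot>\<^bsub>M'\<^esub> x, y) - frag_of (x, a \<odot>\<^bsub>N'\<^esub> y) | a x y.
        a \<in> carrier B \<and> x \<in> carrier M' \<and> y \<in> carrier N'})" for r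
    using that unfolding tensor_relations_def by (rule generate.incl)
  have "S.K \<subseteq> {z \<in> carrier S.F. e z \<in> T.K}"
    unfolding tensor_relations_def [of A]
  proof (rule S.F.generate_subgroup_incl)
    show "subgroup {z \<in> carrier S.F. e z \<in> T.K} S.F"
    proof (rule S.F.subgroupI)
      show "{z \<in> carrier S.F. e z \<in> T.K} \<noteq> {}"
        using T.K.one_closed by (auto intro!: exI [of _ 0])
      fix z assume z: "z \<in> {z \<in> carrier S.F. e z \<in> T.K}"
      then show "inv\<^bsub>S.F\<^esub> z \<in> {z \<in> carrier S.F. e z \<in> T.K}"
        using e.hom_inv [of z] T.K.m_inv_closed [of "e z"] S.F.inv_closed [of z]
        by (simp del: inv_free_Abelian_group)
      fix w assume "w \<in> {z \<in> carrier S.F. e z \<in> T.K}"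
      then show "z \<otimes>\<^bsub>S.F\<^esub> w \<in> {z \<in> carrier S.F. e z \<in> T.K}"
        using z e.hom_mult [of z w] T.K.m_closed [of "e z" "e w"] S.F.m_closed [of z w]
        by (simp del: mult_free_Abelian_group)
    qed auto
    show "{frag_of (x \<oplus>\<^bsub>M\<^esub> x', y) - frag_of (x, y) - frag_of (x', y) | x x' y.
        x \<in> carrier M \<and> x' \<in> carrier M \<and> y \<in> carrier N} \<union>
     {frag_of (x, y \<oplus>\<^bsub>N\<^esub> y') - frag_of (x, y) - frag_of (x, y') | x y y'.
        x \<in> carrier M \<and> y \<in> carrier N \<and> y' \<in> carrier N} \<union>
     {frag_of (a \<odot>\<^bsub>M\<^esub> x, y) - frag_of (x, a \<odot>\<^bsub>N\<^esub> y) | a x y.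
        a \<in> carrier A \<and> x \<in> carrier M \<and> y \<in> carrier N} \<subseteq> {z \<in> carrier S.F. e z \<in> T.K}"
      (is "?X \<union> ?Y \<union> ?Z \<subseteq> _")
    proof (intro Un_least subsetI)
      fix z assume "z \<in> ?X"
      then obtain x x' y where *: "z = frag_of (x \<oplus>\<^bsub>M\<^esub> x', y) - frag_of (x, y) - frag_of (x', y)"
        "x \<in> carrier M" "x' \<in> carrier M" "y \<in> carrier N" by blast
      then have "e z = frag_of (f x \<oplus>\<^bsub>M'\<^esub> f x', h y) - frag_of (f x, h y) - frag_of (f x', h y)"
        by (simp add: frag_extend_diff f_add)
      then have "e z \<in> T.K"
        using * f_closed h_closed by (intro mem) blast
      with * show "z \<in> {z \<in> carrier S.F. e z \<in> T.K}"
        by (simp add: keys_diff_subset)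
    next
      fix z assume "z \<in> ?Y"
      then obtain x y y' where *: "z = frag_of (x, y \<oplus>\<^bsub>N\<^esub> y') - frag_of (x, y) - frag_of (x, y')"
        "x \<in> carrier M" "y \<in> carrier N" "y' \<in> carrier N" by blast
      then have "e z = frag_of (f x, h y \<oplus>\<^bsub>N'\<^esub> h y') - frag_of (f x, h y) - frag_of (f x, h y')"
        by (simp add: frag_extend_diff h_add)
      then have "e z \<in> T.K"
        using * f_closed h_closed by (intro mem) blast
      with * show "z \<in> {z \<in> carrier S.F. e z \<in> T.K}"
        by (simp add: keys_diff_subset)
    next
      fix z assume "z \<in> ?Z"
      then obtain a x y where *: "z = frag_of (a \<odot>\<^bsub>M\<^esub> x, y) - frag_of (x, a \<odot>\<^bsub>N\<^esub> y)"
        "a \<in> carrier A" "x \<in> carrier M" "y \<in> carrier N" by blast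
      then have "e z = frag_of (\<phi> a \<odot>\<^bsub>M'\<^esub> f x, h y) - frag_of (f x, \<phi> a \<odot>\<^bsub>N'\<^esub> h y)"
        by (simp add: frag_extend_diff h_act f_act)
      then have "e z \<in> T.K"
        using * f_closed h_closed \<phi>_closed by (intro mem) blast
      with * show "z \<in> {z \<in> carrier S.F. e z \<in> T.K}"
        by (simp add: S.M.act_closed S.N_act keys_diff_subset)
    qed
  qed
  then show ?thesis by blast
qed

lemmas coset_prems = S.F.is_group T.K.normal_axioms S.K.normal_axioms e_hom e_relations

lemma tensor_map_hom: "tensor_map B M' N' f h \<in> hom (tensor A M N) (tensor B M' N')"
  unfolding tensor_map_def tensor_def by (rule induced_map_hom [OF coset_prems])

lemma tensor_map_pure:
  assumes "x \<in> carrier M" "y \<in> carrier N"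
  shows "tensor_map B M' N' f h (pure_tensor A M N x y) = pure_tensor B M' N' (f x) (h y)"
  unfolding tensor_map_def pure_tensor_def
  using assms by (subst induced_map_coset [OF coset_prems]) auto

end

subsection \<open>Functoriality of Tor\<close>

text \<open>Functoriality is a matter of chain complexes; exactness and projectivity come in where
  chain maps and homotopies are constructed.\<close>

locale tensor_resolution =
  fixes A :: "('a, 'c) ring_scheme" and P :: "('a, 'p, 'm) resolution"
    and N :: "('a, 'n, 'e) module_scheme"
  assumes pair: "tensor_pair A (res_obj P k) N"
    and diff: "res_diff P k \<in> linear_maps A (res_obj P (Suc k)) (res_obj P k)"
    and diff_diff: "x \<in> carrier (res_obj P (Suc (Suc k))) \<Longrightarrow>
      res_diff P k (res_diff P (Suc k) x) = \<zero>\<^bsub>res_obj P k\<^esub>"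
begin

lemma diff_closed: "x \<in> carrier (res_obj P (Suc k)) \<Longrightarrow> res_diff P k x \<in> carrier (res_obj P k)"
  using diff [of k] by (auto simp: semilinear_def)

lemma diff_pair_map:
  "tensor_pair_map A (res_obj P (Suc k)) N A (res_obj P k) N (\<lambda>a. a) (res_diff P k) (\<lambda>y. y)"
  using pair diff by (simp add: tensor_pair_map_def tensor_pair_map_axioms_def)

sublocale C: group_complex "tensor_complex A P N" "tensor_diff A P N"
proof (rule group_complex.intro)
  fix k
  interpret T: tensor_pair A "res_obj P k" N by (rule pair)
  show "comm_group (tensor_complex A P N k)"
    unfolding tensor_complex_def by (rule T.tensor_comm_group)
  interpret d: tensor_pair_map A "res_obj P (Suc k)" N A "res_obj P k" N
    "\<lambda>a. a" "res_diff P k" "\<lambda>y. y" by (rule diff_pair_map)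
  show d_hom: "tensor_diff A P N k \<in> hom (tensor_complex A P N (Suc k)) (tensor_complex A P N k)"
    unfolding tensor_complex_def tensor_diff_def by (rule d.tensor_map_hom)
  interpret d': tensor_pair_map A "res_obj P (Suc (Suc k))" N A "res_obj P (Suc k)" N
    "\<lambda>a. a" "res_diff P (Suc k)" "\<lambda>y. y" by (rule diff_pair_map)
  interpret G: comm_group "tensor A (res_obj P k) N" by (rule T.tensor_comm_group)
  fix c assume "c \<in> carrier (tensor_complex A P N (Suc (Suc k)))"
  then have c: "c \<in> carrier (tensor A (res_obj P (Suc (Suc k))) N)"
    by (simp add: tensor_complex_def)
  show "tensor_diff A P N k (tensor_diff A P N (Suc k) c) = \<one>\<^bsub>tensor_complex A P N k\<^esub>"
    unfolding tensor_diff_def tensor_complex_def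
  proof (rule tensor_pair.tensor_hom_eqI [OF pair G.is_group _ _ _ c])
    show "(\<lambda>c. tensor_map A (res_obj P k) N (res_diff P k) (\<lambda>y. y)
        (tensor_map A (res_obj P (Suc k)) N (res_diff P (Suc k)) (\<lambda>y. y) c))
      \<in> hom (tensor A (res_obj P (Suc (Suc k))) N) (tensor A (res_obj P k) N)"
      using hom_compose [OF d'.tensor_map_hom d.tensor_map_hom] by (simp add: comp_def)
    show "(\<lambda>c. \<one>\<^bsub>tensor A (res_obj P k) N\<^esub>)
      \<in> hom (tensor A (res_obj P (Suc (Suc k))) N) (tensor A (res_obj P k) N)"
      by (auto intro: homI)
  qed (simp add: d'.tensor_map_pure d.tensor_map_pure d'.f_closed diff_diff T.pure_zero_left)
qed

end

locale tensor_chain_map = S: tensor_resolution A P N + T: tensor_resolution B Q N'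
  for A :: "('a, 'c) ring_scheme" and P :: "('a, 'p, 'm) resolution"
    and N :: "('a, 'n, 'e) module_scheme"
    and B :: "('b, 'c') ring_scheme" and Q :: "('b, 'q, 'm') resolution"
    and N' :: "('b, 'n', 'e') module_scheme" +
  fixes \<phi> :: "'a \<Rightarrow> 'b" and f :: "nat \<Rightarrow> 'p \<Rightarrow> 'q" and h :: "'n \<Rightarrow> 'n'"
  assumes \<phi>_closed: "a \<in> carrier A \<Longrightarrow> \<phi> a \<in> carrier B"
    and f_semilinear: "f k \<in> semilinear A \<phi> (res_obj P k) (res_obj Q k)"
    and f_diff: "x \<in> carrier (res_obj P (Suc k)) \<Longrightarrow> f k (res_diff P k x) = res_diff Q k (f (Suc k) x)"
    and h_closed: "y \<in> carrier N \<Longrightarrow> h y \<in> carrier N'"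
    and h_add: "\<lbrakk>y \<in> carrier N; y' \<in> carrier N\<rbrakk> \<Longrightarrow> h (y \<oplus>\<^bsub>N\<^esub> y') = h y \<oplus>\<^bsub>N'\<^esub> h y'"
    and h_act: "\<lbrakk>a \<in> carrier A; y \<in> carrier N\<rbrakk> \<Longrightarrow> h (a \<odot>\<^bsub>N\<^esub> y) = \<phi> a \<odot>\<^bsub>N'\<^esub> h y"
begin

lemma f_closed: "x \<in> carrier (res_obj P k) \<Longrightarrow> f k x \<in> carrier (res_obj Q k)"
  using f_semilinear [of k] by (auto simp: semilinear_def)

sublocale f: tensor_pair_map A "res_obj P k" N B "res_obj Q k" N' \<phi> "f k" h for k
  using S.pair T.pair f_semilinear \<phi>_closed h_closed h_add h_act
  by (simp add: tensor_pair_map_def tensor_pair_map_axioms_def)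

sublocale C: group_complex_map "tensor_complex A P N" "tensor_diff A P N"
  "tensor_complex B Q N'" "tensor_diff B Q N'" "\<lambda>k. tensor_map B (res_obj Q k) N' (f k) h"
proof
  fix k
  show "tensor_map B (res_obj Q k) N' (f k) h \<in> hom (tensor_complex A P N k) (tensor_complex B Q N' k)"
    unfolding tensor_complex_def by (rule f.tensor_map_hom)
  fix c assume "c \<in> carrier (tensor_complex A P N (Suc k))"
  then have c: "c \<in> carrier (tensor A (res_obj P (Suc k)) N)"
    by (simp add: tensor_complex_def)
  interpret d: tensor_pair_map A "res_obj P (Suc k)" N A "res_obj P k" N
    "\<lambda>a. a" "res_diff P k" "\<lambda>y. y" by (rule S.diff_pair_map)
  interpret d': tensor_pair_map B "res_obj Q (Suc k)" N' B "res_obj Q k" N'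
    "\<lambda>a. a" "res_diff Q k" "\<lambda>y. y" by (rule T.diff_pair_map)
  interpret G: comm_group "tensor B (res_obj Q k) N'" by (rule tensor_pair.tensor_comm_group [OF T.pair])
  show "tensor_map B (res_obj Q k) N' (f k) h (tensor_diff A P N k c) =
      tensor_diff B Q N' k (tensor_map B (res_obj Q (Suc k)) N' (f (Suc k)) h c)"
    unfolding tensor_diff_def
  proof (rule tensor_pair.tensor_hom_eqI [OF S.pair G.is_group _ _ _ c])
    show "(\<lambda>c. tensor_map B (res_obj Q k) N' (f k) h
        (tensor_map A (res_obj P k) N (res_diff P k) (\<lambda>y. y) c))
      \<in> hom (tensor A (res_obj P (Suc k)) N) (tensor B (res_obj Q k) N')"
      using hom_compose [OF d.tensor_map_hom f.tensor_map_hom] by (simp add: comp_def)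
    show "(\<lambda>c. tensor_map B (res_obj Q k) N' (res_diff Q k) (\<lambda>y. y)
        (tensor_map B (res_obj Q (Suc k)) N' (f (Suc k)) h c))
      \<in> hom (tensor A (res_obj P (Suc k)) N) (tensor B (res_obj Q k) N')"
      using hom_compose [OF f.tensor_map_hom d'.tensor_map_hom] by (simp add: comp_def)
  qed (simp add: d'.tensor_map_pure d.tensor_map_pure f.tensor_map_pure d.f_closed f_closed
      f_diff h_closed)
qed

lemma Tor_map_eq: "Tor_map B Q N' f h k = homology_map (tensor_complex B Q N') (tensor_diff B Q N')
    (\<lambda>k. tensor_map B (res_obj Q k) N' (f k) h) k"
  by (simp add: Tor_map_def homology_map_def)

lemma Tor_map_hom: "Tor_map B Q N' f h k \<in> hom (Tor A P N k) (Tor B Q N' k)"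
  unfolding Tor_map_eq Tor_def by (rule C.homology_map_hom)

end

lemma Tor_map_cong:
  assumes "tensor_chain_map A P N B Q N' \<phi> f h" "tensor_chain_map A P N B Q N' \<psi> g h'"
    and fg: "\<And>x. x \<in> carrier (res_obj P k) \<Longrightarrow> f k x = g k x"
    and hh: "\<And>y. y \<in> carrier N \<Longrightarrow> h y = h' y"
    and x: "x \<in> carrier (Tor A P N k)"
  shows "Tor_map B Q N' f h k x = Tor_map B Q N' g h' k x"
proof -
  interpret f: tensor_chain_map A P N B Q N' \<phi> f h by fact
  interpret g: tensor_chain_map A P N B Q N' \<psi> g h' by fact
  interpret G: comm_group "tensor B (res_obj Q k) N'" by (rule tensor_pair.tensor_comm_group [OF f.T.pair])
  show ?thesis
    unfolding f.Tor_map_eq g.Tor_map_eq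
  proof (rule homology_map_cong [OF f.C.group_complex_map_axioms g.C.group_complex_map_axioms])
    fix z assume "z \<in> carrier (tensor_complex A P N k)"
    then have z: "z \<in> carrier (tensor A (res_obj P k) N)" by (simp add: tensor_complex_def)
    show "tensor_map B (res_obj Q k) N' (f k) h z = tensor_map B (res_obj Q k) N' (g k) h' z"
      by (rule tensor_pair.tensor_hom_eqI [OF f.S.pair G.is_group f.f.tensor_map_hom g.f.tensor_map_hom _ z])
         (simp add: f.f.tensor_map_pure g.f.tensor_map_pure fg hh)
  qed (use x in \<open>simp add: Tor_def\<close>)
qed

lemma Tor_map_comp:
  assumes "tensor_chain_map A P N B Q N' \<phi> f h" "tensor_chain_map B Q N' D W N'' \<psi> g h'"
    and x: "x \<in> carrier (Tor A P N k)"
  shows "Tor_map D W N'' g h' k (Tor_map B Q N' f h k x)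
    = Tor_map D W N'' (\<lambda>j x. g j (f j x)) (\<lambda>y. h' (h y)) k x"
    and "tensor_chain_map A P N D W N'' (\<lambda>a. \<psi> (\<phi> a)) (\<lambda>j x. g j (f j x)) (\<lambda>y. h' (h y))"
proof -
  interpret f: tensor_chain_map A P N B Q N' \<phi> f h by fact
  interpret g: tensor_chain_map B Q N' D W N'' \<psi> g h' by fact
  interpret gf: tensor_chain_map A P N D W N'' "\<lambda>a. \<psi> (\<phi> a)" "\<lambda>j x. g j (f j x)" "\<lambda>y. h' (h y)"
  proof
    show "(\<lambda>x. g j (f j x)) \<in> semilinear A (\<lambda>a. \<psi> (\<phi> a)) (res_obj P j) (res_obj W j)" for j
      using f.f_semilinear [of j] g.f_semilinear [of j] f.\<phi>_closed
      by (auto simp: semilinear_def Pi_iff)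
  qed (simp_all add: f.f_closed f.\<phi>_closed g.\<phi>_closed f.h_closed g.h_closed f.h_add g.h_add
      f.h_act g.h_act f.f_diff g.f_diff)
  show "tensor_chain_map A P N D W N'' (\<lambda>a. \<psi> (\<phi> a)) (\<lambda>j x. g j (f j x)) (\<lambda>y. h' (h y))"
    by (rule gf.tensor_chain_map_axioms)
  interpret G: comm_group "tensor D (res_obj W k) N''" by (rule tensor_pair.tensor_comm_group [OF g.T.pair])
  \<comment> \<open>Functoriality of homology produces the composite of two tensor maps, whereas the
    goal has the tensor map of the composite. They agree on the carriers, by comparison on pure
    tensors.\<close>
  let ?\<chi> = "\<lambda>k c. tensor_map D (res_obj W k) N'' (g k) h' (tensor_map B (res_obj Q k) N' (f k) h c)"
  have eq: "?\<chi> k z = tensor_map D (res_obj W k) N'' (\<lambda>x. g k (f k x)) (\<lambda>y. h' (h y)) z"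
    if "z \<in> carrier (tensor_complex A P N k)" for k z
  proof -
    from that have z: "z \<in> carrier (tensor A (res_obj P k) N)" by (simp add: tensor_complex_def)
    interpret G: comm_group "tensor D (res_obj W k) N''" by (rule tensor_pair.tensor_comm_group [OF g.T.pair])
    show ?thesis
    proof (rule tensor_pair.tensor_hom_eqI [OF f.S.pair G.is_group _ gf.f.tensor_map_hom _ z])
      show "?\<chi> k \<in> hom (tensor A (res_obj P k) N) (tensor D (res_obj W k) N'')"
        using hom_compose [OF f.f.tensor_map_hom g.f.tensor_map_hom] by (simp add: comp_def)
    qed (simp add: f.f.tensor_map_pure g.f.tensor_map_pure gf.f.tensor_map_pure f.f_closed f.h_closed)
  qed
  interpret X: group_complex_map "tensor_complex A P N" "tensor_diff A P N"
    "tensor_complex D W N''" "tensor_diff D W N''" ?\<chi>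
  proof
    show "?\<chi> k \<in> hom (tensor_complex A P N k) (tensor_complex D W N'' k)" for k
      using hom_compose [OF f.C.map_hom g.C.map_hom] by (simp add: comp_def)
  qed (simp add: f.C.map_d g.C.map_d f.C.map_closed)
  have x': "x \<in> carrier (homology (tensor_complex A P N) (tensor_diff A P N) k)"
    using x by (simp add: Tor_def)
  show "Tor_map D W N'' g h' k (Tor_map B Q N' f h k x)
    = Tor_map D W N'' (\<lambda>j x. g j (f j x)) (\<lambda>y. h' (h y)) k x"
    unfolding f.Tor_map_eq g.Tor_map_eq gf.Tor_map_eq
      homology_map_comp [OF f.C.group_complex_map_axioms g.C.group_complex_map_axioms x']
    by (rule homology_map_cong [OF X.group_complex_map_axioms gf.C.group_complex_map_axioms eq x'])
qed

text \<open>The homotopy identity is demanded of pure tensors only, so it may fail in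
  \<open>P\<close> by elements that vanish after tensoring. Likewise \<open>f\<close> may be
  semilinear over a nontrivial \<open>\<phi>\<close>; that \<open>f\<close> can be tensored with the
  identity of \<open>N\<close> means that \<open>\<phi>\<close> preserves the action on
  \<open>N\<close>.\<close>

lemma (in tensor_resolution) Tor_map_homotopic_id:
  assumes "tensor_chain_map A P N A P N \<phi> f (\<lambda>y. y)"
    and s: "\<And>k. s k \<in> linear_maps A (res_obj P k) (res_obj P (Suc k))"
    and s0: "\<And>x y. \<lbrakk>x \<in> carrier (res_obj P 0); y \<in> carrier N\<rbrakk> \<Longrightarrow>
      pure_tensor A (res_obj P 0) N (f 0 x) y =
      pure_tensor A (res_obj P 0) N (res_diff P 0 (s 0 x) \<oplus>\<^bsub>res_obj P 0\<^esub> x) y"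
    and s_Suc: "\<And>k x y. \<lbrakk>x \<in> carrier (res_obj P (Suc k)); y \<in> carrier N\<rbrakk> \<Longrightarrow>
      pure_tensor A (res_obj P (Suc k)) N (f (Suc k) x) y =
      pure_tensor A (res_obj P (Suc k)) N (res_diff P (Suc k) (s (Suc k) x)
        \<oplus>\<^bsub>res_obj P (Suc k)\<^esub> (s k (res_diff P k x) \<oplus>\<^bsub>res_obj P (Suc k)\<^esub> x)) y"
    and x: "x \<in> carrier (Tor A P N k)"
  shows "Tor_map A P N f (\<lambda>y. y) k x = x"
proof -
  interpret f: tensor_chain_map A P N A P N \<phi> f "\<lambda>y. y" by fact
  let ?D = "tensor_diff A P N"
  define \<sigma> where "\<sigma> k = tensor_map A (res_obj P (Suc k)) N (s k) (\<lambda>y. y)" for k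
  have sp: "tensor_pair_map A (res_obj P k) N A (res_obj P (Suc k)) N (\<lambda>a. a) (s k) (\<lambda>y. y)" for k
    using pair s by (simp add: tensor_pair_map_def tensor_pair_map_axioms_def)
  have \<sigma>_hom: "\<sigma> k \<in> hom (tensor_complex A P N k) (tensor_complex A P N (Suc k))" for k
    unfolding \<sigma>_def tensor_complex_def by (rule tensor_pair_map.tensor_map_hom [OF sp])
  have sc: "s k x \<in> carrier (res_obj P (Suc k))" if "x \<in> carrier (res_obj P k)" for k x
    using s [of k] that by (auto simp: semilinear_def)
  have \<sigma>_pure: "\<sigma> k (pure_tensor A (res_obj P k) N x y) = pure_tensor A (res_obj P (Suc k)) N (s k x) y"
    if "x \<in> carrier (res_obj P k)" "y \<in> carrier N" for k x y
    unfolding \<sigma>_def by (rule tensor_pair_map.tensor_map_pure [OF sp that])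
  have D_pure: "?D k (pure_tensor A (res_obj P (Suc k)) N x y) = pure_tensor A (res_obj P k) N (res_diff P k x) y"
    if "x \<in> carrier (res_obj P (Suc k))" "y \<in> carrier N" for k x y
    unfolding tensor_diff_def by (rule tensor_pair_map.tensor_map_pure [OF diff_pair_map that])
  have x': "x \<in> carrier (homology (tensor_complex A P N) ?D k)"
    using x by (simp add: Tor_def)
  have "\<exists>w\<in>carrier (tensor_complex A P N (Suc k)). tensor_map A (res_obj P k) N (f k) (\<lambda>y. y) z
      = ?D k w \<otimes>\<^bsub>tensor_complex A P N k\<^esub> z"
    if z: "z \<in> carrier (cycles (tensor_complex A P N) ?D k)" for z
  proof
    have zc: "z \<in> carrier (tensor_complex A P N k)"
      using z by (rule C.cycles_carrier)
    then show "\<sigma> k z \<in> carrier (tensor_complex A P N (Suc k))"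
      using \<sigma>_hom by (auto simp: hom_def)
    interpret G: comm_group "tensor_complex A P N k" by (rule C.comm)
    have D\<sigma>: "(\<lambda>z. ?D k (\<sigma> k z)) \<in> hom (tensor_complex A P N k) (tensor_complex A P N k)"
      using hom_compose [OF \<sigma>_hom C.d_hom] by (simp add: comp_def)
    have id: "(\<lambda>z. z) \<in> hom (tensor_complex A P N k) (tensor_complex A P N k)"
      by (simp add: hom_def)
    note eqI = tensor_pair.tensor_hom_eqI [OF pair G.is_group [unfolded tensor_complex_def] f.C.map_hom [unfolded tensor_complex_def] _ _ zc [unfolded tensor_complex_def], folded tensor_complex_def]
    show "tensor_map A (res_obj P k) N (f k) (\<lambda>y. y) z = ?D k (\<sigma> k z) \<otimes>\<^bsub>tensor_complex A P N k\<^esub> z"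
    proof (cases k)
      case 0
      show ?thesis
      proof (rule eqI)
        show "(\<lambda>z. ?D k (\<sigma> k z) \<otimes>\<^bsub>tensor_complex A P N k\<^esub> z)
            \<in> hom (tensor_complex A P N k) (tensor_complex A P N k)"
          by (rule G.hom_group_mult [OF D\<sigma> id])
        fix x y assume xy: "x \<in> carrier (res_obj P k)" "y \<in> carrier N"
        then show "tensor_map A (res_obj P k) N (f k) (\<lambda>y. y) (pure_tensor A (res_obj P k) N x y) =
            ?D k (\<sigma> k (pure_tensor A (res_obj P k) N x y))
              \<otimes>\<^bsub>tensor_complex A P N k\<^esub> pure_tensor A (res_obj P k) N x y"
          using s0 [of x y] 0
          by (simp add: f.f.tensor_map_pure \<sigma>_pure D_pure sc diff_closed tensor_pair.pure_add_left [OF pair]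
              tensor_complex_def)
      qed
    next
      case (Suc j)
      have "tensor_map A (res_obj P k) N (f k) (\<lambda>y. y) z = ?D k (\<sigma> k z) \<otimes>\<^bsub>tensor_complex A P N k\<^esub>
          (\<sigma> j (?D j z) \<otimes>\<^bsub>tensor_complex A P N k\<^esub> z)"
      proof (rule eqI)
        have "(\<lambda>z. \<sigma> j (?D j z)) \<in> hom (tensor_complex A P N k) (tensor_complex A P N k)"
          using hom_compose [OF C.d_hom \<sigma>_hom [of j]] Suc by (simp add: comp_def)
        then show "(\<lambda>z. ?D k (\<sigma> k z) \<otimes>\<^bsub>tensor_complex A P N k\<^esub>
              (\<sigma> j (?D j z) \<otimes>\<^bsub>tensor_complex A P N k\<^esub> z))
            \<in> hom (tensor_complex A P N k) (tensor_complex A P N k)"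
          by (intro G.hom_group_mult D\<sigma> id)
        fix x y assume xy: "x \<in> carrier (res_obj P k)" "y \<in> carrier N"
        interpret M: right_module A "res_obj P (Suc j)"
          using pair by (simp add: tensor_pair_def)
        show "tensor_map A (res_obj P k) N (f k) (\<lambda>y. y) (pure_tensor A (res_obj P k) N x y) =
            ?D k (\<sigma> k (pure_tensor A (res_obj P k) N x y)) \<otimes>\<^bsub>tensor_complex A P N k\<^esub>
            (\<sigma> j (?D j (pure_tensor A (res_obj P k) N x y))
              \<otimes>\<^bsub>tensor_complex A P N k\<^esub> pure_tensor A (res_obj P k) N x y)"
          using s_Suc [of x j y] Suc tensor_pair.pure_add_left [OF pair] xy
          by (simp add: f.f.tensor_map_pure \<sigma>_pure D_pure sc diff_closed tensor_complex_def)
      qed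
      \<comment> \<open>As \<open>z\<close> is a cycle, the half \<open>\<sigma> j (?D j z)\<close>
        of the homotopy drops out.\<close>
      moreover have "?D j z = \<one>\<^bsub>tensor_complex A P N j\<^esub>"
        using z Suc by (simp add: cycles_def kernel_def)
      moreover have "\<sigma> j \<one>\<^bsub>tensor_complex A P N j\<^esub> = \<one>\<^bsub>tensor_complex A P N k\<^esub>"
        using hom_one [OF \<sigma>_hom C.grp C.grp] Suc by simp
      ultimately show ?thesis
        using zc by simp
    qed
  qed
  then show ?thesis
    unfolding f.Tor_map_eq
    by (rule C.homology_map_homotopic_id [OF f.C.group_complex_map_axioms _ x'])
qed

subsection \<open>Semilinear maps out of projective modules\<close>

text \<open>
  Closure under multiplication and associativity are left out, so that they do not have to be
  established for the composition of diagrams.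
\<close>

locale left_unital_algebra = abelian_group A
  for A :: "('a, 'c) ring_scheme" (structure) +
  assumes unit_closed: "\<one> \<in> carrier A"
    and left_unit: "a \<in> carrier A \<Longrightarrow> \<one> \<otimes> a = a"
    and zero_mult: "a \<in> carrier A \<Longrightarrow> \<zero> \<otimes> a = \<zero>"

context right_module
begin

lemma act_zero: "a \<in> carrier A \<Longrightarrow> a \<odot>\<^bsub>M\<^esub> \<zero>\<^bsub>M\<^esub> = \<zero>\<^bsub>M\<^esub>"
  using act_add [of a "\<zero>\<^bsub>M\<^esub>" "\<zero>\<^bsub>M\<^esub>"] act_closed [of a "\<zero>\<^bsub>M\<^esub>"] by simp

lemma act_neg: "\<lbrakk>a \<in> carrier A; x \<in> carrier M\<rbrakk> \<Longrightarrow> a \<odot>\<^bsub>M\<^esub> (\<ominus>\<^bsub>M\<^esub> x) = \<ominus>\<^bsub>M\<^esub> (a \<odot>\<^bsub>M\<^esub> x)"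
proof -
  assume a: "a \<in> carrier A" and x: "x \<in> carrier M"
  then have "a \<odot>\<^bsub>M\<^esub> (\<ominus>\<^bsub>M\<^esub> x) \<oplus>\<^bsub>M\<^esub> a \<odot>\<^bsub>M\<^esub> x = \<zero>\<^bsub>M\<^esub>"
    using act_add [of a "\<ominus>\<^bsub>M\<^esub> x" x] by (simp add: M.l_neg act_zero)
  then show ?thesis
    using a x M.minus_equality by (metis M.a_inv_closed act_closed)
qed

lemma act_minus:
  "\<lbrakk>a \<in> carrier A; x \<in> carrier M; y \<in> carrier M\<rbrakk> \<Longrightarrow>
    a \<odot>\<^bsub>M\<^esub> (x \<ominus>\<^bsub>M\<^esub> y) = a \<odot>\<^bsub>M\<^esub> x \<ominus>\<^bsub>M\<^esub> a \<odot>\<^bsub>M\<^esub> y"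
  by (simp add: a_minus_def act_add act_neg act_closed)

lemma zero_act: 
  assumes "abelian_group A" "x \<in> carrier M" 
  shows "\<zero>\<^bsub>A\<^esub> \<odot>\<^bsub>M\<^esub> x = \<zero>\<^bsub>M\<^esub>"
proof -
  interpret A: abelian_group A by fact
  show ?thesis
    using act_add_scalar [of "\<zero>\<^bsub>A\<^esub>" "\<zero>\<^bsub>A\<^esub>" x] act_closed [of "\<zero>\<^bsub>A\<^esub>" x] assms by simp
qed

lemma act_finsum:
  assumes "a \<in> carrier A" "finite Z" "y \<in> Z \<rightarrow> carrier M"
  shows "a \<odot>\<^bsub>M\<^esub> finsum M y Z = finsum M (\<lambda>z. a \<odot>\<^bsub>M\<^esub> y z) Z"
  using assms(2,3)
proof (induction Z)
  case empty
  then show ?case using assms(1) by (simp add: act_zero)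
next
  case (insert z Z)
  then have "y \<in> Z \<rightarrow> carrier M" "y z \<in> carrier M" by auto
  with insert show ?case
    using assms(1) by (simp add: act_add act_closed Pi_iff)
qed

end

lemma semilinear_closed: "\<lbrakk>f \<in> semilinear A \<phi> M N; x \<in> carrier M\<rbrakk> \<Longrightarrow> f x \<in> carrier N"
  and semilinear_add: "\<lbrakk>f \<in> semilinear A \<phi> M N; x \<in> carrier M; y \<in> carrier M\<rbrakk> \<Longrightarrow>
    f (x \<oplus>\<^bsub>M\<^esub> y) = f x \<oplus>\<^bsub>N\<^esub> f y"
  and semilinear_act: "\<lbrakk>f \<in> semilinear A \<phi> M N; a \<in> carrier A; x \<in> carrier M\<rbrakk> \<Longrightarrow>
    f (a \<odot>\<^bsub>M\<^esub> x) = \<phi> a \<odot>\<^bsub>N\<^esub> f x"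
  by (auto simp: semilinear_def)

lemma semilinear_zero:
  assumes "f \<in> semilinear A \<phi> M N" "abelian_group M" "abelian_group N"
  shows "f \<zero>\<^bsub>M\<^esub> = \<zero>\<^bsub>N\<^esub>"
proof -
  interpret M: abelian_group M by fact
  interpret N: abelian_group N by fact
  show ?thesis
    using semilinear_add [OF assms(1), of "\<zero>\<^bsub>M\<^esub>" "\<zero>\<^bsub>M\<^esub>"] semilinear_closed [OF assms(1), of "\<zero>\<^bsub>M\<^esub>"]
    by simp
qed

lemma semilinear_neg:
  assumes "f \<in> semilinear A \<phi> M N" "abelian_group M" "abelian_group N" "x \<in> carrier M"
  shows "f (\<ominus>\<^bsub>M\<^esub> x) = \<ominus>\<^bsub>N\<^esub> f x"
proof -
  interpret M: abelian_group M by fact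
  interpret N: abelian_group N by fact
  have "f (\<ominus>\<^bsub>M\<^esub> x) \<oplus>\<^bsub>N\<^esub> f x = \<zero>\<^bsub>N\<^esub>"
    using semilinear_add [OF assms(1), of "\<ominus>\<^bsub>M\<^esub> x" x] assms(4) semilinear_zero [OF assms(1-3)]
    by (simp add: M.l_neg)
  then show ?thesis
    using semilinear_closed [OF assms(1)] assms(4) N.minus_equality by simp
qed

lemma semilinear_minus:
  assumes "f \<in> semilinear A \<phi> M N" "abelian_group M" "abelian_group N" "x \<in> carrier M" "y \<in> carrier M"
  shows "f (x \<ominus>\<^bsub>M\<^esub> y) = f x \<ominus>\<^bsub>N\<^esub> f y"
proof -
  interpret M: abelian_group M by fact
  show ?thesis
    using assms by (simp add: a_minus_def semilinear_add semilinear_neg)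
qed

section \<open>Free modules and lifting from projective modules\<close>

definition delta :: "('a, 'c) ring_scheme \<Rightarrow> 'x \<Rightarrow> 'a \<Rightarrow> 'x \<Rightarrow> 'a" where
  "delta A x a = (\<lambda>z. if z = x then a else \<zero>\<^bsub>A\<^esub>)"

lemma fin_supp_closed: "v \<in> fin_supp A X \<Longrightarrow> v x \<in> carrier A"
  and fin_supp_zero: "\<lbrakk>v \<in> fin_supp A X; x \<notin> X\<rbrakk> \<Longrightarrow> v x = \<zero>\<^bsub>A\<^esub>"
  and fin_supp_finite: "v \<in> fin_supp A X \<Longrightarrow> finite {x. v x \<noteq> \<zero>\<^bsub>A\<^esub>}"
  by (auto simp: fin_supp_def)

context left_unital_algebra
begin

lemma zero_fin_supp: "(\<lambda>_. \<zero>) \<in> fin_supp A X"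
  by (simp add: fin_supp_def)

lemma delta_fin_supp: "\<lbrakk>x \<in> X; a \<in> carrier A\<rbrakk> \<Longrightarrow> delta A x a \<in> fin_supp A X"
  by (auto simp: fin_supp_def delta_def intro: finite_subset [of _ "{x}"])

lemma add_fin_supp:
  assumes "v \<in> fin_supp A X" "w \<in> fin_supp A X"
  shows "(\<lambda>x. v x \<oplus> w x) \<in> fin_supp A X"
proof -
  have "{x. v x \<oplus> w x \<noteq> \<zero>} \<subseteq> {x. v x \<noteq> \<zero>} \<union> {x. w x \<noteq> \<zero>}" by auto
  then show ?thesis
    using assms unfolding fin_supp_def by (auto intro: finite_subset)
qed

text \<open>The set \<open>L\<close> carries information about the coefficients through the
  induction: it is the whole carrier when maps are extended from a basis, and a left ideal when
  membership in a span is shown.\<close>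

lemma fin_supp_induct [consumes 1, case_names coeff zero_coeff zero add]:
  assumes v: "v \<in> fin_supp A X" and L: "\<And>x. v x \<in> L" "\<zero> \<in> L"
    and zero: "P (\<lambda>_. \<zero>)"
    and add: "\<And>w x a. \<lbrakk>w \<in> fin_supp A X; P w; x \<in> X; a \<in> L; a \<in> carrier A\<rbrakk> \<Longrightarrow>
      P (\<lambda>z. w z \<oplus> delta A x a z)"
  shows "P v"
proof -
  have "P v" if "finite Z" "v \<in> fin_supp A X" "\<And>x. v x \<in> L" "\<And>x. x \<notin> Z \<Longrightarrow> v x = \<zero>" for Z v
    using that
  proof (induction Z arbitrary: v)
    case empty
    then have "v = (\<lambda>_. \<zero>)" by auto
    then show ?case using zero by simp
  next
    case (insert x Z)
    define w where "w = v(x := \<zero>)"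
    have "{z. w z \<noteq> \<zero>} \<subseteq> {z. v z \<noteq> \<zero>}"
      by (auto simp: w_def)
    then have w: "w \<in> fin_supp A X"
      using insert.prems(1) unfolding fin_supp_def by (auto simp: w_def intro: finite_subset)
    have "P w"
      by (rule insert.IH [OF w]) (use insert.prems L in \<open>auto simp: w_def\<close>)
    show ?case
    proof (cases "x \<in> X")
      case True
      have "v = (\<lambda>z. w z \<oplus> delta A x (v x) z)"
        using fin_supp_closed [OF insert.prems(1)] by (auto simp: w_def delta_def)
      moreover have "P (\<lambda>z. w z \<oplus> delta A x (v x) z)"
        by (rule add [OF w \<open>P w\<close> True]) (use insert.prems fin_supp_closed in auto)
      ultimately show ?thesis by simp
    next
      case False
      then have "v = w"
        using insert.prems(1) by (auto simp: w_def fin_supp_def)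
      with \<open>P w\<close> show ?thesis by simp
    qed
  qed
  from this [OF fin_supp_finite [OF v] v L(1)] show ?thesis by simp
qed

end

locale algebra_map = A: left_unital_algebra A + B: left_unital_algebra B
  for A :: "('a, 'c) ring_scheme" and B :: "('b, 'c') ring_scheme" +
  fixes \<phi> :: "'a \<Rightarrow> 'b"
  assumes closed: "a \<in> carrier A \<Longrightarrow> \<phi> a \<in> carrier B"
    and add: "\<lbrakk>a \<in> carrier A; b \<in> carrier A\<rbrakk> \<Longrightarrow> \<phi> (a \<oplus>\<^bsub>A\<^esub> b) = \<phi> a \<oplus>\<^bsub>B\<^esub> \<phi> b"
    and mult: "\<lbrakk>a \<in> carrier A; b \<in> carrier A\<rbrakk> \<Longrightarrow> \<phi> (a \<otimes>\<^bsub>A\<^esub> b) = \<phi> a \<otimes>\<^bsub>B\<^esub> \<phi> b"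
begin

lemma map_zero: "\<phi> \<zero>\<^bsub>A\<^esub> = \<zero>\<^bsub>B\<^esub>"
  using add [of "\<zero>\<^bsub>A\<^esub>" "\<zero>\<^bsub>A\<^esub>"] closed [of "\<zero>\<^bsub>A\<^esub>"] by simp

text \<open>This is the universal property of a free module, semilinear over \<open>\<phi>\<close>.
  The last clause prescribes \<open>H\<close> on every multiple of a basis element, since
  \<open>algebra_map\<close> says nothing about units.\<close>

lemma free_lift:
  assumes N: "right_module B N" and y: "\<And>x. x \<in> X \<Longrightarrow> y x \<in> carrier N"
  obtains H where
    "\<And>v. v \<in> fin_supp A X \<Longrightarrow> H v \<in> carrier N"
    "\<And>v w. \<lbrakk>v \<in> fin_supp A X; w \<in> fin_supp A X\<rbrakk> \<Longrightarrow> H (\<lambda>x. v x \<oplus>\<^bsub>A\<^esub> w x) = H v \<oplus>\<^bsub>N\<^esub> H w"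
    "\<And>v a. \<lbrakk>v \<in> fin_supp A X; a \<in> carrier A\<rbrakk> \<Longrightarrow> H (\<lambda>x. v x \<otimes>\<^bsub>A\<^esub> a) = \<phi> a \<odot>\<^bsub>N\<^esub> H v"
    "\<And>x a. \<lbrakk>x \<in> X; a \<in> carrier A\<rbrakk> \<Longrightarrow> H (delta A x a) = \<phi> a \<odot>\<^bsub>N\<^esub> y x"
proof
  interpret N: right_module B N by fact
  \<comment> \<open>The default zero outside \<open>X\<close> puts every summand into
    \<open>N\<close>, also at points where nothing is known about \<open>y\<close>; the coefficient
    there is zero anyway.\<close>
  define t where "t v x = \<phi> (v x) \<odot>\<^bsub>N\<^esub> (if x \<in> X then y x else \<zero>\<^bsub>N\<^esub>)" for v x
  define H where "H v = finsum N (t v) {x. v x \<noteq> \<zero>\<^bsub>A\<^esub>}" for v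
  have t: "t v x \<in> carrier N" if "v \<in> fin_supp A X" for v x
    using that fin_supp_closed [OF that] y by (auto simp: t_def N.act_closed closed)
  have t0: "t v x = \<zero>\<^bsub>N\<^esub>" if "v x = \<zero>\<^bsub>A\<^esub>" for v x
    using that y by (simp add: t_def map_zero N.zero_act [OF B.abelian_group_axioms])
  have H: "H v = finsum N (t v) Z"
    if "v \<in> fin_supp A X" "finite Z" "{x. v x \<noteq> \<zero>\<^bsub>A\<^esub>} \<subseteq> Z" for v Z
    unfolding H_def
    by (rule N.add.finprod_mono_neutral_cong_left) (use that t t0 in auto)
  show Hc: "H v \<in> carrier N" if "v \<in> fin_supp A X" for v
    unfolding H_def using t [OF that] by (simp add: Pi_iff)
  show "H (\<lambda>x. v x \<oplus>\<^bsub>A\<^esub> w x) = H v \<oplus>\<^bsub>N\<^esub> H w" if vw: "v \<in> fin_supp A X" "w \<in> fin_supp A X" for v w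
  proof -
    define Z where "Z = {x. v x \<noteq> \<zero>\<^bsub>A\<^esub>} \<union> {x. w x \<noteq> \<zero>\<^bsub>A\<^esub>}"
    have Z: "finite Z" using vw fin_supp_finite unfolding Z_def by blast
    have "H (\<lambda>x. v x \<oplus>\<^bsub>A\<^esub> w x) = finsum N (t (\<lambda>x. v x \<oplus>\<^bsub>A\<^esub> w x)) Z"
      by (rule H [OF A.add_fin_supp [OF vw] Z]) (auto simp: Z_def)
    also have "t (\<lambda>x. v x \<oplus>\<^bsub>A\<^esub> w x) = (\<lambda>x. t v x \<oplus>\<^bsub>N\<^esub> t w x)"
      using vw [THEN fin_supp_closed] y
      by (auto simp: t_def add closed intro!: ext N.act_add_scalar)
    also have "finsum N \<dots> Z = finsum N (t v) Z \<oplus>\<^bsub>N\<^esub> finsum N (t w) Z"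
      using t vw by (intro N.add.finprod_multf) auto
    also have "\<dots> = H v \<oplus>\<^bsub>N\<^esub> H w"
      using H [OF vw(1) Z] H [OF vw(2) Z] by (auto simp: Z_def)
    finally show ?thesis .
  qed
  show "H (\<lambda>x. v x \<otimes>\<^bsub>A\<^esub> a) = \<phi> a \<odot>\<^bsub>N\<^esub> H v" if v: "v \<in> fin_supp A X" and a: "a \<in> carrier A" for v a
  proof -
    define Z where "Z = {x. v x \<noteq> \<zero>\<^bsub>A\<^esub>}"
    have Z: "finite Z" using v fin_supp_finite unfolding Z_def by blast
    have eq: "t (\<lambda>x. v x \<otimes>\<^bsub>A\<^esub> a) = (\<lambda>x. \<phi> a \<odot>\<^bsub>N\<^esub> t v x)"
      using fin_supp_closed [OF v] a y by (auto simp: t_def mult closed N.act_mult)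
    have "H (\<lambda>x. v x \<otimes>\<^bsub>A\<^esub> a) = finsum N (t (\<lambda>x. v x \<otimes>\<^bsub>A\<^esub> a)) Z"
      unfolding H_def
    proof (rule N.add.finprod_mono_neutral_cong_left [OF Z])
      show "{x. v x \<otimes>\<^bsub>A\<^esub> a \<noteq> \<zero>\<^bsub>A\<^esub>} \<subseteq> Z"
        using a A.zero_mult by (auto simp: Z_def)
      show "t (\<lambda>x. v x \<otimes>\<^bsub>A\<^esub> a) \<in> Z \<rightarrow> carrier N"
        using t [OF v] a closed by (simp add: eq N.act_closed)
    qed (auto simp: t0)
    also have "\<dots> = \<phi> a \<odot>\<^bsub>N\<^esub> H v"
      unfolding H_def Z_def [symmetric] using t [OF v] a closed Z
      by (simp add: eq N.act_finsum)
    finally show ?thesis .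
  qed
  show "H (delta A x a) = \<phi> a \<odot>\<^bsub>N\<^esub> y x" if x: "x \<in> X" and a: "a \<in> carrier A" for x a
  proof -
    have "H (delta A x a) = finsum N (t (delta A x a)) {x}"
      by (rule H [OF A.delta_fin_supp [OF x a]]) (auto simp: delta_def)
    also have "\<dots> = t (delta A x a) x"
      using t [OF A.delta_fin_supp [OF x a], of x] by simp
    finally show ?thesis
      using x by (simp add: t_def delta_def)
  qed
qed

text \<open>
  Everything is relative to a congruence \<open>E\<close> on \<open>N\<^sub>0\<close>: for equality this is the usual lifting
  property, and below \<open>E\<close> is also congruence modulo the submodule generated by the diagrams that
  are not permutations.
\<close>

lemma projective_lift:
  fixes M :: "('a, 'm, 'd) module_scheme"
  assumes proj: "projective_right_module A M" and N: "right_module B N"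
    and N0: "abelian_group N\<^sub>0"
    and N0_act: "\<And>a x. \<lbrakk>a \<in> carrier B; x \<in> carrier N\<^sub>0\<rbrakk> \<Longrightarrow> a \<odot>\<^bsub>N\<^sub>0\<^esub> x \<in> carrier N\<^sub>0"
    and N0_zero_act: "\<And>x. x \<in> carrier N\<^sub>0 \<Longrightarrow> \<zero>\<^bsub>B\<^esub> \<odot>\<^bsub>N\<^sub>0\<^esub> x = \<zero>\<^bsub>N\<^sub>0\<^esub>"
    and d: "d \<in> linear_maps B N N\<^sub>0"
    and E_refl: "\<And>x. x \<in> carrier N\<^sub>0 \<Longrightarrow> E x x"
    and E_trans: "\<And>x y z. \<lbrakk>E x y; E y z; x \<in> carrier N\<^sub>0; y \<in> carrier N\<^sub>0; z \<in> carrier N\<^sub>0\<rbrakk> \<Longrightarrow> E x z"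
    and E_add: "\<And>x y x' y'. \<lbrakk>E x y; E x' y'; x \<in> carrier N\<^sub>0; y \<in> carrier N\<^sub>0; x' \<in> carrier N\<^sub>0;
      y' \<in> carrier N\<^sub>0\<rbrakk> \<Longrightarrow> E (x \<oplus>\<^bsub>N\<^sub>0\<^esub> x') (y \<oplus>\<^bsub>N\<^sub>0\<^esub> y')"
    and E_act: "\<And>a x y. \<lbrakk>E x y; a \<in> carrier B; x \<in> carrier N\<^sub>0; y \<in> carrier N\<^sub>0\<rbrakk> \<Longrightarrow>
      E (a \<odot>\<^bsub>N\<^sub>0\<^esub> x) (a \<odot>\<^bsub>N\<^sub>0\<^esub> y)"
    and u_closed: "\<And>x. x \<in> carrier M \<Longrightarrow> u x \<in> carrier N\<^sub>0"
    and u_add: "\<And>x y. \<lbrakk>x \<in> carrier M; y \<in> carrier M\<rbrakk> \<Longrightarrow> E (u (x \<oplus>\<^bsub>M\<^esub> y)) (u x \<oplus>\<^bsub>N\<^sub>0\<^esub> u y)"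
    and u_act: "\<And>a x. \<lbrakk>a \<in> carrier A; x \<in> carrier M\<rbrakk> \<Longrightarrow> E (u (a \<odot>\<^bsub>M\<^esub> x)) (\<phi> a \<odot>\<^bsub>N\<^sub>0\<^esub> u x)"
    and u_image: "\<And>x. x \<in> carrier M \<Longrightarrow> \<exists>y\<in>carrier N. E (u x) (d y)"
  obtains h where "h \<in> semilinear A \<phi> M N" "\<And>x. x \<in> carrier M \<Longrightarrow> E (u x) (d (h x))"
proof -
  interpret N: right_module B N by fact
  interpret N0: abelian_group N\<^sub>0 by fact
  interpret M: right_module A M
    using proj by (simp add: projective_right_module_def)
  obtain X :: "'m set" and s r where s: "s \<in> linear_maps A M (free_right_module A X)"
    and r: "r \<in> linear_maps A (free_right_module A X) M" and rs: "\<And>m. m \<in> carrier M \<Longrightarrow> r (s m) = m"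
    using proj unfolding projective_right_module_def by blast
  define q where "q x = r (delta A x \<one>\<^bsub>A\<^esub>)" for x
  have q: "q x \<in> carrier M" if "x \<in> X" for x
    unfolding q_def using semilinear_closed [OF r] A.delta_fin_supp [OF that A.unit_closed]
    by (simp add: free_right_module_def)
  have "\<forall>x\<in>X. \<exists>y. y \<in> carrier N \<and> E (u (q x)) (d y)"
    using u_image q by blast
  then obtain y where y: "\<And>x. x \<in> X \<Longrightarrow> y x \<in> carrier N" "\<And>x. x \<in> X \<Longrightarrow> E (u (q x)) (d (y x))"
    by (metis (no_types))
  obtain H where H: "\<And>v. v \<in> fin_supp A X \<Longrightarrow> H v \<in> carrier N"
    "\<And>v w. \<lbrakk>v \<in> fin_supp A X; w \<in> fin_supp A X\<rbrakk> \<Longrightarrow> H (\<lambda>x. v x \<oplus>\<^bsub>A\<^esub> w x) = H v \<oplus>\<^bsub>N\<^esub> H w"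
    "\<And>v a. \<lbrakk>v \<in> fin_supp A X; a \<in> carrier A\<rbrakk> \<Longrightarrow> H (\<lambda>x. v x \<otimes>\<^bsub>A\<^esub> a) = \<phi> a \<odot>\<^bsub>N\<^esub> H v"
    "\<And>x a. \<lbrakk>x \<in> X; a \<in> carrier A\<rbrakk> \<Longrightarrow> H (delta A x a) = \<phi> a \<odot>\<^bsub>N\<^esub> y x"
    using free_lift [where y = y and X = X, OF N y(1)] by blast
  have sc: "s m \<in> fin_supp A X" if "m \<in> carrier M" for m
    using semilinear_closed [OF s that] by (simp add: free_right_module_def)
  have rc: "r v \<in> carrier M" if "v \<in> fin_supp A X" for v
    using semilinear_closed [OF r] that by (simp add: free_right_module_def)
  have r_add: "r (\<lambda>x. v x \<oplus>\<^bsub>A\<^esub> w x) = r v \<oplus>\<^bsub>M\<^esub> r w" if "v \<in> fin_supp A X" "w \<in> fin_supp A X" for v w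
    using semilinear_add [OF r] that by (simp add: free_right_module_def)
  have r_delta: "r (delta A x a) = a \<odot>\<^bsub>M\<^esub> q x" if "x \<in> X" "a \<in> carrier A" for x a
  proof -
    have "delta A x a = (\<lambda>z. delta A x \<one>\<^bsub>A\<^esub> z \<otimes>\<^bsub>A\<^esub> a)"
      using that by (auto simp: delta_def A.left_unit A.zero_mult)
    then show ?thesis
      using semilinear_act [OF r that(2), of "delta A x \<one>\<^bsub>A\<^esub>"] A.delta_fin_supp [OF that(1) A.unit_closed]
      by (simp add: q_def free_right_module_def)
  qed
  have dc: "d z \<in> carrier N\<^sub>0" if "z \<in> carrier N" for z
    using semilinear_closed [OF d that] .
  \<comment> \<open>Both sides are additive and semilinear in \<open>v\<close> up to
    \<open>E\<close>, and on basis elements the relation holds by the choice of \<open>y\<close>.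
    Composition with the section \<open>s\<close> then yields the lift on \<open>M\<close>.\<close>
  have E: "E (u (r v)) (d (H v))" if v: "v \<in> fin_supp A X" for v
    using v
  proof (induction rule: A.fin_supp_induct [where L = "carrier A"])
    case zero
    \<comment> \<open>Nothing says that \<open>u\<close> maps zero to zero. Writing zero as the zero
      scalar acting on zero lets \<open>u_act\<close> relate its image to zero by
      \<open>E\<close>.\<close>
    have 0: "r (\<lambda>_. \<zero>\<^bsub>A\<^esub>) = \<zero>\<^bsub>A\<^esub> \<odot>\<^bsub>M\<^esub> \<zero>\<^bsub>M\<^esub>"
      using r_add [OF A.zero_fin_supp A.zero_fin_supp] rc [OF A.zero_fin_supp]
      by (simp add: M.act_zero)
    have "H (\<lambda>_. \<zero>\<^bsub>A\<^esub>) = \<zero>\<^bsub>N\<^esub>"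
      using H(2) [OF A.zero_fin_supp A.zero_fin_supp] H(1) [OF A.zero_fin_supp] by simp
    then have "d (H (\<lambda>_. \<zero>\<^bsub>A\<^esub>)) = \<phi> \<zero>\<^bsub>A\<^esub> \<odot>\<^bsub>N\<^sub>0\<^esub> u \<zero>\<^bsub>M\<^esub>"
      using semilinear_zero [OF d] N.abelian_group_axioms N0.abelian_group_axioms u_closed
      by (simp add: map_zero N0_zero_act)
    then show ?case
      unfolding 0 using u_act [of "\<zero>\<^bsub>A\<^esub>" "\<zero>\<^bsub>M\<^esub>"] by simp
  next
    case (add w x a)
    have xq: "a \<odot>\<^bsub>M\<^esub> q x \<in> carrier M" "q x \<in> carrier M" "\<phi> a \<in> carrier B" "\<phi> a \<odot>\<^bsub>N\<^esub> y x \<in> carrier N"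
      using add q y closed by (auto simp: M.act_closed N.act_closed)
    have "E (u (a \<odot>\<^bsub>M\<^esub> q x)) (\<phi> a \<odot>\<^bsub>N\<^sub>0\<^esub> d (y x))"
      by (rule E_trans [OF u_act E_act])
        (use add y xq dc u_closed in \<open>auto simp: N0_act\<close>)
    then have "E (u (r w) \<oplus>\<^bsub>N\<^sub>0\<^esub> u (a \<odot>\<^bsub>M\<^esub> q x)) (d (H w) \<oplus>\<^bsub>N\<^sub>0\<^esub> \<phi> a \<odot>\<^bsub>N\<^sub>0\<^esub> d (y x))"
      by (intro E_add)
        (use add y xq dc u_closed rc H(1) in \<open>auto simp: N0_act\<close>)
    moreover have "d (H w) \<oplus>\<^bsub>N\<^sub>0\<^esub> \<phi> a \<odot>\<^bsub>N\<^sub>0\<^esub> d (y x) = d (H (\<lambda>z. w z \<oplus>\<^bsub>A\<^esub> delta A x a z))"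
      using add xq y H(1) A.delta_fin_supp [of x X a]
      by (simp add: H(2,4) semilinear_add [OF d] semilinear_act [OF d])
    moreover have "r (\<lambda>z. w z \<oplus>\<^bsub>A\<^esub> delta A x a z) = r w \<oplus>\<^bsub>M\<^esub> a \<odot>\<^bsub>M\<^esub> q x"
      using add A.delta_fin_supp [of x X a] by (simp add: r_add r_delta)
    moreover have "E (u (r w \<oplus>\<^bsub>M\<^esub> a \<odot>\<^bsub>M\<^esub> q x)) (u (r w) \<oplus>\<^bsub>N\<^sub>0\<^esub> u (a \<odot>\<^bsub>M\<^esub> q x))"
      using add xq rc by (intro u_add) auto
    moreover have "H (\<lambda>z. w z \<oplus>\<^bsub>A\<^esub> delta A x a z) \<in> carrier N"
      by (intro H(1) A.add_fin_supp A.delta_fin_supp add)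
    ultimately show ?case
      using E_trans [of "u (r w \<oplus>\<^bsub>M\<^esub> a \<odot>\<^bsub>M\<^esub> q x)" "u (r w) \<oplus>\<^bsub>N\<^sub>0\<^esub> u (a \<odot>\<^bsub>M\<^esub> q x)"]
        add xq rc u_closed dc by simp
  qed (use fin_supp_closed [OF v] in auto)
  show ?thesis
  proof
    show "(\<lambda>m. H (s m)) \<in> semilinear A \<phi> M N"
      using sc H(1) H(2) [OF sc sc] H(3) [OF sc] s
      by (auto simp: semilinear_def free_right_module_def)
    show "E (u m) (d (H (s m)))" if "m \<in> carrier M" for m
      using E [OF sc [OF that]] rs [OF that] by simp
  qed
qed

end

subsection \<open>Comparison of resolutions\<close>

locale proj_resolution =
  fixes A :: "('a, 'c) ring_scheme" and M :: "('a, 'm, 'd) module_scheme"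
    and P :: "('a, 'p, 'm) resolution"
  assumes resolution: "projective_resolution A M P"
begin

lemma proj: "projective_right_module A (res_obj P k)"
  and diff: "res_diff P k \<in> linear_maps A (res_obj P (Suc k)) (res_obj P k)"
  and aug: "res_aug P \<in> linear_maps A (res_obj P 0) M"
  and aug_surj: "res_aug P ` carrier (res_obj P 0) = carrier M"
  and diff_image_0: "res_diff P 0 ` carrier (res_obj P (Suc 0)) =
      {x \<in> carrier (res_obj P 0). res_aug P x = \<zero>\<^bsub>M\<^esub>}"
  and diff_image: "res_diff P (Suc k) ` carrier (res_obj P (Suc (Suc k))) =
      {x \<in> carrier (res_obj P (Suc k)). res_diff P k x = \<zero>\<^bsub>res_obj P k\<^esub>}"
  using resolution by (simp_all add: projective_resolution_def)

lemma obj: "right_module A (res_obj P k)"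
  using proj by (simp add: projective_right_module_def)

lemma grp: "abelian_group (res_obj P k)"
  using obj [of k] by (simp add: right_module_def)

lemma diff_closed: "x \<in> carrier (res_obj P (Suc k)) \<Longrightarrow> res_diff P k x \<in> carrier (res_obj P k)"
  using semilinear_closed [OF diff] .

lemma aug_diff: "x \<in> carrier (res_obj P (Suc 0)) \<Longrightarrow> res_aug P (res_diff P 0 x) = \<zero>\<^bsub>M\<^esub>"
  using diff_image_0 by blast

lemma diff_diff: "x \<in> carrier (res_obj P (Suc (Suc k))) \<Longrightarrow>
    res_diff P k (res_diff P (Suc k) x) = \<zero>\<^bsub>res_obj P k\<^esub>"
  using diff_image [of k] by blast

lemma exact_0: "\<lbrakk>x \<in> carrier (res_obj P 0); res_aug P x = \<zero>\<^bsub>M\<^esub>\<rbrakk> \<Longrightarrow>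
    \<exists>y\<in>carrier (res_obj P (Suc 0)). x = res_diff P 0 y"
  using diff_image_0 by blast

lemma exact: "\<lbrakk>x \<in> carrier (res_obj P (Suc k)); res_diff P k x = \<zero>\<^bsub>res_obj P k\<^esub>\<rbrakk> \<Longrightarrow>
    \<exists>y\<in>carrier (res_obj P (Suc (Suc k))). x = res_diff P (Suc k) y"
  using diff_image [of k] by blast

end

text \<open>This is the comparison theorem for resolutions along a change of rings: each degree is
  an instance of \<open>projective_lift\<close> with equality as the congruence.\<close>

lemma (in algebra_map) chain_map_exists:
  fixes P :: "('a, 'p, 'm) resolution" and Q :: "('b, 'q, 'n) resolution"
  assumes P: "projective_resolution A M P" and Q: "projective_resolution B N Q"
    and M: "abelian_group M" and N: "abelian_group N"
    and N_act: "\<And>a x. \<lbrakk>a \<in> carrier B; x \<in> carrier N\<rbrakk> \<Longrightarrow> a \<odot>\<^bsub>N\<^esub> x \<in> carrier N"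
    and N_zero_act: "\<And>x. x \<in> carrier N \<Longrightarrow> \<zero>\<^bsub>B\<^esub> \<odot>\<^bsub>N\<^esub> x = \<zero>\<^bsub>N\<^esub>"
    and g: "g \<in> semilinear A \<phi> M N"
  shows "\<exists>f. covers A \<phi> g P Q f"
proof -
  interpret P: proj_resolution A M P by unfold_locales (rule P)
  interpret Q: proj_resolution B N Q by unfold_locales (rule Q)
  note dP = P.diff and dQ = Q.diff and augP = P.aug and augQ = Q.aug
  note projP = P.proj and mQ = Q.obj and gP = P.grp and gQ = Q.grp
  note aug_dP = P.aug_diff and d_dP = P.diff_diff and exQ0 = Q.exact_0 and exQ = Q.exact
  \<comment> \<open>The last clause is the invariant that keeps the recursion going:
    \<open>f\<close> composed with the differential of \<open>P\<close> has values in the image of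
    the differential of \<open>Q\<close>, so it lifts to the next degree.\<close>
  define good where "good k f \<longleftrightarrow> f \<in> semilinear A \<phi> (res_obj P k) (res_obj Q k) \<and>
    (k = 0 \<longrightarrow> (\<forall>x\<in>carrier (res_obj P 0). res_aug Q (f x) = g (res_aug P x))) \<and>
    (\<forall>x\<in>carrier (res_obj P (Suc k)). \<exists>y\<in>carrier (res_obj Q (Suc k)).
      f (res_diff P k x) = res_diff Q k y)" for k f
  have "\<exists>f. \<forall>k. good k (f k) \<and>
      (\<forall>x\<in>carrier (res_obj P (Suc k)). f k (res_diff P k x) = res_diff Q k (f (Suc k) x))"
  proof (rule dependent_nat_choice)
    obtain f where f: "f \<in> semilinear A \<phi> (res_obj P 0) (res_obj Q 0)"
      "\<And>x. x \<in> carrier (res_obj P 0) \<Longrightarrow> g (res_aug P x) = res_aug Q (f x)"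
    proof (rule projective_lift [where E = "(=)" and u = "\<lambda>x. g (res_aug P x)",
          OF projP mQ N N_act N_zero_act augQ])
      show "\<exists>y\<in>carrier (res_obj Q 0). g (res_aug P x) = res_aug Q y"
        if "x \<in> carrier (res_obj P 0)" for x
        using Q.aug_surj semilinear_closed [OF g semilinear_closed [OF augP that]] by blast
    qed (simp_all add: semilinear_closed [OF g] semilinear_closed [OF augP]
        semilinear_add [OF g] semilinear_add [OF augP] semilinear_act [OF g] semilinear_act [OF augP])
    have "\<exists>y\<in>carrier (res_obj Q (Suc 0)). f (res_diff P 0 x) = res_diff Q 0 y"
      if x: "x \<in> carrier (res_obj P (Suc 0))" for x
    proof (rule exQ0)
      have "res_diff P 0 x \<in> carrier (res_obj P 0)"
        using semilinear_closed [OF dP x] .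
      then show "f (res_diff P 0 x) \<in> carrier (res_obj Q 0)"
        "res_aug Q (f (res_diff P 0 x)) = \<zero>\<^bsub>N\<^esub>"
        using f semilinear_closed [OF f(1)] aug_dP [OF x] semilinear_zero [OF g M N]
        by (auto simp flip: f(2))
    qed
    then show "\<exists>f. good 0 f"
      using f unfolding good_def by (metis (no_types))
  next
    fix f k assume "good k f"
    then have f: "f \<in> semilinear A \<phi> (res_obj P k) (res_obj Q k)"
      and im: "\<And>x. x \<in> carrier (res_obj P (Suc k)) \<Longrightarrow>
        \<exists>y\<in>carrier (res_obj Q (Suc k)). f (res_diff P k x) = res_diff Q k y"
      by (auto simp: good_def)
    interpret Qk: right_module B "res_obj Q k" by (rule mQ)
    have "\<exists>f'. f' \<in> semilinear A \<phi> (res_obj P (Suc k)) (res_obj Q (Suc k)) \<and>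
        (\<forall>x\<in>carrier (res_obj P (Suc k)). f (res_diff P k x) = res_diff Q k (f' x))"
    proof (rule projective_lift [where E = "(=)" and u = "\<lambda>x. f (res_diff P k x)",
          OF projP mQ gQ Qk.act_closed Qk.zero_act [OF B.abelian_group_axioms] dQ _ _ _ _ _ _ _ im])
      fix h assume "h \<in> semilinear A \<phi> (res_obj P (Suc k)) (res_obj Q (Suc k))"
        "\<And>x. x \<in> carrier (res_obj P (Suc k)) \<Longrightarrow> f (res_diff P k x) = res_diff Q k (h x)"
      then show ?thesis by blast
    qed (simp_all add: semilinear_closed [OF f] semilinear_closed [OF dP]
        semilinear_add [OF f] semilinear_add [OF dP] semilinear_act [OF f] semilinear_act [OF dP])
    then obtain f' where f': "f' \<in> semilinear A \<phi> (res_obj P (Suc k)) (res_obj Q (Suc k))"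
      "\<And>x. x \<in> carrier (res_obj P (Suc k)) \<Longrightarrow> f (res_diff P k x) = res_diff Q k (f' x)"
      by blast
    have "\<exists>y\<in>carrier (res_obj Q (Suc (Suc k))). f' (res_diff P (Suc k) x) = res_diff Q (Suc k) y"
      if x: "x \<in> carrier (res_obj P (Suc (Suc k)))" for x
    proof (rule exQ)
      have "res_diff P (Suc k) x \<in> carrier (res_obj P (Suc k))"
        using semilinear_closed [OF dP x] .
      then show "f' (res_diff P (Suc k) x) \<in> carrier (res_obj Q (Suc k))"
        "res_diff Q k (f' (res_diff P (Suc k) x)) = \<zero>\<^bsub>res_obj Q k\<^esub>"
        using f' semilinear_closed [OF f'(1)] d_dP [OF x] semilinear_zero [OF f gP gQ]
        by (auto simp flip: f'(2))
    qed
    then have "good (Suc k) f'"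
      using f' unfolding good_def by blast
    then show "\<exists>f'. good (Suc k) f' \<and>
        (\<forall>x\<in>carrier (res_obj P (Suc k)). f (res_diff P k x) = res_diff Q k (f' x))"
      using f' by blast
  qed
  then obtain f where f: "\<And>k. good k (f k)" "\<And>k x. x \<in> carrier (res_obj P (Suc k)) \<Longrightarrow>
      f k (res_diff P k x) = res_diff Q k (f (Suc k) x)" by blast
  have "covers A \<phi> g P Q f"
    unfolding covers_def using f(1) f(2) f(1) [of 0] by (simp add: good_def)
  then show ?thesis by blast
qed

text \<open>Zero and sums in \<open>K\<close> make the relation \<open>x \<ominus> y \<in> K\<close>
  reflexive, transitive and additive, and the action makes it compatible with scalars. This is what
  \<open>projective_lift\<close> asks of a congruence.\<close>

definition act_submodule ::
  "('a, 'c) ring_scheme \<Rightarrow> ('a, 'm, 'd) module_scheme \<Rightarrow> 'm set \<Rightarrow> bool" where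
  "act_submodule A M K \<longleftrightarrow> K \<subseteq> carrier M \<and> \<zero>\<^bsub>M\<^esub> \<in> K \<and> (\<forall>x\<in>K. \<forall>y\<in>K. x \<oplus>\<^bsub>M\<^esub> y \<in> K) \<and>
    (\<forall>a\<in>carrier A. \<forall>x\<in>K. a \<odot>\<^bsub>M\<^esub> x \<in> K)"

context abelian_group
begin

lemma minus_eq_zero_iff: "\<lbrakk>x \<in> carrier G; y \<in> carrier G\<rbrakk> \<Longrightarrow> x \<ominus> y = \<zero> \<longleftrightarrow> x = y"
  by (metis a_inv_closed a_minus_def minus_equality minus_minus r_neg)

lemma minus_plus_minus: "\<lbrakk>x \<in> carrier G; y \<in> carrier G; z \<in> carrier G\<rbrakk> \<Longrightarrow> (x \<ominus> y) \<oplus> (y \<ominus> z) = x \<ominus> z"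
  by (simp add: a_minus_def a_ac r_neg1 r_neg2)

lemma plus_minus_plus: "\<lbrakk>x \<in> carrier G; y \<in> carrier G; x' \<in> carrier G; y' \<in> carrier G\<rbrakk> \<Longrightarrow>
    (x \<oplus> x') \<ominus> (y \<oplus> y') = (x \<ominus> y) \<oplus> (x' \<ominus> y')"
  by (simp add: a_minus_def a_ac minus_add)

lemma minus_minus_right_cancel:
  assumes "x \<in> carrier G" "y \<in> carrier G" "z \<in> carrier G"
  shows "(x \<ominus> z) \<ominus> (y \<ominus> z) = x \<ominus> y"
proof -
  have "\<ominus> (y \<ominus> z) = z \<ominus> y"
    using assms by (simp add: a_minus_def minus_add a_comm)
  then show ?thesis
    using minus_plus_minus [of x z y] assms by (simp add: a_minus_def [of G "x \<ominus> z"])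
qed

lemma minus_minus_swap: "\<lbrakk>x \<in> carrier G; y \<in> carrier G; z \<in> carrier G\<rbrakk> \<Longrightarrow> x \<ominus> y \<ominus> z = x \<ominus> (z \<oplus> y)"
  by (simp add: a_minus_def a_ac minus_add)

end

definition mod_homotopy ::
  "('a, 'c) ring_scheme \<Rightarrow> ('a, 'p, 'm) resolution \<Rightarrow> (nat \<Rightarrow> 'p set) \<Rightarrow> (nat \<Rightarrow> 'p \<Rightarrow> 'p)
    \<Rightarrow> (nat \<Rightarrow> 'p \<Rightarrow> 'p) \<Rightarrow> bool" where
  "mod_homotopy A P K c s \<longleftrightarrow> (\<forall>k. s k \<in> linear_maps A (res_obj P k) (res_obj P (Suc k))) \<and>
    (\<forall>x\<in>carrier (res_obj P 0). c 0 x \<ominus>\<^bsub>res_obj P 0\<^esub>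
      (res_diff P 0 (s 0 x) \<oplus>\<^bsub>res_obj P 0\<^esub> x) \<in> K 0) \<and>
    (\<forall>k. \<forall>x\<in>carrier (res_obj P (Suc k)). c (Suc k) x \<ominus>\<^bsub>res_obj P (Suc k)\<^esub>
      (res_diff P (Suc k) (s (Suc k) x) \<oplus>\<^bsub>res_obj P (Suc k)\<^esub>
        (s k (res_diff P k x) \<oplus>\<^bsub>res_obj P (Suc k)\<^esub> x)) \<in> K (Suc k))"
  \<comment> \<open>\<open>c - id = d s + s d\<close> modulo \<open>K\<close>\<close>

text \<open>This is the usual construction of a homotopy, carried out in \<open>P / K\<close>
  without forming the quotient. In positive degrees exactness modulo \<open>K\<close> replaces
  exactness of \<open>P\<close>; in degree 0 the exactness of \<open>P\<close> itself applies,
  because \<open>c 0\<close> commutes with the augmentation. For \<open>K = 0\<close> it is the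
  classical statement.\<close>

lemma (in left_unital_algebra) homotopy_mod_exists:
  fixes P :: "('a, 'p, 'm) resolution"
  assumes P: "projective_resolution A M P" and M: "abelian_group M"
    and K: "\<And>k. act_submodule A (res_obj P k) (K k)"
    and exact: "\<And>k x. \<lbrakk>x \<in> carrier (res_obj P (Suc k)); res_diff P k x \<in> K k\<rbrakk> \<Longrightarrow>
      \<exists>y\<in>carrier (res_obj P (Suc (Suc k))).
        x \<ominus>\<^bsub>res_obj P (Suc k)\<^esub> res_diff P (Suc k) y \<in> K (Suc k)"
    and c_closed: "\<And>k x. x \<in> carrier (res_obj P k) \<Longrightarrow> c k x \<in> carrier (res_obj P k)"
    and c_add: "\<And>k x y. \<lbrakk>x \<in> carrier (res_obj P k); y \<in> carrier (res_obj P k)\<rbrakk> \<Longrightarrow>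
      c k (x \<oplus>\<^bsub>res_obj P k\<^esub> y) = c k x \<oplus>\<^bsub>res_obj P k\<^esub> c k y"
    and c_act: "\<And>k a x. \<lbrakk>a \<in> carrier A; x \<in> carrier (res_obj P k)\<rbrakk> \<Longrightarrow>
      c k (a \<odot>\<^bsub>res_obj P k\<^esub> x) \<ominus>\<^bsub>res_obj P k\<^esub> a \<odot>\<^bsub>res_obj P k\<^esub> c k x \<in> K k"
    and c_diff: "\<And>k x. x \<in> carrier (res_obj P (Suc k)) \<Longrightarrow>
      c k (res_diff P k x) = res_diff P k (c (Suc k) x)"
    and c_aug: "\<And>x. x \<in> carrier (res_obj P 0) \<Longrightarrow> res_aug P (c 0 x) = res_aug P x"
  shows "\<exists>s. mod_homotopy A P K c s"
proof -
  interpret id: algebra_map A A "\<lambda>a. a"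
    by unfold_locales auto
  interpret R: proj_resolution A M P by unfold_locales (rule P)
  note proj = R.proj and mP = R.obj and gP = R.grp and d = R.diff and dc = R.diff_closed
  note aug = R.aug and d_d = R.diff_diff and ex0 = R.exact_0
  interpret P: right_module A "res_obj P k" for k
    by (rule mP)
  have K0: "\<zero>\<^bsub>res_obj P k\<^esub> \<in> K k" for k
    using K [of k] by (simp add: act_submodule_def)
  \<comment> \<open>One step of the recursion: a map \<open>u\<close> that is linear modulo
    \<open>K\<close> and has values in the image of the differential modulo \<open>K\<close> lifts
    to an honestly linear \<open>s\<close>.\<close>
  have lift: "\<exists>s\<in>linear_maps A (res_obj P k) (res_obj P (Suc k)).
      \<forall>x\<in>carrier (res_obj P k). u x \<ominus>\<^bsub>res_obj P k\<^esub> res_diff P k (s x) \<in> K k"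
    if uc: "\<And>x. x \<in> carrier (res_obj P k) \<Longrightarrow> u x \<in> carrier (res_obj P k)"
    and ua: "\<And>x y. \<lbrakk>x \<in> carrier (res_obj P k); y \<in> carrier (res_obj P k)\<rbrakk> \<Longrightarrow>
      u (x \<oplus>\<^bsub>res_obj P k\<^esub> y) = u x \<oplus>\<^bsub>res_obj P k\<^esub> u y"
    and uact: "\<And>a x. \<lbrakk>a \<in> carrier A; x \<in> carrier (res_obj P k)\<rbrakk> \<Longrightarrow>
      u (a \<odot>\<^bsub>res_obj P k\<^esub> x) \<ominus>\<^bsub>res_obj P k\<^esub> a \<odot>\<^bsub>res_obj P k\<^esub> u x \<in> K k"
    and im: "\<And>x. x \<in> carrier (res_obj P k) \<Longrightarrow> \<exists>y\<in>carrier (res_obj P (Suc k)).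
      u x \<ominus>\<^bsub>res_obj P k\<^esub> res_diff P k y \<in> K k" for u k
  proof -
    let ?E = "\<lambda>x y. x \<ominus>\<^bsub>res_obj P k\<^esub> y \<in> K k"
    have refl: "?E x x" if "x \<in> carrier (res_obj P k)" for x
      using that K0 P.minus_eq_zero_iff [of x k x] by simp
    obtain s where "s \<in> linear_maps A (res_obj P k) (res_obj P (Suc k))"
      "\<And>x. x \<in> carrier (res_obj P k) \<Longrightarrow> ?E (u x) (res_diff P k (s x))"
    proof (rule id.projective_lift [where E = ?E and u = u, OF proj mP gP P.act_closed
          P.zero_act [OF abelian_group_axioms] d refl _ _ _ uc _ uact im])
      show "?E x z" if "?E x y" "?E y z" "x \<in> carrier (res_obj P k)" "y \<in> carrier (res_obj P k)"
        "z \<in> carrier (res_obj P k)" for x y z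
        using that K [of k] P.minus_plus_minus [of x k y z] unfolding act_submodule_def by metis
      show "?E (x \<oplus>\<^bsub>res_obj P k\<^esub> x') (y \<oplus>\<^bsub>res_obj P k\<^esub> y')"
        if "?E x y" "?E x' y'" "x \<in> carrier (res_obj P k)" "y \<in> carrier (res_obj P k)"
        "x' \<in> carrier (res_obj P k)" "y' \<in> carrier (res_obj P k)" for x y x' y'
        using that K [of k] by (simp add: P.plus_minus_plus act_submodule_def)
      show "?E (a \<odot>\<^bsub>res_obj P k\<^esub> x) (a \<odot>\<^bsub>res_obj P k\<^esub> y)"
        if "?E x y" "a \<in> carrier A" "x \<in> carrier (res_obj P k)" "y \<in> carrier (res_obj P k)" for a x y
        using that K [of k] by (simp add: P.act_minus [symmetric] act_submodule_def)
    qed (simp_all add: ua refl uc)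
    then show ?thesis by blast
  qed
  \<comment> \<open>The last clause is the homotopy identity on boundaries, where the contribution
    of the previous homotopy vanishes because two successive differentials compose to zero. It is
    the condition under which the next degree can be solved.\<close>
  define good where "good k s \<longleftrightarrow> s \<in> linear_maps A (res_obj P k) (res_obj P (Suc k)) \<and>
    (k = 0 \<longrightarrow> (\<forall>x\<in>carrier (res_obj P 0). c 0 x \<ominus>\<^bsub>res_obj P 0\<^esub>
      (res_diff P 0 (s x) \<oplus>\<^bsub>res_obj P 0\<^esub> x) \<in> K 0)) \<and>
    (\<forall>x\<in>carrier (res_obj P (Suc k)). c k (res_diff P k x) \<ominus>\<^bsub>res_obj P k\<^esub>
      (res_diff P k (s (res_diff P k x)) \<oplus>\<^bsub>res_obj P k\<^esub> res_diff P k x) \<in> K k)" for k s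
  have "\<exists>s. \<forall>k. good k (s k) \<and> (\<forall>x\<in>carrier (res_obj P (Suc k)). c (Suc k) x \<ominus>\<^bsub>res_obj P (Suc k)\<^esub>
      (res_diff P (Suc k) (s (Suc k) x) \<oplus>\<^bsub>res_obj P (Suc k)\<^esub>
        (s k (res_diff P k x) \<oplus>\<^bsub>res_obj P (Suc k)\<^esub> x)) \<in> K (Suc k))"
  proof (rule dependent_nat_choice)
    have "\<exists>s\<in>linear_maps A (res_obj P 0) (res_obj P (Suc 0)). \<forall>x\<in>carrier (res_obj P 0).
        (c 0 x \<ominus>\<^bsub>res_obj P 0\<^esub> x) \<ominus>\<^bsub>res_obj P 0\<^esub> res_diff P 0 (s x) \<in> K 0"
    proof (rule lift)
      fix x assume x: "x \<in> carrier (res_obj P 0)"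
      then have "res_aug P (c 0 x \<ominus>\<^bsub>res_obj P 0\<^esub> x) = \<zero>\<^bsub>M\<^esub>"
        using semilinear_minus [OF aug gP M c_closed x] c_aug [OF x] semilinear_closed [OF aug x]
          abelian_group.minus_eq_zero_iff [OF M] by simp
      then obtain y where y: "y \<in> carrier (res_obj P (Suc 0))" "c 0 x \<ominus>\<^bsub>res_obj P 0\<^esub> x = res_diff P 0 y"
        using ex0 [of "c 0 x \<ominus>\<^bsub>res_obj P 0\<^esub> x"] x c_closed by auto
      then show "\<exists>y\<in>carrier (res_obj P (Suc 0)).
          c 0 x \<ominus>\<^bsub>res_obj P 0\<^esub> x \<ominus>\<^bsub>res_obj P 0\<^esub> res_diff P 0 y \<in> K 0"
        using K0 dc [OF y(1)] by (metis P.minus_eq_zero_iff)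
    next
      fix a x assume a: "a \<in> carrier A" and x: "x \<in> carrier (res_obj P 0)"
      show "c 0 (a \<odot>\<^bsub>res_obj P 0\<^esub> x) \<ominus>\<^bsub>res_obj P 0\<^esub> a \<odot>\<^bsub>res_obj P 0\<^esub> x \<ominus>\<^bsub>res_obj P 0\<^esub>
          a \<odot>\<^bsub>res_obj P 0\<^esub> (c 0 x \<ominus>\<^bsub>res_obj P 0\<^esub> x) \<in> K 0"
        using c_act [OF a x] a x
        by (simp add: P.act_minus P.minus_minus_right_cancel P.act_closed c_closed)
    qed (simp_all add: c_closed c_add P.plus_minus_plus)
    then obtain s where s: "s \<in> linear_maps A (res_obj P 0) (res_obj P (Suc 0))"
      "\<And>x. x \<in> carrier (res_obj P 0) \<Longrightarrow>
        (c 0 x \<ominus>\<^bsub>res_obj P 0\<^esub> x) \<ominus>\<^bsub>res_obj P 0\<^esub> res_diff P 0 (s x) \<in> K 0" by blast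
    have "c 0 x \<ominus>\<^bsub>res_obj P 0\<^esub> (res_diff P 0 (s x) \<oplus>\<^bsub>res_obj P 0\<^esub> x) \<in> K 0"
      if x: "x \<in> carrier (res_obj P 0)" for x
      using s(2) [OF x] c_closed x dc [OF semilinear_closed [OF s(1) x]]
      by (simp add: P.minus_minus_swap)
    then have "good 0 s"
      unfolding good_def using s(1) dc by blast
    then show "\<exists>s. good 0 s" by blast
  next
    fix s k assume "good k s"
    then have s: "s \<in> linear_maps A (res_obj P k) (res_obj P (Suc k))"
      and good: "\<And>x. x \<in> carrier (res_obj P (Suc k)) \<Longrightarrow> c k (res_diff P k x) \<ominus>\<^bsub>res_obj P k\<^esub>
      (res_diff P k (s (res_diff P k x)) \<oplus>\<^bsub>res_obj P k\<^esub> res_diff P k x) \<in> K k"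
      by (auto simp: good_def)
    have sdc: "s (res_diff P k x) \<in> carrier (res_obj P (Suc k))"
      if "x \<in> carrier (res_obj P (Suc k))" for x
      using semilinear_closed [OF s dc [OF that]] .
    \<comment> \<open>The next homotopy has to satisfy \<open>d s' = c - ?v\<close> modulo
      \<open>K\<close>, and the invariant says that \<open>c - ?v\<close> is a cycle modulo
      \<open>K\<close>.\<close>
    let ?v = "\<lambda>x. s (res_diff P k x) \<oplus>\<^bsub>res_obj P (Suc k)\<^esub> x"
    have "\<exists>s'\<in>linear_maps A (res_obj P (Suc k)) (res_obj P (Suc (Suc k))).
        \<forall>x\<in>carrier (res_obj P (Suc k)).
        (c (Suc k) x \<ominus>\<^bsub>res_obj P (Suc k)\<^esub> ?v x) \<ominus>\<^bsub>res_obj P (Suc k)\<^esub> res_diff P (Suc k) (s' x) \<in> K (Suc k)"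
    proof (rule lift)
      fix x assume x: "x \<in> carrier (res_obj P (Suc k))"
      show "\<exists>y\<in>carrier (res_obj P (Suc (Suc k))).
          c (Suc k) x \<ominus>\<^bsub>res_obj P (Suc k)\<^esub> ?v x \<ominus>\<^bsub>res_obj P (Suc k)\<^esub> res_diff P (Suc k) y \<in> K (Suc k)"
      proof (rule exact)
        have v: "?v x \<in> carrier (res_obj P (Suc k))"
          using sdc x by simp
        then show "c (Suc k) x \<ominus>\<^bsub>res_obj P (Suc k)\<^esub> ?v x \<in> carrier (res_obj P (Suc k))"
          using x c_closed by simp
        show "res_diff P k (c (Suc k) x \<ominus>\<^bsub>res_obj P (Suc k)\<^esub> ?v x) \<in> K k"
          using good [OF x] x sdc [OF x]
          by (simp add: semilinear_minus [OF d gP gP c_closed v] semilinear_add [OF d] c_diff)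
      qed
      fix y assume y: "y \<in> carrier (res_obj P (Suc k))"
      have "?v (x \<oplus>\<^bsub>res_obj P (Suc k)\<^esub> y) = ?v x \<oplus>\<^bsub>res_obj P (Suc k)\<^esub> ?v y"
        using x y dc sdc by (simp add: semilinear_add [OF d] semilinear_add [OF s] P.a_ac)
      then show "c (Suc k) (x \<oplus>\<^bsub>res_obj P (Suc k)\<^esub> y) \<ominus>\<^bsub>res_obj P (Suc k)\<^esub> ?v (x \<oplus>\<^bsub>res_obj P (Suc k)\<^esub> y)
         = (c (Suc k) x \<ominus>\<^bsub>res_obj P (Suc k)\<^esub> ?v x) \<oplus>\<^bsub>res_obj P (Suc k)\<^esub>
           (c (Suc k) y \<ominus>\<^bsub>res_obj P (Suc k)\<^esub> ?v y)"
        using x y sdc c_closed by (simp only: c_add P.plus_minus_plus P.add.m_closed)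
    next
      fix a x assume a: "a \<in> carrier A" and x: "x \<in> carrier (res_obj P (Suc k))"
      have "?v (a \<odot>\<^bsub>res_obj P (Suc k)\<^esub> x) = a \<odot>\<^bsub>res_obj P (Suc k)\<^esub> ?v x"
        using a x dc sdc
        by (simp add: semilinear_act [OF d] semilinear_act [OF s] P.act_add)
      then show "c (Suc k) (a \<odot>\<^bsub>res_obj P (Suc k)\<^esub> x) \<ominus>\<^bsub>res_obj P (Suc k)\<^esub> ?v (a \<odot>\<^bsub>res_obj P (Suc k)\<^esub> x)
          \<ominus>\<^bsub>res_obj P (Suc k)\<^esub> a \<odot>\<^bsub>res_obj P (Suc k)\<^esub> (c (Suc k) x \<ominus>\<^bsub>res_obj P (Suc k)\<^esub> ?v x) \<in> K (Suc k)"
        using c_act [OF a x] a x sdc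
        by (simp add: P.act_minus P.minus_minus_right_cancel P.act_closed c_closed)
    qed (simp add: c_closed sdc)
    then obtain s' where s': "s' \<in> linear_maps A (res_obj P (Suc k)) (res_obj P (Suc (Suc k)))"
      "\<And>x. x \<in> carrier (res_obj P (Suc k)) \<Longrightarrow>
        (c (Suc k) x \<ominus>\<^bsub>res_obj P (Suc k)\<^esub> ?v x) \<ominus>\<^bsub>res_obj P (Suc k)\<^esub> res_diff P (Suc k) (s' x) \<in> K (Suc k)"
      by blast
    have *: "c (Suc k) x \<ominus>\<^bsub>res_obj P (Suc k)\<^esub>
        (res_diff P (Suc k) (s' x) \<oplus>\<^bsub>res_obj P (Suc k)\<^esub> ?v x) \<in> K (Suc k)"
      if x: "x \<in> carrier (res_obj P (Suc k))" for x
      using s'(2) [OF x] x c_closed [of x "Suc k"] dc [OF semilinear_closed [OF s'(1) x]] sdc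
      by (simp add: P.minus_minus_swap)
    have "good (Suc k) s'"
      unfolding good_def
    proof (intro conjI ballI s'(1))
      fix x assume x: "x \<in> carrier (res_obj P (Suc (Suc k)))"
      then show "c (Suc k) (res_diff P (Suc k) x) \<ominus>\<^bsub>res_obj P (Suc k)\<^esub>
          (res_diff P (Suc k) (s' (res_diff P (Suc k) x)) \<oplus>\<^bsub>res_obj P (Suc k)\<^esub> res_diff P (Suc k) x) \<in> K (Suc k)"
        using * [OF dc [OF x]] dc [OF x] d_d [OF x] semilinear_zero [OF s gP gP] by simp
    qed simp
    then show "\<exists>s'. good (Suc k) s' \<and> (\<forall>x\<in>carrier (res_obj P (Suc k)). c (Suc k) x \<ominus>\<^bsub>res_obj P (Suc k)\<^esub>
      (res_diff P (Suc k) (s' x) \<oplus>\<^bsub>res_obj P (Suc k)\<^esub> (s (res_diff P k x) \<oplus>\<^bsub>res_obj P (Suc k)\<^esub> x)) \<in> K (Suc k))"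
      using * by blast
  qed
  then obtain s where s: "\<And>k. good k (s k)" "\<And>k x. x \<in> carrier (res_obj P (Suc k)) \<Longrightarrow>
      c (Suc k) x \<ominus>\<^bsub>res_obj P (Suc k)\<^esub> (res_diff P (Suc k) (s (Suc k) x) \<oplus>\<^bsub>res_obj P (Suc k)\<^esub>
        (s k (res_diff P k x) \<oplus>\<^bsub>res_obj P (Suc k)\<^esub> x)) \<in> K (Suc k)" by blast
  have "mod_homotopy A P K c s"
    unfolding mod_homotopy_def
  proof (intro conjI allI ballI)
    show "s k \<in> linear_maps A (res_obj P k) (res_obj P (Suc k))" for k
      using s(1) [of k] by (simp add: good_def)
    show "c 0 x \<ominus>\<^bsub>res_obj P 0\<^esub> (res_diff P 0 (s 0 x) \<oplus>\<^bsub>res_obj P 0\<^esub> x) \<in> K 0"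
      if "x \<in> carrier (res_obj P 0)" for x
      using s(1) [of 0] that by (simp add: good_def)
  qed (rule s(2))
  then show ?thesis by blast
qed

subsection \<open>Submodules generated by left ideals\<close>

text \<open>On paper this is \<open>M L\<close>, the set of finite sums of products
  \<open>q a\<close> with \<open>q\<close> in \<open>M\<close> and \<open>a\<close> in
  \<open>L\<close>. Negatives come for free from \<open>- (q a) = (- q) a\<close>.\<close>

inductive_set act_span :: "('a, 'm, 'd) module_scheme \<Rightarrow> 'a set \<Rightarrow> 'm set"
  for M :: "('a, 'm, 'd) module_scheme" and L :: "'a set" where
  zero: "\<zero>\<^bsub>M\<^esub> \<in> act_span M L"
| add: "\<lbrakk>x \<in> act_span M L; q \<in> carrier M; a \<in> L\<rbrakk> \<Longrightarrow> x \<oplus>\<^bsub>M\<^esub> a \<odot>\<^bsub>M\<^esub> q \<in> act_span M L"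

text \<open>A left ideal, up to the proviso that the product lies in the carrier;
  \<open>left_unital_algebra\<close> does not provide closure under multiplication.\<close>

definition left_absorbing :: "('a, 'c) ring_scheme \<Rightarrow> 'a set \<Rightarrow> bool" where
  "left_absorbing A L \<longleftrightarrow> L \<subseteq> carrier A \<and> \<zero>\<^bsub>A\<^esub> \<in> L \<and> (\<forall>a\<in>L. \<forall>b\<in>L. a \<oplus>\<^bsub>A\<^esub> b \<in> L) \<and>
    (\<forall>b\<in>carrier A. \<forall>a\<in>L. b \<otimes>\<^bsub>A\<^esub> a \<in> carrier A \<longrightarrow> b \<otimes>\<^bsub>A\<^esub> a \<in> L)"

lemma left_absorbing_Int: "\<lbrakk>left_absorbing A X; left_absorbing A Y\<rbrakk> \<Longrightarrow> left_absorbing A (X \<inter> Y)"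
  by (auto simp: left_absorbing_def)

context right_module
begin

lemma span_closed: "\<lbrakk>L \<subseteq> carrier A; x \<in> act_span M L\<rbrakk> \<Longrightarrow> x \<in> carrier M"
  by (rotate_tac, induction rule: act_span.induct) (auto simp: act_closed subset_iff)

lemma span_act:
  assumes "L \<subseteq> carrier A" "a \<in> L" "q \<in> carrier M"
  shows "a \<odot>\<^bsub>M\<^esub> q \<in> act_span M L"
proof -
  have "\<zero>\<^bsub>M\<^esub> \<oplus>\<^bsub>M\<^esub> a \<odot>\<^bsub>M\<^esub> q \<in> act_span M L"
    by (rule act_span.add [OF act_span.zero]) (use assms in auto)
  then show ?thesis
    using assms act_closed [of a q] by auto
qed

lemma span_add:
  assumes L: "L \<subseteq> carrier A" and x: "x \<in> act_span M L" and y: "y \<in> act_span M L"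
  shows "x \<oplus>\<^bsub>M\<^esub> y \<in> act_span M L"
  using y
proof induction
  case zero
  then show ?case using x span_closed [OF L x] by simp
next
  case (add y q a)
  have "x \<oplus>\<^bsub>M\<^esub> y \<oplus>\<^bsub>M\<^esub> a \<odot>\<^bsub>M\<^esub> q \<in> act_span M L"
    by (rule act_span.add [OF add.IH add.hyps(2,3)])
  moreover have "a \<odot>\<^bsub>M\<^esub> q \<in> carrier M"
    using add L by (auto intro: act_closed)
  ultimately show ?case
    using span_closed [OF L x] span_closed [OF L add.hyps(1)] by (simp add: M.a_assoc)
qed

lemma span_neg:
  assumes L: "L \<subseteq> carrier A" and x: "x \<in> act_span M L"
  shows "\<ominus>\<^bsub>M\<^esub> x \<in> act_span M L"
  using x
proof induction
  case zero
  have "\<ominus>\<^bsub>M\<^esub> \<zero>\<^bsub>M\<^esub> = \<zero>\<^bsub>M\<^esub>"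
    by (rule M.minus_equality) auto
  then show ?case using act_span.zero [of M L] by (simp only:)
next
  case (add x q a)
  have a: "a \<in> carrier A" using add L by auto
  then have "\<ominus>\<^bsub>M\<^esub> (x \<oplus>\<^bsub>M\<^esub> a \<odot>\<^bsub>M\<^esub> q) = \<ominus>\<^bsub>M\<^esub> x \<oplus>\<^bsub>M\<^esub> a \<odot>\<^bsub>M\<^esub> (\<ominus>\<^bsub>M\<^esub> q)"
    using add span_closed [OF L add.hyps(1)] by (simp add: act_neg act_closed M.minus_add)
  then show ?case
    using act_span.add [OF add.IH] add by simp
qed

lemma span_map:
  assumes L: "L \<subseteq> carrier A" and x: "x \<in> act_span M L" and N: "right_module A N"
    and f: "f \<in> linear_maps A M N"
  shows "f x \<in> act_span N L"
  using x
proof induction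
  case zero
  have "f \<zero>\<^bsub>M\<^esub> = \<zero>\<^bsub>N\<^esub>"
    using N f M.abelian_group_axioms by (intro semilinear_zero) (auto simp: right_module_def)
  then show ?case using act_span.zero [of N] by simp
next
  case (add x q a)
  have a: "a \<in> carrier A" using add L by auto
  then have "f (x \<oplus>\<^bsub>M\<^esub> a \<odot>\<^bsub>M\<^esub> q) = f x \<oplus>\<^bsub>N\<^esub> a \<odot>\<^bsub>N\<^esub> f q"
    using add span_closed [OF L add.hyps(1)]
    by (simp add: semilinear_add [OF f] semilinear_act [OF f] act_closed)
  then show ?case
    using act_span.add [OF add.IH] add semilinear_closed [OF f] by simp
qed

lemma span_decompose:
  assumes X: "X \<subseteq> carrier A" and Y: "Y \<subseteq> carrier A"
    and L: "\<And>a. a \<in> L \<Longrightarrow> \<exists>b\<in>X. \<exists>c\<in>Y. a = b \<oplus>\<^bsub>A\<^esub> c" and x: "x \<in> act_span M L"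
  shows "\<exists>y\<in>act_span M X. \<exists>z\<in>act_span M Y. x = y \<oplus>\<^bsub>M\<^esub> z"
  using x
proof induction
  case zero
  then show ?case using act_span.zero [of M] M.r_zero [OF M.zero_closed] by metis
next
  case (add x q a)
  then obtain y z where yz: "y \<in> act_span M X" "z \<in> act_span M Y" "x = y \<oplus>\<^bsub>M\<^esub> z" by blast
  obtain b c where bc: "b \<in> X" "c \<in> Y" "a = b \<oplus>\<^bsub>A\<^esub> c"
    using L [OF add.hyps(3)] by blast
  have c: "b \<in> carrier A" "c \<in> carrier A" "y \<in> carrier M" "z \<in> carrier M"
    using bc yz X Y span_closed by auto
  have "x \<oplus>\<^bsub>M\<^esub> a \<odot>\<^bsub>M\<^esub> q = (y \<oplus>\<^bsub>M\<^esub> b \<odot>\<^bsub>M\<^esub> q) \<oplus>\<^bsub>M\<^esub> (z \<oplus>\<^bsub>M\<^esub> c \<odot>\<^bsub>M\<^esub> q)"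
    using c add.hyps(2) by (simp add: bc yz act_add_scalar act_closed M.a_ac)
  then show ?case
    using act_span.add [OF yz(1) add.hyps(2) bc(1)] act_span.add [OF yz(2) add.hyps(2) bc(2)] by blast
qed

end

section \<open>Coordinates in projective modules\<close>

context left_unital_algebra
begin

text \<open>The coordinates are those of the section \<open>s\<close> into a free module. A product
  \<open>q a\<close> has coordinates in \<open>L\<close> since \<open>L\<close> absorbs from the
  left; conversely \<open>x = r (s x)\<close> is a sum of images of basis elements multiplied by the
  coordinates of \<open>x\<close>. One \<open>c\<close> serves all \<open>L\<close> at once, which
  is what makes intersections tractable.\<close>

lemma projective_span_iff:
  fixes M :: "('a, 'm, 'd) module_scheme"
  assumes "projective_right_module A M"
  obtains c :: "'m \<Rightarrow> 'm \<Rightarrow> 'a" where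
    "\<And>L x. left_absorbing A L \<Longrightarrow> x \<in> act_span M L \<longleftrightarrow> x \<in> carrier M \<and> (\<forall>z. c x z \<in> L)"
    "\<And>x a z. \<lbrakk>x \<in> carrier M; a \<in> carrier A\<rbrakk> \<Longrightarrow> c (a \<odot>\<^bsub>M\<^esub> x) z = c x z \<otimes> a"
    "\<And>x z. x \<in> carrier M \<Longrightarrow> c x z \<in> carrier A"
proof -
  interpret M: right_module A M
    using assms by (simp add: projective_right_module_def)
  obtain X :: "'m set" and s r where s: "s \<in> linear_maps A M (free_right_module A X)"
    and r: "r \<in> linear_maps A (free_right_module A X) M" and rs: "\<And>m. m \<in> carrier M \<Longrightarrow> r (s m) = m"
    using assms unfolding projective_right_module_def by blast
  have sc: "s m \<in> fin_supp A X" if "m \<in> carrier M" for m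
    using semilinear_closed [OF s that] by (simp add: free_right_module_def)
  have rc: "r v \<in> carrier M" if "v \<in> fin_supp A X" for v
    using semilinear_closed [OF r] that by (simp add: free_right_module_def)
  have s_add: "s (x \<oplus>\<^bsub>M\<^esub> y) = (\<lambda>z. s x z \<oplus> s y z)" if "x \<in> carrier M" "y \<in> carrier M" for x y
    using semilinear_add [OF s that] by (simp add: free_right_module_def)
  have s_act: "s (a \<odot>\<^bsub>M\<^esub> x) = (\<lambda>z. s x z \<otimes> a)" if "x \<in> carrier M" "a \<in> carrier A" for x a
    using semilinear_act [OF s that(2,1)] by (simp add: free_right_module_def)
  have r_add: "r (\<lambda>x. v x \<oplus> w x) = r v \<oplus>\<^bsub>M\<^esub> r w" if "v \<in> fin_supp A X" "w \<in> fin_supp A X" for v w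
    using semilinear_add [OF r] that by (simp add: free_right_module_def)
  have r_delta: "r (delta A x a) = a \<odot>\<^bsub>M\<^esub> r (delta A x \<one>)" if "x \<in> X" "a \<in> carrier A" for x a
  proof -
    have "delta A x a = (\<lambda>z. delta A x \<one> z \<otimes> a)"
      using that by (auto simp: delta_def left_unit zero_mult)
    then show ?thesis
      using semilinear_act [OF r that(2), of "delta A x \<one>"] delta_fin_supp [OF that(1) unit_closed]
      by (simp add: free_right_module_def)
  qed
  have s_zero: "s \<zero>\<^bsub>M\<^esub> z = \<zero>" for z
    using s_add [OF M.zero_closed M.zero_closed] fin_supp_closed [OF sc [OF M.zero_closed], of z]
    by (metis M.r_zero M.zero_closed add.r_cancel_one')
  have r_zero: "r (\<lambda>_. \<zero>) = \<zero>\<^bsub>M\<^esub>"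
    using r_add [OF zero_fin_supp zero_fin_supp] rc [OF zero_fin_supp] by simp
  show ?thesis
  proof
    fix L x assume "left_absorbing A L"
    then have L: "L \<subseteq> carrier A" "\<zero> \<in> L" "\<And>a b. \<lbrakk>a \<in> L; b \<in> L\<rbrakk> \<Longrightarrow> a \<oplus> b \<in> L"
      "\<And>a b. \<lbrakk>b \<in> carrier A; a \<in> L; b \<otimes> a \<in> carrier A\<rbrakk> \<Longrightarrow> b \<otimes> a \<in> L"
      by (auto simp: left_absorbing_def)
    show "x \<in> act_span M L \<longleftrightarrow> x \<in> carrier M \<and> (\<forall>z. s x z \<in> L)"
    proof (intro iffI conjI allI)
      assume x: "x \<in> act_span M L"
      then show "x \<in> carrier M" by (rule M.span_closed [OF L(1)])
      show "s x z \<in> L" for z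
        using x
      proof induction
        case zero
        then show ?case using L s_zero by simp
      next
        case (add x q a)
        have a: "a \<in> carrier A" "x \<in> carrier M"
          using add L M.span_closed [OF L(1)] by auto
        \<comment> \<open>The product is a coordinate of the module element \<open>q a\<close> and
          hence lies in the carrier; this settles the proviso in
          \<open>left_absorbing\<close>.\<close>
        have "s q z \<otimes> a \<in> carrier A"
          using fin_supp_closed [OF sc, of "a \<odot>\<^bsub>M\<^esub> q" z] add a by (simp add: s_act M.act_closed)
        then have "s q z \<otimes> a \<in> L"
          using add a fin_supp_closed [OF sc] by (intro L(4)) auto
        then show ?case
          using add a by (simp add: s_add s_act M.act_closed L(3))
      qed
    next
      assume x: "x \<in> carrier M \<and> (\<forall>z. s x z \<in> L)"
      have "r v \<in> act_span M L" if "v \<in> fin_supp A X" "\<And>z. v z \<in> L" for v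
        using that L(2)
      proof (induction rule: fin_supp_induct [consumes 3, case_names zero add])
        case zero
        then show ?case using r_zero act_span.zero [of M] by simp
      next
        case (add w x a)
        have "r (\<lambda>z. w z \<oplus> delta A x a z) = r w \<oplus>\<^bsub>M\<^esub> a \<odot>\<^bsub>M\<^esub> r (delta A x \<one>)"
          using add by (simp add: r_add delta_fin_supp r_delta)
        then show ?case
          using add rc [OF delta_fin_supp [OF add.hyps(2) unit_closed]] act_span.add [OF add.IH] by auto
      qed
      then show "x \<in> act_span M L"
        using x rs sc by metis
    qed
  qed (use s_act fin_supp_closed [OF sc] in auto)
qed

text \<open>Membership in both spans is read off the same system of coordinates, which then have to
  lie in \<open>X\<close> and in \<open>Y\<close>.\<close>

lemma span_Int:
  assumes "projective_right_module A M" "left_absorbing A X" "left_absorbing A Y"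
    "x \<in> act_span M X" "x \<in> act_span M Y"
  shows "x \<in> act_span M (X \<inter> Y)"
proof (rule projective_span_iff [OF assms(1)])
  fix c :: "'b \<Rightarrow> 'b \<Rightarrow> 'a"
  assume *: "\<And>L x. left_absorbing A L \<Longrightarrow> x \<in> act_span M L \<longleftrightarrow> x \<in> carrier M \<and> (\<forall>z. c x z \<in> L)"
  then show ?thesis
    using assms(4,5) unfolding * [OF assms(2)] * [OF assms(3)] * [OF left_absorbing_Int [OF assms(2,3)]]
    by blast
qed

text \<open>The argument goes through coordinates instead of \<open>(q b) a = q (b a)\<close>,
  because \<open>b \<otimes> a\<close> is not known to lie in the carrier, whereas
  \<open>c x z \<otimes> a\<close> does, being a coordinate of an element of
  \<open>M\<close>.\<close>

lemma span_act_submodule: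
  assumes M: "projective_right_module A M" and L: "left_absorbing A L"
    and right: "\<And>a b. \<lbrakk>b \<in> L; a \<in> carrier A; b \<otimes> a \<in> carrier A\<rbrakk> \<Longrightarrow> b \<otimes> a \<in> L"
  shows "act_submodule A M (act_span M L)"
proof -
  interpret M: right_module A M
    using M by (simp add: projective_right_module_def)
  have Lc: "L \<subseteq> carrier A" using L by (simp add: left_absorbing_def)
  show ?thesis
  proof (rule projective_span_iff [OF M])
  fix c :: "'b \<Rightarrow> 'b \<Rightarrow> 'a"
  assume c:
    "\<And>L x. left_absorbing A L \<Longrightarrow> x \<in> act_span M L \<longleftrightarrow> x \<in> carrier M \<and> (\<forall>z. c x z \<in> L)"
    "\<And>x a z. \<lbrakk>x \<in> carrier M; a \<in> carrier A\<rbrakk> \<Longrightarrow> c (a \<odot>\<^bsub>M\<^esub> x) z = c x z \<otimes> a"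
    "\<And>x z. x \<in> carrier M \<Longrightarrow> c x z \<in> carrier A"
  have "a \<odot>\<^bsub>M\<^esub> x \<in> act_span M L" if a: "a \<in> carrier A" and x: "x \<in> act_span M L" for a x
  proof -
    have xc: "x \<in> carrier M" using M.span_closed [OF Lc x] .
    have "c x z \<otimes> a \<in> L" for z
    proof (rule right)
      show "c x z \<in> L" using x unfolding c(1) [OF L] by blast
      show "c x z \<otimes> a \<in> carrier A"
        using c(2) [OF xc a, of z] c(3) [OF M.act_closed [OF a xc], of z] by simp
    qed (rule a)
    then show ?thesis
      unfolding c(1) [OF L] using c(2) [OF xc a] M.act_closed [OF a xc] by simp
  qed
  then show "act_submodule A M (act_span M L)"
    using M.span_closed [OF Lc] M.span_add [OF Lc] act_span.zero [of M L]
    by (auto simp: act_submodule_def)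
  qed
qed

end

subsection \<open>Acyclicity\<close>

locale unital_resolution = left_unital_algebra A + proj_resolution A M P
  for A :: "('a, 'c) ring_scheme" and M :: "('a, 'm, 'd) module_scheme"
    and P :: "('a, 'p, 'm) resolution"
begin

definition cycle :: "nat \<Rightarrow> 'p \<Rightarrow> bool" where
  "cycle k x = (case k of 0 \<Rightarrow> True | Suc j \<Rightarrow> res_diff P j x = \<zero>\<^bsub>res_obj P j\<^esub>)"

text \<open>In degree 0 every element counts as a cycle, so \<open>P L\<close> is required to be exact there too.\<close>

definition acyclic_span :: "'a set \<Rightarrow> bool" where
  "acyclic_span L \<longleftrightarrow> (\<forall>k. \<forall>x\<in>act_span (res_obj P k) L. cycle k x \<longrightarrow>
    (\<exists>y\<in>act_span (res_obj P (Suc k)) L. res_diff P k y = x))"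

lemma acyclic_span_zero:
  assumes "L \<subseteq> {\<zero>\<^bsub>A\<^esub>}"
  shows "acyclic_span L"
proof -
  note A_grp = abelian_group_axioms
  have "x = \<zero>\<^bsub>res_obj P k\<^esub>" if "x \<in> act_span (res_obj P k) L" for x k
  proof -
    interpret right_module A "res_obj P k" by (rule obj)
    show ?thesis
      using that assms by induction (auto simp: zero_act [OF A_grp])
  qed
  then show ?thesis
    unfolding acyclic_span_def
    using semilinear_zero [OF diff grp grp] act_span.zero by metis
qed

text \<open>
  If \<open>L = A e\<close> for an idempotent \<open>e\<close>, then \<open>P L = P e\<close>, and multiplication by \<open>e\<close> projects the exact
  complex \<open>P \<rightarrow> M\<close> onto \<open>P e \<rightarrow> M e = 0\<close>.
\<close>

lemma acyclic_span_idempotent: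
  assumes L: "L \<subseteq> carrier A" and e: "e \<in> L" and Le: "\<And>a. a \<in> L \<Longrightarrow> a \<otimes>\<^bsub>A\<^esub> e = a"
    and Me: "\<And>t. t \<in> carrier M \<Longrightarrow> e \<odot>\<^bsub>M\<^esub> t = \<zero>\<^bsub>M\<^esub>"
  shows "acyclic_span L"
  unfolding acyclic_span_def
proof (intro allI ballI impI)
  fix k x assume x: "x \<in> act_span (res_obj P k) L" and cyc: "cycle k x"
  interpret R: right_module A "res_obj P k" by (rule obj)
  interpret R': right_module A "res_obj P (Suc k)" by (rule obj)
  have ec: "e \<in> carrier A" using e L by blast
  have xc: "x \<in> carrier (res_obj P k)" using R.span_closed [OF L x] .
  have ex: "e \<odot>\<^bsub>res_obj P k\<^esub> x = x"
    using x
  proof induction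
    case zero
    then show ?case using R.act_zero [OF ec] .
  next
    case (add x q a)
    have a: "a \<in> carrier A" "x \<in> carrier (res_obj P k)"
      using add L R.span_closed [OF L] by auto
    have "e \<odot>\<^bsub>res_obj P k\<^esub> (a \<odot>\<^bsub>res_obj P k\<^esub> q) = a \<odot>\<^bsub>res_obj P k\<^esub> q"
      using R.act_mult [OF a(1) ec add.hyps(2)] Le [OF add.hyps(3)] by simp
    then show ?case
      using R.act_add [OF ec a(2) R.act_closed [OF a(1) add.hyps(2)]] add.IH by simp
  qed
  have "\<exists>y\<in>carrier (res_obj P (Suc k)). x = res_diff P k y"
  proof (cases k)
    case 0
    \<comment> \<open>In degree 0 every \<open>x\<close> has to be a boundary. It is fixed by
      \<open>e\<close>, so its augmentation is fixed by \<open>e\<close> as well, and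
      \<open>e\<close> kills \<open>M\<close>.\<close>
    have "res_aug P x = e \<odot>\<^bsub>M\<^esub> res_aug P x"
      using semilinear_act [OF aug ec] xc ex 0 by metis
    also have "\<dots> = \<zero>\<^bsub>M\<^esub>"
      using Me semilinear_closed [OF aug] xc 0 by simp
    finally show ?thesis using exact_0 xc 0 by simp
  next
    case (Suc j)
    then show ?thesis using exact [of x j] xc cyc by (simp add: cycle_def)
  qed
  then obtain y where y: "y \<in> carrier (res_obj P (Suc k))" "x = res_diff P k y" by blast
  \<comment> \<open>A preimage exists in the full resolution; acting by \<open>e\<close> moves it
    into the span of \<open>L\<close> without changing its differential.\<close>
  have "res_diff P k (e \<odot>\<^bsub>res_obj P (Suc k)\<^esub> y) = x"
    using semilinear_act [OF diff ec y(1)] y(2) ex by simp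
  then show "\<exists>y\<in>act_span (res_obj P (Suc k)) L. res_diff P k y = x"
    using R'.span_act [OF L e y(1)] by blast
qed

text \<open>Mayer--Vietoris; projectivity enters through \<open>P X \<inter> P Y = P (X \<inter> Y)\<close>.\<close>

lemma acyclic_span_sum:
  assumes X: "left_absorbing A X" and Y: "left_absorbing A Y"
    and L: "L \<subseteq> carrier A" "X \<subseteq> L" "Y \<subseteq> L"
    and split: "\<And>a. a \<in> L \<Longrightarrow> \<exists>b\<in>X. \<exists>c\<in>Y. a = b \<oplus>\<^bsub>A\<^esub> c"
    and acX: "acyclic_span X" and acY: "acyclic_span Y" and acXY: "acyclic_span (X \<inter> Y)"
  shows "acyclic_span L"
  unfolding acyclic_span_def
proof (intro allI ballI impI)
  fix k z assume z: "z \<in> act_span (res_obj P k) L" and cyc: "cycle k z"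
  interpret R: right_module A "res_obj P k" by (rule obj)
  interpret R': right_module A "res_obj P (Suc k)" by (rule obj)
  have XY: "X \<subseteq> carrier A" "Y \<subseteq> carrier A" using L by auto
  have mono: "act_span (res_obj P j) X \<subseteq> act_span (res_obj P j) L"
    "act_span (res_obj P j) Y \<subseteq> act_span (res_obj P j) L"
    "act_span (res_obj P j) (X \<inter> Y) \<subseteq> act_span (res_obj P j) X"
    "act_span (res_obj P j) (X \<inter> Y) \<subseteq> act_span (res_obj P j) Y" for j
  proof -
    have "x \<in> act_span (res_obj P j) V" if "x \<in> act_span (res_obj P j) U" "U \<subseteq> V" for x U V
      using that by induction (auto intro: act_span.intros)
    then show "act_span (res_obj P j) X \<subseteq> act_span (res_obj P j) L"
    "act_span (res_obj P j) Y \<subseteq> act_span (res_obj P j) L"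
    "act_span (res_obj P j) (X \<inter> Y) \<subseteq> act_span (res_obj P j) X"
    "act_span (res_obj P j) (X \<inter> Y) \<subseteq> act_span (res_obj P j) Y"
      using L by blast+
  qed
  obtain x y where xy: "x \<in> act_span (res_obj P k) X" "y \<in> act_span (res_obj P k) Y"
    "z = x \<oplus>\<^bsub>res_obj P k\<^esub> y"
    using R.span_decompose [OF XY split z] by blast
  have c: "x \<in> carrier (res_obj P k)" "y \<in> carrier (res_obj P k)"
    using xy R.span_closed XY by blast+
  \<comment> \<open>The summands \<open>x\<close> and \<open>y\<close> of a cycle need not be
    cycles. Since \<open>d x = - d y\<close> lies in both spans, it is a cycle in the span of
    \<open>X \<inter> Y\<close>, hence equals \<open>d w\<close> for some \<open>w\<close> there;
    moving \<open>w\<close> from \<open>x\<close> to \<open>y\<close> turns both summands into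
    cycles.\<close>
  have "\<exists>w\<in>act_span (res_obj P k) (X \<inter> Y). cycle k (x \<ominus>\<^bsub>res_obj P k\<^esub> w) \<and> cycle k (w \<oplus>\<^bsub>res_obj P k\<^esub> y)"
  proof (cases k)
    case 0
    then show ?thesis using act_span.zero [of "res_obj P k"] by (auto simp: cycle_def)
  next
    case (Suc j)
    interpret S: right_module A "res_obj P j" by (rule obj)
    note d = diff [of j, folded Suc]
    have dc: "res_diff P j x \<in> carrier (res_obj P j)" "res_diff P j y \<in> carrier (res_obj P j)"
      using semilinear_closed [OF d] c by auto
    have sum: "res_diff P j x \<oplus>\<^bsub>res_obj P j\<^esub> res_diff P j y = \<zero>\<^bsub>res_obj P j\<^esub>"
      using cyc Suc xy(3) semilinear_add [OF d c] by (simp add: cycle_def)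
    then have "res_diff P j x = \<ominus>\<^bsub>res_obj P j\<^esub> res_diff P j y"
      using dc S.minus_equality by simp
    then have "res_diff P j x \<in> act_span (res_obj P j) Y"
      using S.span_neg [OF XY(2)] R.span_map [OF XY(2) xy(2) obj d] by simp
    then have dx: "res_diff P j x \<in> act_span (res_obj P j) (X \<inter> Y)"
      using span_Int [OF proj X Y] R.span_map [OF XY(1) xy(1) obj d] by blast
    have "cycle j (res_diff P j x)"
      using diff_diff c Suc by (auto simp: cycle_def split: nat.split)
    then obtain w where w: "w \<in> act_span (res_obj P k) (X \<inter> Y)" "res_diff P j w = res_diff P j x"
      using acXY dx unfolding acyclic_span_def Suc by blast
    have wc: "w \<in> carrier (res_obj P k)"
      using R.span_closed w XY by blast
    have "cycle k (x \<ominus>\<^bsub>res_obj P k\<^esub> w)"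
      using semilinear_minus [OF d grp grp c(1) wc] w(2) dc S.minus_eq_zero_iff
      by (simp add: cycle_def Suc)
    moreover have "cycle k (w \<oplus>\<^bsub>res_obj P k\<^esub> y)"
      using semilinear_add [OF d wc c(2)] w(2) sum by (simp add: cycle_def Suc)
    ultimately show ?thesis using w by blast
  qed
  then obtain w where w: "w \<in> act_span (res_obj P k) (X \<inter> Y)"
    "cycle k (x \<ominus>\<^bsub>res_obj P k\<^esub> w)" "cycle k (w \<oplus>\<^bsub>res_obj P k\<^esub> y)" by blast
  have wc: "w \<in> carrier (res_obj P k)"
    using R.span_closed w XY by blast
  have "x \<ominus>\<^bsub>res_obj P k\<^esub> w \<in> act_span (res_obj P k) X"
    using R.span_add [OF XY(1) xy(1) R.span_neg [OF XY(1) subsetD [OF mono(3) w(1)]]]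
    by (simp add: a_minus_def)
  then obtain x' where x': "x' \<in> act_span (res_obj P (Suc k)) X" "res_diff P k x' = x \<ominus>\<^bsub>res_obj P k\<^esub> w"
    using acX w(2) unfolding acyclic_span_def by blast
  have "w \<oplus>\<^bsub>res_obj P k\<^esub> y \<in> act_span (res_obj P k) Y"
    using R.span_add [OF XY(2) subsetD [OF mono(4) w(1)] xy(2)] .
  then obtain y' where y': "y' \<in> act_span (res_obj P (Suc k)) Y" "res_diff P k y' = w \<oplus>\<^bsub>res_obj P k\<^esub> y"
    using acY w(3) unfolding acyclic_span_def by blast
  have c': "x' \<in> carrier (res_obj P (Suc k))" "y' \<in> carrier (res_obj P (Suc k))"
    using x' y' R'.span_closed XY by blast+
  have "res_diff P k (x' \<oplus>\<^bsub>res_obj P (Suc k)\<^esub> y') = (x \<ominus>\<^bsub>res_obj P k\<^esub> w) \<oplus>\<^bsub>res_obj P k\<^esub> (w \<oplus>\<^bsub>res_obj P k\<^esub> y)"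
    using semilinear_add [OF diff c'] x' y' by simp
  also have "\<dots> = z"
    using c wc xy(3) by (simp add: a_minus_def R.a_assoc R.r_neg1)
  finally show "\<exists>y\<in>act_span (res_obj P (Suc k)) L. res_diff P k y = z"
    using R'.span_add [OF L(1) subsetD [OF mono(1) x'(1)] subsetD [OF mono(2) y'(1)]] by blast
qed

text \<open>This is exactness of \<open>P / P L\<close> in positive degrees: an element
  \<open>w\<close> of \<open>P L\<close> with the same differential as \<open>x\<close> exists by
  acyclicity, and \<open>x - w\<close> is then a boundary in \<open>P\<close>.\<close>

lemma acyclic_span_exact:
  assumes L: "L \<subseteq> carrier A" and ac: "acyclic_span L"
    and x: "x \<in> carrier (res_obj P (Suc k))" and dx: "res_diff P k x \<in> act_span (res_obj P k) L"
  shows "\<exists>y\<in>carrier (res_obj P (Suc (Suc k))).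
    x \<ominus>\<^bsub>res_obj P (Suc k)\<^esub> res_diff P (Suc k) y \<in> act_span (res_obj P (Suc k)) L"
proof -
  interpret R: right_module A "res_obj P k" by (rule obj)
  interpret R': right_module A "res_obj P (Suc k)" by (rule obj)
  have "cycle k (res_diff P k x)"
    using diff_diff x by (auto simp: cycle_def split: nat.split)
  then obtain w where w: "w \<in> act_span (res_obj P (Suc k)) L" "res_diff P k w = res_diff P k x"
    using ac dx unfolding acyclic_span_def by blast
  have wc: "w \<in> carrier (res_obj P (Suc k))"
    using R'.span_closed [OF L w(1)] .
  have "res_diff P k (x \<ominus>\<^bsub>res_obj P (Suc k)\<^esub> w) = \<zero>\<^bsub>res_obj P k\<^esub>"
    using semilinear_minus [OF diff grp grp x wc] w(2) diff_closed [OF x] R.minus_eq_zero_iff by simp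
  then obtain y where y: "y \<in> carrier (res_obj P (Suc (Suc k)))"
    "x \<ominus>\<^bsub>res_obj P (Suc k)\<^esub> w = res_diff P (Suc k) y"
    using exact x wc by blast
  have "x \<ominus>\<^bsub>res_obj P (Suc k)\<^esub> res_diff P (Suc k) y = w"
    using x wc by (simp add: y(2) [symmetric] a_minus_def R'.minus_add R'.r_neg1 R'.r_neg2)
  then show ?thesis using y w by auto
qed

end

subsection \<open>Composition of diagrams\<close>

lemma diagram_cover: "\<lbrakk>b \<in> diagrams n; u \<in> nodes n\<rbrakk> \<Longrightarrow> \<exists>e\<in>b. u \<in> e"
  by (auto simp: diagrams_def partition_on_def)

lemma diagram_unique: "\<lbrakk>b \<in> diagrams n; e \<in> b; e' \<in> b; u \<in> e; u \<in> e'\<rbrakk> \<Longrightarrow> e = e'"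
  by (simp add: diagrams_def partition_on_def disjoint_def) blast

lemma diagram_nodes: "\<lbrakk>b \<in> diagrams n; e \<in> b; u \<in> e\<rbrakk> \<Longrightarrow> u \<in> nodes n"
  by (auto simp: diagrams_def partition_on_def)

lemma diagram_arc_eq: "\<lbrakk>b \<in> diagrams n; e \<in> b; u \<in> e; v \<in> e; u \<noteq> v\<rbrakk> \<Longrightarrow> e = {u, v}"
  by (auto simp: diagrams_def card_2_iff)

lemma diagram_arcE:
  assumes "b \<in> diagrams n" "e \<in> b"
  obtains u v where "u \<noteq> v" "e = {u, v}"
  using assms by (auto simp: diagrams_def card_2_iff)

lemma diagram_partner:
  assumes "b \<in> diagrams n" "e \<in> b" "u \<in> e"
  obtains v where "u \<noteq> v" "e = {u, v}"
proof (rule diagram_arcE [OF assms(1,2)])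
  fix x y assume "x \<noteq> y" "e = {x, y}"
  then show ?thesis using assms(3) that [of x] that [of y] by (cases "u = x") auto
qed

lemma finite_diagrams: "finite (diagrams n)"
proof (rule finite_subset)
  show "diagrams n \<subseteq> Pow (Pow (nodes n))"
    by (auto simp: diagrams_def partition_on_def)
qed (simp add: nodes_def)

section \<open>Connected components of two glued diagrams\<close>

lemma joined_refl: "(x, x) \<in> joined b c"
  by (simp add: joined_def)

lemma joined_sym: "(x, y) \<in> joined b c \<Longrightarrow> (y, x) \<in> joined b c"
proof -
  have "sym {(x, y). {x, y} \<in> glued_arcs b c}"
    by (auto simp: sym_def insert_commute)
  then show "(x, y) \<in> joined b c \<Longrightarrow> (y, x) \<in> joined b c"
    unfolding joined_def using sym_rtrancl symD by metis
qed

lemma joined_trans: "\<lbrakk>(x, y) \<in> joined b c; (y, z) \<in> joined b c\<rbrakk> \<Longrightarrow> (x, z) \<in> joined b c"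
  unfolding joined_def by (rule rtrancl_trans)

lemma joined_left:
  assumes "{u, v} \<in> b"
  shows "(place Lft Mid u, place Lft Mid v) \<in> joined b c"
proof -
  have "place Lft Mid ` {u, v} \<in> glued_arcs b c"
    using assms unfolding glued_arcs_def by blast
  then show ?thesis
    unfolding joined_def by (intro r_into_rtrancl) simp
qed

lemma joined_right:
  assumes "{u, v} \<in> c"
  shows "(place Mid Rgt u, place Mid Rgt v) \<in> joined b c"
proof -
  have "place Mid Rgt ` {u, v} \<in> glued_arcs b c"
    using assms unfolding glued_arcs_def by blast
  then show ?thesis
    unfolding joined_def by (intro r_into_rtrancl) simp
qed

text \<open>This bounds a component from above: a set of nodes that no arc leaves contains the
  component of each of its members.\<close>

lemma joined_closed:
  assumes "(x, y) \<in> joined b c" "x \<in> C"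
    and b: "\<And>e u v. \<lbrakk>e \<in> b; u \<in> e; v \<in> e; place Lft Mid u \<in> C\<rbrakk> \<Longrightarrow> place Lft Mid v \<in> C"
    and c: "\<And>e u v. \<lbrakk>e \<in> c; u \<in> e; v \<in> e; place Mid Rgt u \<in> C\<rbrakk> \<Longrightarrow> place Mid Rgt v \<in> C"
  shows "y \<in> C"
  using assms(1) unfolding joined_def
proof (induction rule: rtrancl_induct)
  case base
  show ?case by fact
next
  case (step y z)
  then have "{y, z} \<in> glued_arcs b c" by simp
  then consider e where "e \<in> b" "{y, z} = place Lft Mid ` e" | e where "e \<in> c" "{y, z} = place Mid Rgt ` e"
    by (auto simp: glued_arcs_def)
  then show ?case
  proof cases
    case 1
    have "y \<in> place Lft Mid ` e" "z \<in> place Lft Mid ` e"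
      unfolding 1(2) [symmetric] by simp_all
    then obtain u v where "u \<in> e" "y = place Lft Mid u" "v \<in> e" "z = place Lft Mid v" by blast
    then show ?thesis using b 1 step.IH by blast
  next
    case 2
    have "y \<in> place Mid Rgt ` e" "z \<in> place Mid Rgt ` e"
      unfolding 2(2) [symmetric] by simp_all
    then obtain u v where "u \<in> e" "y = place Mid Rgt u" "v \<in> e" "z = place Mid Rgt v" by blast
    then show ?thesis using c 2 step.IH by blast
  qed
qed

text \<open>Both ends lie in the column \<open>Rgt\<close>, so the arc survives gluing on the left
  unchanged. This is why the diagrams containing a set of right arcs span a left ideal.\<close>

lemma compose_right_arc:
  assumes "c \<in> diagrams n" "e \<in> c" "e \<subseteq> {0<..}"
  shows "e \<in> compose_diagrams n b c"
proof -
  obtain u v where uv: "u \<noteq> v" "e = {u, v}" using assms(1,2) by (rule diagram_arcE)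
  have "(place Mid Rgt u, place Mid Rgt v) \<in> joined b c"
    using assms uv by (intro joined_right) auto
  then have "(place Lft Rgt u, place Lft Rgt v) \<in> joined b c"
    using assms uv by (simp add: place_def)
  then show ?thesis
    using uv diagram_nodes [OF assms(1,2)] unfolding compose_diagrams_def by blast
qed

lemma compose_left_arc:
  assumes "b \<in> diagrams n" "e \<in> b" "e \<subseteq> {..<0}"
  shows "e \<in> compose_diagrams n b c"
proof -
  obtain u v where uv: "u \<noteq> v" "e = {u, v}" using assms(1,2) by (rule diagram_arcE)
  have "(place Lft Mid u, place Lft Mid v) \<in> joined b c"
    using assms uv by (intro joined_left) auto
  then have "(place Lft Rgt u, place Lft Rgt v) \<in> joined b c"
    using assms uv by (simp add: place_def)
  then show ?thesis
    using uv diagram_nodes [OF assms(1,2)] unfolding compose_diagrams_def by blast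
qed

subsection \<open>Diagrams of caps and cups\<close>

definition right_arcs :: "nat \<Rightarrow> int set set" where
  "right_arcs n = {e. e \<subseteq> {1..int n} \<and> card e = 2}"

text \<open>The set is a diagram when the arcs of \<open>T\<close> are disjoint right arcs, as they
  are if some diagram contains \<open>T\<close>. In the context below the diagram \<open>b\<close>
  both guarantees this and serves as the left factor of the product.\<close>

definition cap_diagram :: "nat \<Rightarrow> int set set \<Rightarrow> int set set" where
  "cap_diagram n T = T \<union> (`) uminus ` T \<union> (\<lambda>i. {- i, i}) ` ({1..int n} - \<Union>T)"

lemma cap_diagram_cases:
  assumes "e \<in> cap_diagram n T"
  obtains "e \<in> T" | t where "t \<in> T" "e = uminus ` t" | i where "i \<in> {1..int n} - \<Union>T" "e = {- i, i}"
  using assms by (auto simp: cap_diagram_def)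

lemma finite_right_arcs: "finite (right_arcs n)"
  by (rule finite_subset [of _ "Pow {1..int n}"]) (auto simp: right_arcs_def)

context
  fixes b :: "int set set" and n :: nat and T :: "int set set"
  assumes b: "b \<in> diagrams n" and T: "T \<subseteq> b" and T_right: "T \<subseteq> right_arcs n"
begin

lemma cap_arc_pos: "\<lbrakk>t \<in> T; i \<in> t\<rbrakk> \<Longrightarrow> 0 < i \<and> i \<le> int n"
  using T_right by (force simp: right_arcs_def)

lemma cap_arc_unique: "\<lbrakk>t \<in> T; e \<in> b; i \<in> t; i \<in> e\<rbrakk> \<Longrightarrow> e = t"
  using diagram_unique [OF b] T by blast

lemma cap_diagram_in_diagrams: "cap_diagram n T \<in> diagrams n"
proof -
  have card: "card e = 2" if "e \<in> cap_diagram n T" for e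
    using that
  proof (cases rule: cap_diagram_cases)
    case 1
    then show ?thesis using T_right by (auto simp: right_arcs_def)
  next
    case (2 t)
    then show ?thesis using T_right by (auto simp: right_arcs_def card_image)
  next
    case (3 i)
    then show ?thesis by auto
  qed
  have "partition_on (nodes n) (cap_diagram n T)"
  proof (rule partition_onI)
    show "\<Union>(cap_diagram n T) = nodes n"
    proof (intro equalityI subsetI)
      fix u assume "u \<in> \<Union>(cap_diagram n T)"
      then show "u \<in> nodes n"
        using cap_arc_pos by (fastforce simp: cap_diagram_def nodes_def)
    next
      fix u assume u: "u \<in> nodes n"
      show "u \<in> \<Union>(cap_diagram n T)"
      proof (cases "\<bar>u\<bar> \<in> \<Union>T")
        case True
        then obtain t where "t \<in> T" "\<bar>u\<bar> \<in> t" by blast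
        then have "u \<in> t \<or> u \<in> uminus ` t" by (cases "u < 0") force+
        then show ?thesis using \<open>t \<in> T\<close> by (auto simp: cap_diagram_def)
      next
        case False
        then have "\<bar>u\<bar> \<in> {1..int n} - \<Union>T" using u by (auto simp: nodes_def)
        then have "{- \<bar>u\<bar>, \<bar>u\<bar>} \<in> cap_diagram n T" unfolding cap_diagram_def by blast
        moreover have "u \<in> {- \<bar>u\<bar>, \<bar>u\<bar>}" by (cases "u < 0") auto
        ultimately show ?thesis by blast
      qed
    qed
    show "{} \<notin> cap_diagram n T"
      using card by fastforce
    \<comment> \<open>The kind of the arc through \<open>u\<close> is determined by the sign of
      \<open>u\<close> and by whether \<open>\<bar>u\<bar>\<close> lies on an arc of
      \<open>T\<close>; disjointness follows from this.\<close>
    have mem: "p \<in> T \<and> u > 0 \<or> (\<exists>t\<in>T. p = uminus ` t \<and> u < 0 \<and> - u \<in> t) \<or>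
        \<bar>u\<bar> \<notin> \<Union>T \<and> p = {- \<bar>u\<bar>, \<bar>u\<bar>}" if "p \<in> cap_diagram n T" "u \<in> p" for p u
      using that(1)
    proof (cases rule: cap_diagram_cases)
      case 1
      then show ?thesis using cap_arc_pos that(2) by blast
    next
      case (2 t)
      then have "- u \<in> t" using that(2) by auto
      then show ?thesis using cap_arc_pos [OF 2(1)] 2 by fastforce
    next
      case (3 i)
      then have "\<bar>u\<bar> = i" using that(2) by auto
      then show ?thesis using 3 by auto
    qed
    have meet: "p = q" if p: "p \<in> cap_diagram n T" and q: "q \<in> cap_diagram n T" and u: "u \<in> p" "u \<in> q" for p q u
    proof (cases "\<bar>u\<bar> \<in> \<Union>T")
      case False
      have "r = {- \<bar>u\<bar>, \<bar>u\<bar>}" if r: "r \<in> cap_diagram n T" "u \<in> r" for r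
        using mem [OF r]
      proof (elim disjE bexE conjE)
        assume "r \<in> T" "u > 0"
        then have "\<bar>u\<bar> \<in> \<Union>T" using r(2) by auto
        with False show ?thesis ..
      next
        fix t assume "t \<in> T" "u < 0" "- u \<in> t"
        then have "\<bar>u\<bar> \<in> \<Union>T" by auto
        with False show ?thesis ..
      qed
      from this [OF p u(1)] this [OF q u(2)] show ?thesis by metis
    next
      case True
      then obtain t where t: "t \<in> T" "\<bar>u\<bar> \<in> t" by blast
      have "r = (if u > 0 then t else uminus ` t)" if r: "r \<in> cap_diagram n T" "u \<in> r" for r
        using mem [OF r]
      proof (elim disjE bexE conjE)
        assume *: "r \<in> T" "u > 0"
        then have "u \<in> t" using t by simp
        then have "r = t" using cap_arc_unique [OF t(1) _ _ r(2)] * T by blast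
        with * show ?thesis by simp
      next
        fix s assume *: "s \<in> T" "r = uminus ` s" "u < 0" "- u \<in> s"
        then have "- u \<in> t" using t by simp
        then have "s = t" using cap_arc_unique [OF t(1) _ _ *(4)] * T by blast
        with * show ?thesis by simp
      next
        assume "\<bar>u\<bar> \<notin> \<Union>T"
        with True show ?thesis by blast
      qed
      from this [OF p u(1)] this [OF q u(2)] show ?thesis by simp
    qed
    show "disjnt p q" if "p \<in> cap_diagram n T" "q \<in> cap_diagram n T" "p \<noteq> q" for p q
      using meet that by (auto simp: disjnt_def)
  qed
  then show ?thesis using card by (simp add: diagrams_def)
qed

text \<open>Away from \<open>T\<close> the cap diagram consists of straight lines, which carry the
  right ends of arcs of \<open>b\<close> from the middle to the right column.\<close>

lemma cap_outer_joined:
  assumes "e \<in> b" "e \<notin> T" "u \<in> e"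
  shows "(place Lft Mid u, place Lft Rgt u) \<in> joined b (cap_diagram n T)"
proof (cases "u < 0")
  case True
  then show ?thesis by (simp add: place_def joined_refl)
next
  case False
  then have "u \<in> {1..int n}"
    using diagram_nodes [OF b assms(1,3)] by (auto simp: nodes_def)
  moreover have "u \<notin> \<Union>T"
    using cap_arc_unique assms by blast
  ultimately have "{- u, u} \<in> cap_diagram n T"
    by (auto simp: cap_diagram_def)
  then have "(place Mid Rgt (- u), place Mid Rgt u) \<in> joined b (cap_diagram n T)"
    by (rule joined_right)
  then show ?thesis
    using \<open>u \<in> {1..int n}\<close> by (simp add: place_def)
qed

text \<open>The arcs of \<open>T\<close> in \<open>b\<close> are closed off by their mirror images
  and disappear into loops, but the right half of the cap diagram puts them back. All other arcs of
  \<open>b\<close> are prolonged by straight lines.\<close>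

lemma compose_cap_diagram: "compose_diagrams n b (cap_diagram n T) = b"
proof (intro equalityI subsetI)
  fix e assume e: "e \<in> b"
  obtain u v where uv: "u \<noteq> v" "e = {u, v}" using b e by (rule diagram_arcE)
  show "e \<in> compose_diagrams n b (cap_diagram n T)"
  proof (cases "e \<in> T")
    case True
    then show ?thesis
      using cap_arc_pos by (intro compose_right_arc [OF cap_diagram_in_diagrams]) (auto simp: cap_diagram_def)
  next
    case False
    have "(place Lft Mid u, place Lft Mid v) \<in> joined b (cap_diagram n T)"
      using e uv by (intro joined_left) simp
    moreover have "(place Lft Mid u, place Lft Rgt u) \<in> joined b (cap_diagram n T)"
      "(place Lft Mid v, place Lft Rgt v) \<in> joined b (cap_diagram n T)"
      using cap_outer_joined [OF e False] uv by auto
    ultimately have "(place Lft Rgt u, place Lft Rgt v) \<in> joined b (cap_diagram n T)"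
      using joined_sym joined_trans by metis
    then show ?thesis
      using uv diagram_nodes [OF b e] unfolding compose_diagrams_def by blast
  qed
next
  fix f assume "f \<in> compose_diagrams n b (cap_diagram n T)"
  then obtain u v where f: "f = {u, v}" and uv: "u \<in> nodes n" "v \<in> nodes n" "u \<noteq> v"
    and j: "(place Lft Rgt u, place Lft Rgt v) \<in> joined b (cap_diagram n T)"
    by (auto simp: compose_diagrams_def)
  obtain e where e: "e \<in> b" "u \<in> e" using diagram_cover [OF b uv(1)] by blast
  have "v \<in> e"
  proof (cases "e \<in> T")
    case True
    \<comment> \<open>No arc of \<open>b\<close> reaches the column \<open>Rgt\<close>, and the only
      arc of the cap diagram that meets the right copies of the ends of \<open>e\<close> is
      \<open>e\<close> itself.\<close>
    have "place Lft Rgt v \<in> {Rgt} \<times> e"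
    proof (rule joined_closed [OF j])
      show "place Lft Rgt u \<in> {Rgt} \<times> e"
        using cap_arc_pos [OF True e(2)] e by (simp add: place_def)
    next
      fix a w z assume a: "a \<in> cap_diagram n T" "w \<in> a" "z \<in> a" "place Mid Rgt w \<in> {Rgt} \<times> e"
      then have w: "0 \<le> w" "w \<in> e" by (auto simp: place_def split: if_splits)
      with a(1) have "a = e"
      proof (cases rule: cap_diagram_cases)
        case 1
        then show ?thesis using cap_arc_unique [OF 1 e(1)] a w by blast
      next
        case (2 t)
        then show ?thesis using cap_arc_pos a w by fastforce
      next
        case (3 i)
        then show ?thesis using True a w by auto
      qed
      then show "place Mid Rgt z \<in> {Rgt} \<times> e"
        using a cap_arc_pos [OF True, of z] by (simp add: place_def)
    qed (auto simp: place_def split: if_splits)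
    then show ?thesis by (auto simp: place_def split: if_splits)
  next
    case False
    \<comment> \<open>The component of an arc \<open>e\<close> outside \<open>T\<close>: its left
      nodes in \<open>Lft\<close>, its right nodes in \<open>Mid\<close> and, along straight lines,
      in \<open>Rgt\<close>. Pairs in \<open>C\<close> with a negative number are harmless, since
      \<open>place\<close> yields absolute values.\<close>
    define C where "C = {(p, i). (p = Lft \<and> - i \<in> e) \<or> (p \<noteq> Lft \<and> i \<in> e)}"
    have "place Lft Rgt v \<in> C"
    proof (rule joined_closed [OF j])
      show "place Lft Rgt u \<in> C" using e by (simp add: place_def C_def)
    next
      fix a w z assume "a \<in> b" "w \<in> a" "z \<in> a" "place Lft Mid w \<in> C"
      then show "place Lft Mid z \<in> C"
        using diagram_unique [OF b, of a e w] e by (auto simp: place_def C_def split: if_splits)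
    next
      fix a w z assume a: "a \<in> cap_diagram n T" "w \<in> a" "z \<in> a" "place Mid Rgt w \<in> C"
      from a(1) show "place Mid Rgt z \<in> C"
      proof (cases rule: cap_diagram_cases)
        case 1
        then have "w \<in> e" using a cap_arc_pos [OF 1 a(2)] by (auto simp: place_def C_def)
        then show ?thesis using cap_arc_unique [OF 1 e(1) a(2)] False 1 by blast
      next
        case (2 t)
        then have "- w \<in> t" "- w \<in> e" using a cap_arc_pos by (auto simp: place_def C_def split: if_splits)
        then show ?thesis using cap_arc_unique [OF 2(1) e(1)] False 2 by blast
      next
        case (3 i)
        then show ?thesis using a by (auto simp: place_def C_def)
      qed
    qed
    then show ?thesis by (auto simp: place_def C_def split: if_splits)
  qed
  then show "f \<in> b"
    using diagram_arc_eq [OF b e(1) e(2) _ uv(3)] f e by simp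
qed

text \<open>In the middle column each \<open>t \<in> T\<close> meets its mirror image and forms a
  loop with exactly the nodes of \<open>t\<close>. Every other middle node is tied to the right
  column by a straight line.\<close>

lemma loops_cap_diagram: "loops n b (cap_diagram n T) = card T"
proof -
  let ?J = "joined b (cap_diagram n T)"
  have comp: "?J `` {(Mid, i)} = {Mid} \<times> t" if t: "t \<in> T" "i \<in> t" for t i
  proof (intro equalityI subsetI)
    fix y assume "y \<in> ?J `` {(Mid, i)}"
    then have j: "((Mid, i), y) \<in> ?J" by simp
    show "y \<in> {Mid} \<times> t"
    proof (rule joined_closed [OF j])
      show "(Mid, i) \<in> {Mid} \<times> t" using t by simp
    next
      fix a w z assume a: "a \<in> b" "w \<in> a" "z \<in> a" "place Lft Mid w \<in> {Mid} \<times> t"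
      then have "a = t" using cap_arc_unique [OF t(1)] by (auto simp: place_def split: if_splits)
      then show "place Lft Mid z \<in> {Mid} \<times> t"
        using a cap_arc_pos [OF t(1), of z] by (simp add: place_def)
    next
      fix a w z assume a: "a \<in> cap_diagram n T" "w \<in> a" "z \<in> a" "place Mid Rgt w \<in> {Mid} \<times> t"
      then have w: "w < 0" "- w \<in> t" by (auto simp: place_def split: if_splits)
      from a(1) show "place Mid Rgt z \<in> {Mid} \<times> t"
      proof (cases rule: cap_diagram_cases)
        case 1
        then show ?thesis using cap_arc_pos [OF 1 a(2)] w by simp
      next
        case (2 s)
        then have "s = t" using cap_arc_unique [OF t(1), of s "- w"] w a T by auto
        then show ?thesis using 2 a cap_arc_pos [OF t(1), of "- z"] by (auto simp: place_def)
      next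
        case (3 k)
        then show ?thesis using w a t by auto
      qed
    qed
  next
    fix y assume y: "y \<in> {Mid} \<times> t"
    then obtain k where k: "y = (Mid, k)" "k \<in> t" by auto
    show "y \<in> ?J `` {(Mid, i)}"
    proof (cases "k = i")
      case True
      then show ?thesis using k joined_refl by simp
    next
      case False
      then have "t = {i, k}" using diagram_arc_eq [OF b _ t(2) k(2)] t T by auto
      then have "(place Lft Mid i, place Lft Mid k) \<in> ?J"
        using t T by (intro joined_left) auto
      then show ?thesis
        using cap_arc_pos [OF t] cap_arc_pos [OF t(1) k(2)] k by (simp add: place_def)
    qed
  qed
  have out: "\<not> ?J `` {(Mid, i)} \<subseteq> {Mid} \<times> UNIV" if i: "i \<in> {1..int n}" "i \<notin> \<Union>T" for i
  proof -
    have "(place Mid Rgt (- i), place Mid Rgt i) \<in> ?J"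
      using i by (intro joined_right) (auto simp: cap_diagram_def)
    then have "(Rgt, i) \<in> ?J `` {(Mid, i)}"
      using i by (simp add: place_def)
    then show ?thesis by blast
  qed
  have "{?J `` {(Mid, i)} | i. i \<in> {1..int n} \<and> ?J `` {(Mid, i)} \<subseteq> {Mid} \<times> UNIV} = (\<lambda>t. {Mid} \<times> t) ` T"
  proof (intro equalityI subsetI)
    fix A assume "A \<in> {?J `` {(Mid, i)} | i. i \<in> {1..int n} \<and> ?J `` {(Mid, i)} \<subseteq> {Mid} \<times> UNIV}"
    then obtain i where i: "A = ?J `` {(Mid, i)}" "i \<in> {1..int n}" "A \<subseteq> {Mid} \<times> UNIV" by blast
    then obtain t where "t \<in> T" "i \<in> t" using out by blast
    then show "A \<in> (\<lambda>t. {Mid} \<times> t) ` T" using comp i by blast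
  next
    fix A assume "A \<in> (\<lambda>t. {Mid} \<times> t) ` T"
    then obtain t where t: "t \<in> T" "A = {Mid} \<times> t" by blast
    then obtain i where i: "i \<in> t" using T b by (auto elim: diagram_arcE [OF b])
    then have "i \<in> {1..int n}" using cap_arc_pos [OF t(1) i] by simp
    then show "A \<in> {?J `` {(Mid, i)} | i. i \<in> {1..int n} \<and> ?J `` {(Mid, i)} \<subseteq> {Mid} \<times> UNIV}"
      using comp [OF t(1) i] t(2) by (intro CollectI exI [of _ i]) auto
  qed
  moreover have "inj_on (\<lambda>t. {Mid} \<times> t) T" by (auto simp: inj_on_def)
  ultimately show ?thesis unfolding loops_def by (simp add: card_image)
qed

end

subsection \<open>Permutation diagrams\<close>

abbreviation "Sym n \<equiv> carrier (sym_group n)"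

text \<open>The effect of gluing the permutation diagram of \<open>g\<close> on the left: the left
  node \<open>- i\<close> is glued to the right end of an arc whose left end is
  \<open>- g i\<close>, while right nodes stay in place.\<close>

definition relabel :: "(nat \<Rightarrow> nat) \<Rightarrow> int \<Rightarrow> int" where
  "relabel g u = (if u < 0 then - int (g (nat (- u))) else u)"

lemma Sym_range: "\<lbrakk>g \<in> Sym n; i \<in> {1..n}\<rbrakk> \<Longrightarrow> g i \<in> {1..n}"
  using permutes_in_image by (fastforce simp: sym_group_carrier)

lemma relabel_neg:
  assumes "g \<in> Sym n" "u \<in> nodes n" "u < 0"
  shows "relabel g u \<in> nodes n \<and> relabel g u < 0"
proof -
  have "nat (- u) \<in> {1..n}" using assms by (auto simp: nodes_def)
  then have "g (nat (- u)) \<in> {1..n}" by (rule Sym_range [OF assms(1)])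
  then show ?thesis using assms(3) by (simp add: relabel_def nodes_def)
qed

lemma relabel_nodes: "\<lbrakk>g \<in> Sym n; u \<in> nodes n\<rbrakk> \<Longrightarrow> relabel g u \<in> nodes n"
  using relabel_neg [of g n u] by (cases "u < 0") (auto simp: relabel_def)

lemma relabel_sign: "\<lbrakk>g \<in> Sym n; u \<in> nodes n\<rbrakk> \<Longrightarrow> relabel g u < 0 \<longleftrightarrow> u < 0"
  using relabel_neg [of g n u] by (cases "u < 0") (auto simp: relabel_def)

lemma relabel_inj:
  assumes g: "g \<in> Sym n" and u: "u \<in> nodes n" and v: "v \<in> nodes n" and eq: "relabel g u = relabel g v"
  shows "u = v"
proof (cases "u < 0")
  case True
  then have "v < 0" using relabel_sign [OF g u] relabel_sign [OF g v] eq by simp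
  then have "g (nat (- u)) = g (nat (- v))" using True eq by (simp add: relabel_def)
  then have "nat (- u) = nat (- v)"
    using g permutes_inj [of g "{1..n}"] by (auto simp: sym_group_carrier dest: injD)
  then show ?thesis using True \<open>v < 0\<close> by simp
next
  case False
  then have "\<not> v < 0" using relabel_sign [OF g u] relabel_sign [OF g v] eq by simp
  then show ?thesis using False eq by (simp add: relabel_def)
qed

lemma relabel_surj:
  assumes g: "g \<in> Sym n" and v: "v \<in> nodes n"
  obtains u where "u \<in> nodes n" "v = relabel g u"
proof -
  have "relabel g ` nodes n = nodes n"
  proof (rule endo_inj_surj)
    show "finite (nodes n)" by (simp add: nodes_def)
  qed (use g relabel_nodes relabel_inj in \<open>auto simp: inj_on_def\<close>)
  then show ?thesis using v that by blast
qed

lemma perm_diagram_arc: "i \<in> {1..n} \<Longrightarrow> {- int (g i), int i} \<in> perm_diagram n g"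
  by (auto simp: perm_diagram_def)

lemma perm_diagram_joined:
  assumes "g \<in> Sym n" "u \<in> nodes n"
  shows "(place Lft Rgt (relabel g u), place Mid Rgt u) \<in> joined (perm_diagram n g) c"
proof (cases "u < 0")
  case True
  define i where "i = nat (- u)"
  have i: "i \<in> {1..n}" "u = - int i" using True assms by (auto simp: i_def nodes_def)
  have "(place Lft Mid (- int (g i)), place Lft Mid (int i)) \<in> joined (perm_diagram n g) c"
    by (rule joined_left [OF perm_diagram_arc [OF i(1)]])
  then show ?thesis
    using i Sym_range [OF assms(1) i(1)] by (simp add: place_def relabel_def)
next
  case False
  then show ?thesis by (simp add: place_def relabel_def joined_refl)
qed

lemma compose_perm_diagram:
  assumes g: "g \<in> Sym n" and c: "c \<in> diagrams n"
  shows "compose_diagrams n (perm_diagram n g) c = (`) (relabel g) ` c"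
proof (intro equalityI subsetI)
  fix f assume "f \<in> (`) (relabel g) ` c"
  then obtain e where e: "e \<in> c" "f = relabel g ` e" by blast
  obtain u v where uv: "u \<noteq> v" "e = {u, v}" using c e(1) by (rule diagram_arcE)
  then have n: "u \<in> nodes n" "v \<in> nodes n" using diagram_nodes [OF c e(1)] by auto
  have "(place Mid Rgt u, place Mid Rgt v) \<in> joined (perm_diagram n g) c"
    using e uv by (intro joined_right) simp
  then have "(place Lft Rgt (relabel g u), place Lft Rgt (relabel g v)) \<in> joined (perm_diagram n g) c"
    using perm_diagram_joined [OF g n(1), of c] perm_diagram_joined [OF g n(2), of c]
      joined_sym joined_trans by metis
  moreover have "relabel g u \<noteq> relabel g v" using relabel_inj [OF g n] uv by blast
  moreover have "f = {relabel g u, relabel g v}" using e uv by simp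
  ultimately show "f \<in> compose_diagrams n (perm_diagram n g) c"
    using relabel_nodes [OF g] n unfolding compose_diagrams_def by blast
next
  fix f assume "f \<in> compose_diagrams n (perm_diagram n g) c"
  then obtain u' v' where f: "f = {u', v'}" and n': "u' \<in> nodes n" "v' \<in> nodes n" "u' \<noteq> v'"
    and j: "(place Lft Rgt u', place Lft Rgt v') \<in> joined (perm_diagram n g) c"
    by (auto simp: compose_diagrams_def)
  obtain u where u: "u \<in> nodes n" "u' = relabel g u" using g n'(1) by (rule relabel_surj)
  obtain v where v: "v \<in> nodes n" "v' = relabel g v" using g n'(2) by (rule relabel_surj)
  obtain e where e: "e \<in> c" "u \<in> e" using diagram_cover [OF c u(1)] by blast
  \<comment> \<open>The component of the arc \<open>e\<close> of \<open>c\<close>: its left nodes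
    appear in \<open>Mid\<close> and, transported by \<open>g\<close>, in \<open>Lft\<close>; its
    right nodes appear in \<open>Rgt\<close>.\<close>
  define C where "C = {(Lft, int (g i)) | i. i \<in> {1..n} \<and> - int i \<in> e} \<union>
    {(Mid, int i) | i. i \<in> {1..n} \<and> - int i \<in> e} \<union> {(Rgt, i) | i. i \<in> e}"
  have C_outer: "place Lft Rgt (relabel g w) \<in> C \<longleftrightarrow> w \<in> e" if w: "w \<in> nodes n" for w
  proof (cases "w < 0")
    case True
    define i where "i = nat (- w)"
    have i: "i \<in> {1..n}" "w = - int i" using True w by (auto simp: i_def nodes_def)
    have "j = i" if "g j = g i" for j
      using that g permutes_inj [of g "{1..n}"] by (auto simp: sym_group_carrier dest: injD)
    then have "(Lft, int (g i)) \<in> C \<longleftrightarrow> - int i \<in> e"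
      using i by (auto simp: C_def)
    then show ?thesis
      using i Sym_range [OF g i(1)] by (simp add: place_def relabel_def)
  next
    case False
    then show ?thesis by (simp add: place_def relabel_def C_def)
  qed
  have C_inner: "place Mid Rgt w \<in> C \<longleftrightarrow> w \<in> e" if w: "w \<in> nodes n" for w
  proof (cases "w < 0")
    case True
    define i where "i = nat (- w)"
    have i: "i \<in> {1..n}" "w = - int i" using True w by (auto simp: i_def nodes_def)
    then show ?thesis by (simp add: place_def C_def)
  next
    case False
    then show ?thesis by (simp add: place_def C_def)
  qed
  have "place Lft Rgt v' \<in> C"
  proof (rule joined_closed [OF j])
    show "place Lft Rgt u' \<in> C" using C_outer [OF u(1)] u e by simp
  next
    fix a w z assume a: "a \<in> c" "w \<in> a" "z \<in> a" "place Mid Rgt w \<in> C"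
    then have "w \<in> e" using C_inner diagram_nodes [OF c] by blast
    then have "z \<in> e" using diagram_unique [OF c a(1) e(1) a(2)] a by simp
    then show "place Mid Rgt z \<in> C" using C_inner diagram_nodes [OF c] a by blast
  next
    fix a w z assume a: "a \<in> perm_diagram n g" "w \<in> a" "z \<in> a" "place Lft Mid w \<in> C"
    then obtain i where i: "i \<in> {1..n}" "a = {- int (g i), int i}" by (auto simp: perm_diagram_def)
    have n: "- int i \<in> nodes n" using i by (auto simp: nodes_def)
    have "place Lft Mid (- int (g i)) = place Lft Rgt (relabel g (- int i))"
      "place Lft Mid (int i) = place Mid Rgt (- int i)"
      using i Sym_range [OF g i(1)] by (auto simp: place_def relabel_def)
    then show "place Lft Mid z \<in> C"
      using a i C_outer [OF n] C_inner [OF n] by auto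
  qed
  then have "v \<in> e" using C_outer v by simp
  then have "e = {u, v}" using diagram_arc_eq [OF c e] u v n'(3) by auto
  then have "f = relabel g ` e" using f u v by simp
  then show "f \<in> (`) (relabel g) ` c" using e by blast
qed

text \<open>Each middle node is joined to a node of the left column, so no component stays in the
  middle.\<close>

lemma loops_perm_diagram:
  assumes "g \<in> Sym n"
  shows "loops n (perm_diagram n g) c = 0"
proof -
  have "\<not> joined (perm_diagram n g) c `` {(Mid, i)} \<subseteq> {Mid} \<times> UNIV" if i: "i \<in> {1..int n}" for i
  proof -
    have n: "- i \<in> nodes n" using i by (auto simp: nodes_def)
    have "(place Mid Rgt (- i), place Lft Rgt (relabel g (- i))) \<in> joined (perm_diagram n g) c"
      by (rule joined_sym [OF perm_diagram_joined [OF assms n]])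
    moreover have "relabel g (- i) < 0" using relabel_sign [OF assms n] i by simp
    ultimately have "(Lft, - relabel g (- i)) \<in> joined (perm_diagram n g) c `` {(Mid, i)}"
      using i by (simp add: place_def)
    then show ?thesis by blast
  qed
  then have "{joined (perm_diagram n g) c `` {(Mid, i)} | i. i \<in> {1..int n} \<and>
      joined (perm_diagram n g) c `` {(Mid, i)} \<subseteq> {Mid} \<times> UNIV} = {}" by blast
  then show ?thesis unfolding loops_def by (simp only: card.empty)
qed

lemma perm_diagram_in_diagrams:
  assumes g: "g \<in> Sym n"
  shows "perm_diagram n g \<in> diagrams n"
proof -
  have inj: "i = j" if "g i = g j" for i j
    using that g permutes_inj [of g "{1..n}"] by (auto simp: sym_group_carrier dest: injD)
  have pos: "0 < g i" if "i \<in> {1..n}" for i using Sym_range [OF g that] by simp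
  have "partition_on (nodes n) (perm_diagram n g)"
  proof (rule partition_onI)
    show "\<Union>(perm_diagram n g) = nodes n"
    proof (intro equalityI subsetI)
      fix u assume "u \<in> \<Union>(perm_diagram n g)"
      then show "u \<in> nodes n" using Sym_range [OF g] by (fastforce simp: perm_diagram_def nodes_def)
    next
      fix u assume u: "u \<in> nodes n"
      obtain v where v: "v \<in> nodes n" "u = relabel g v" using g u by (rule relabel_surj)
      show "u \<in> \<Union>(perm_diagram n g)"
      proof (cases "v < 0")
        case True
        then have "nat (- v) \<in> {1..n}" "u = - int (g (nat (- v)))"
          using v by (auto simp: nodes_def relabel_def)
        then show ?thesis using perm_diagram_arc by blast
      next
        case False
        then have "nat v \<in> {1..n}" "u = int (nat v)"
          using v by (auto simp: nodes_def relabel_def)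
        then show ?thesis using perm_diagram_arc by blast
      qed
    qed
    show "disjnt p q" if pq: "p \<in> perm_diagram n g" "q \<in> perm_diagram n g" "p \<noteq> q" for p q
    proof -
      obtain i j where ij: "i \<in> {1..n}" "p = {- int (g i), int i}" "j \<in> {1..n}" "q = {- int (g j), int j}"
        using pq unfolding perm_diagram_def by blast
      then have "i \<noteq> j" "g i \<noteq> g j" using pq(3) inj by auto
      then show ?thesis using ij pos [OF ij(1)] pos [OF ij(3)] by (auto simp: disjnt_def)
    qed
  qed (auto simp: perm_diagram_def)
  moreover have "card e = 2" if e: "e \<in> perm_diagram n g" for e
  proof -
    obtain i where "i \<in> {1..n}" "e = {- int (g i), int i}" using e by (auto simp: perm_diagram_def)
    moreover from this have "- int (g i) \<noteq> int i" using pos [of i] by linarith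
    ultimately show ?thesis by simp
  qed
  ultimately show ?thesis by (simp add: diagrams_def)
qed

lemma perm_diagram_inj:
  assumes g: "g \<in> Sym n" and h: "h \<in> Sym n" and eq: "perm_diagram n g = perm_diagram n h"
  shows "g = h"
proof
  fix i
  show "g i = h i"
  proof (cases "i \<in> {1..n}")
    case True
    then have "{- int (g i), int i} \<in> perm_diagram n h" using perm_diagram_arc eq by blast
    then obtain j where j: "j \<in> {1..n}" "{- int (g i), int i} = {- int (h j), int j}"
      by (auto simp: perm_diagram_def)
    have "0 < g i" "0 < h j" using Sym_range [OF g True] Sym_range [OF h j(1)] by auto
    then show ?thesis using j(2) by (auto simp: doubleton_eq_iff)
  next
    case False
    then show ?thesis using g h by (simp add: sym_group_carrier permutes_def)
  qed
qed

lemma perm_diagram_no_right_arc: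
  assumes "g \<in> Sym n" "e \<in> perm_diagram n g" shows "\<not> e \<subseteq> {0<..}" "\<not> e \<subseteq> {..<0}"
  using assms by (auto simp: perm_diagram_def)

lemma compose_perm_perm:
  assumes g: "g \<in> Sym n" and h: "h \<in> Sym n"
  shows "compose_diagrams n (perm_diagram n g) (perm_diagram n h) = perm_diagram n (g \<circ> h)"
  unfolding compose_perm_diagram [OF g perm_diagram_in_diagrams [OF h]]
  unfolding perm_diagram_def image_image
proof (rule image_cong [OF refl])
  fix i assume "i \<in> {1..n}"
  then have "0 < h i" using Sym_range [OF h] by fastforce
  then show "relabel g ` {- int (h i), int i} = {- int ((g \<circ> h) i), int i}"
    by (simp add: relabel_def insert_commute)
qed

lemma id_Sym: "id \<in> Sym n"
  by (simp add: sym_group_carrier permutes_id)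

lemma compose_id_left:
  assumes c: "c \<in> diagrams n"
  shows "compose_diagrams n (perm_diagram n id) c = c"
proof -
  have "relabel id u = u" for u by (simp add: relabel_def)
  then have "relabel id = (\<lambda>u. u)" by auto
  then show ?thesis using compose_perm_diagram [OF id_Sym c] by simp
qed

text \<open>This makes the right unit law the case \<open>T = {}\<close> of the product formulas for
  cap diagrams.\<close>

lemma perm_diagram_id: "perm_diagram n id = cap_diagram n {}"
proof -
  have "(\<lambda>i. {- int i, int i}) ` {1..n} = (\<lambda>i. {- i, i}) ` int ` {1..n}"
    by (simp add: image_image)
  then show ?thesis by (simp add: perm_diagram_def cap_diagram_def image_int_atLeastAtMost)
qed

lemma compose_id_right: "b \<in> diagrams n \<Longrightarrow> compose_diagrams n b (perm_diagram n id) = b"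
  and loops_id_right: "b \<in> diagrams n \<Longrightarrow> loops n b (perm_diagram n id) = 0"
  using compose_cap_diagram [of b n "{}"] loops_cap_diagram [of b n "{}"] by (simp_all add: perm_diagram_id)

text \<open>
  Without right arcs each right node is joined to a left node, and counting shows that the
  diagram is a permutation.
\<close>

lemma perm_diagram_if_no_right_arc:
  assumes b: "b \<in> diagrams n" and no: "\<And>e. e \<in> b \<Longrightarrow> e \<notin> right_arcs n"
  shows "b \<in> perm_diagrams n"
proof -
  have "\<exists>j\<in>{1..n}. {- int j, int i} \<in> b" if i: "i \<in> {1..n}" for i
  proof -
    have "int i \<in> nodes n" using i by (auto simp: nodes_def)
    then obtain e where e: "e \<in> b" "int i \<in> e" using diagram_cover [OF b] by blast
    obtain v where v: "int i \<noteq> v" "e = {int i, v}" using b e by (rule diagram_partner)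
    have "v \<in> nodes n" using diagram_nodes [OF b e(1)] v by simp
    moreover have "\<not> 0 < v"
    proof
      assume "0 < v"
      then have "e \<in> right_arcs n" using v i \<open>v \<in> nodes n\<close> by (auto simp: right_arcs_def nodes_def)
      with no e show False by blast
    qed
    ultimately have "nat (- v) \<in> {1..n}" "v = - int (nat (- v))" by (auto simp: nodes_def)
    then show ?thesis using v e by (metis insert_commute)
  qed
  then obtain p where p: "\<And>i. i \<in> {1..n} \<Longrightarrow> p i \<in> {1..n} \<and> {- int (p i), int i} \<in> b" by metis
  \<comment> \<open>Extended by the identity, as \<open>permutes\<close> requires outside
    \<open>{1..n}\<close>.\<close>
  define g where "g i = (if i \<in> {1..n} then p i else i)" for i
  have g: "g i \<in> {1..n}" "{- int (g i), int i} \<in> b" if "i \<in> {1..n}" for i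
    using p [OF that] that by (simp_all add: g_def)
  have inj: "inj_on g {1..n}"
  proof (rule inj_onI)
    fix i j assume ij: "i \<in> {1..n}" "j \<in> {1..n}" "g i = g j"
    then have "{- int (g i), int i} = {- int (g i), int j}"
      using diagram_unique [OF b g(2) [OF ij(1)] g(2) [OF ij(2)], of "- int (g i)"] by simp
    then show "i = j" by (auto simp: doubleton_eq_iff)
  qed
  then have surj: "g ` {1..n} = {1..n}"
    by (intro endo_inj_surj) (use g in auto)
  have "bij_betw g {1..n} {1..n}" using inj surj by (simp add: bij_betw_def)
  then have "g permutes {1..n}" by (rule bij_imp_permutes) (simp only: g_def if_False)
  then have gS: "g \<in> Sym n" by (simp add: sym_group_carrier)
  have "b = perm_diagram n g"
  proof (intro equalityI subsetI)
    fix e assume "e \<in> perm_diagram n g"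
    then show "e \<in> b" using g by (auto simp: perm_diagram_def)
  next
    fix e assume e: "e \<in> b"
    obtain u v where uv: "u \<noteq> v" "e = {u, v}" using b e by (rule diagram_arcE)
    then have "u \<in> nodes n" using diagram_nodes [OF b e] by simp
    then have "\<exists>i\<in>{1..n}. u \<in> {- int (g i), int i}"
    proof (cases "u < 0")
      case True
      then have "nat (- u) \<in> g ` {1..n}" using surj \<open>u \<in> nodes n\<close> by (auto simp: nodes_def)
      then obtain i where "i \<in> {1..n}" "nat (- u) = g i" by blast
      then show ?thesis using True by (intro bexI [of _ i]) auto
    next
      case False
      then have "nat u \<in> {1..n}" "u = int (nat u)" using \<open>u \<in> nodes n\<close> by (auto simp: nodes_def)
      then show ?thesis by blast
    qed
    then obtain i where i: "i \<in> {1..n}" "u \<in> {- int (g i), int i}" by blast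
    then have "e = {- int (g i), int i}"
      using diagram_unique [OF b e g(2) [OF i(1)]] uv by blast
    then show "e \<in> perm_diagram n g" using i by (auto simp: perm_diagram_def)
  qed
  then show ?thesis using gS by (auto simp: perm_diagrams_def)
qed

text \<open>Counting: if no arc joins two left nodes, then the \<open>n\<close> left nodes are
  matched injectively with the \<open>n\<close> right nodes, and no right node is left over for a
  right arc.\<close>

lemma no_right_arc_if_no_left_arc:
  assumes b: "b \<in> diagrams n" and no: "\<And>e. e \<in> b \<Longrightarrow> \<not> e \<subseteq> {..<0}" and e: "e \<in> b"
  shows "e \<notin> right_arcs n"
proof
  assume er: "e \<in> right_arcs n"
  have "\<exists>j\<in>{1..n}. {- int i, int j} \<in> b" if i: "i \<in> {1..n}" for i
  proof -
    have "- int i \<in> nodes n" using i by (auto simp: nodes_def)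
    then obtain e where e: "e \<in> b" "- int i \<in> e" using diagram_cover [OF b] by blast
    obtain v where v: "- int i \<noteq> v" "e = {- int i, v}" using b e by (rule diagram_partner)
    have "v \<in> nodes n" using diagram_nodes [OF b e(1)] v by simp
    moreover have "\<not> v < 0" using no [OF e(1)] v i by auto
    ultimately have "nat v \<in> {1..n}" "v = int (nat v)" by (auto simp: nodes_def)
    then show ?thesis using v e by metis
  qed
  then obtain p where p: "\<And>i. i \<in> {1..n} \<Longrightarrow> p i \<in> {1..n}" "\<And>i. i \<in> {1..n} \<Longrightarrow> {- int i, int (p i)} \<in> b" by metis
  have "inj_on p {1..n}"
  proof (rule inj_onI)
    fix i j assume ij: "i \<in> {1..n}" "j \<in> {1..n}" "p i = p j"
    then have "{- int i, int (p i)} = {- int j, int (p i)}"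
      using diagram_unique [OF b p(2) [OF ij(1)] p(2) [OF ij(2)], of "int (p i)"] by simp
    then show "i = j" by (auto simp: doubleton_eq_iff)
  qed
  then have surj: "p ` {1..n} = {1..n}"
    by (intro endo_inj_surj) (use p in auto)
  obtain u v where uv: "u \<noteq> v" "e = {u, v}" using b e by (rule diagram_arcE)
  then have "nat u \<in> p ` {1..n}" "u > 0" using er surj by (auto simp: right_arcs_def)
  then obtain i where i: "i \<in> {1..n}" "nat u = p i" by blast
  then have "u \<in> {- int i, int (p i)}" "u \<in> e" using uv \<open>u > 0\<close> by auto
  then have "e = {- int i, int (p i)}"
    using diagram_unique [OF b e p(2) [OF i(1)]] by blast
  then show False using er i by (auto simp: right_arcs_def)
qed

lemma perm_diagrams_no_arc:
  assumes "d \<in> perm_diagrams n" "e \<in> d" shows "\<not> e \<subseteq> {0<..}" "\<not> e \<subseteq> {..<0}"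
  using assms perm_diagram_no_right_arc by (auto simp: perm_diagrams_def)

lemma perm_diagrams_subset: "perm_diagrams n \<subseteq> diagrams n"
  using perm_diagram_in_diagrams by (auto simp: perm_diagrams_def)

text \<open>Right arcs of \<open>c\<close> and left arcs of \<open>b\<close> survive in the product,
  and a diagram lacking either kind is a permutation. This makes the non-permutations span a
  two-sided ideal and \<open>\<pi>\<close> multiplicative.\<close>

lemma compose_perm_diagramsD:
  assumes b: "b \<in> diagrams n" and c: "c \<in> diagrams n" and bc: "compose_diagrams n b c \<in> perm_diagrams n"
  shows "b \<in> perm_diagrams n" "c \<in> perm_diagrams n"
proof -
  show "c \<in> perm_diagrams n"
  proof (rule perm_diagram_if_no_right_arc [OF c])
    fix e assume e: "e \<in> c"
    show "e \<notin> right_arcs n"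
    proof
      assume "e \<in> right_arcs n"
      then have "e \<subseteq> {0<..}" by (auto simp: right_arcs_def)
      then show False using perm_diagrams_no_arc [OF bc compose_right_arc [OF c e]] by blast
    qed
  qed
  show "b \<in> perm_diagrams n"
  proof (rule perm_diagram_if_no_right_arc [OF b no_right_arc_if_no_left_arc [OF b]])
    show "\<not> e \<subseteq> {..<0}" if e: "e \<in> b" for e
      using perm_diagrams_no_arc [OF bc compose_left_arc [OF b e]] by blast
  qed
qed

subsection \<open>The Brauer algebra and the group algebra\<close>

lemma left_unital_algebra_cring: "cring R \<Longrightarrow> left_unital_algebra R"
  by (intro left_unital_algebra.intro left_unital_algebra_axioms.intro)
     (auto intro: cring.axioms ring.is_abelian_group simp: cring_def ring_def monoid.l_one semiring.l_null ring.ring_simprules)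

lemma fin_supp_abelian_group:
  assumes "cring R" "carrier A = fin_supp R X" "\<zero>\<^bsub>A\<^esub> = (\<lambda>_. \<zero>\<^bsub>R\<^esub>)" "add A = (\<lambda>x y u. x u \<oplus>\<^bsub>R\<^esub> y u)"
  shows "abelian_group A"
proof -
  interpret cring R by fact
  interpret U: left_unital_algebra R using assms(1) by (rule left_unital_algebra_cring)
  show ?thesis
  proof (rule abelian_groupI)
    show "\<exists>y\<in>carrier A. y \<oplus>\<^bsub>A\<^esub> x = \<zero>\<^bsub>A\<^esub>" if x: "x \<in> carrier A" for x
    proof
      have "{u. \<ominus>\<^bsub>R\<^esub> x u \<noteq> \<zero>\<^bsub>R\<^esub>} \<subseteq> {u. x u \<noteq> \<zero>\<^bsub>R\<^esub>}" by auto
      then show "(\<lambda>u. \<ominus>\<^bsub>R\<^esub> x u) \<in> carrier A"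
        using x unfolding assms(2) fin_supp_def by (auto intro: finite_subset)
      show "(\<lambda>u. \<ominus>\<^bsub>R\<^esub> x u) \<oplus>\<^bsub>A\<^esub> x = \<zero>\<^bsub>A\<^esub>"
        using fin_supp_closed [of x R X] x by (auto simp: assms l_neg)
    qed
  qed (auto simp: assms U.zero_fin_supp U.add_fin_supp fin_supp_closed a_ac)
qed

locale brauer = cring R for R :: "('r, 's) ring_scheme" (structure) +
  fixes n :: nat and \<delta> :: 'r
  assumes \<delta>_unit: "\<delta> \<in> Units R"
begin

abbreviation "S \<equiv> sym_group_algebra R n"
abbreviation "B \<equiv> brauer_algebra R n \<delta>"
abbreviation "TS \<equiv> triv_sym R n"
abbreviation "TB \<equiv> triv_brauer R n"
abbreviation "\<iota> \<equiv> brauer_incl R n"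
abbreviation "\<pi> \<equiv> brauer_proj R n"

sublocale U: left_unital_algebra R
  by (rule left_unital_algebra_cring) (rule is_cring)

lemma \<delta>_closed: "\<delta> \<in> carrier R"
  using \<delta>_unit by (rule Units_closed)

lemma B_carrier: "carrier B = fin_supp R (diagrams n)"
  and B_zero: "\<zero>\<^bsub>B\<^esub> = (\<lambda>_. \<zero>)"
  and B_add: "add B = (\<lambda>x y d. x d \<oplus> y d)"
  and B_smult: "smult B = (\<lambda>r x d. r \<otimes> x d)"
  and B_mult: "(x \<otimes>\<^bsub>B\<^esub> y) d = finsum R (\<lambda>(b, c). x b \<otimes> y c \<otimes> (\<delta> [^] loops n b c))
       {(b, c). b \<in> diagrams n \<and> c \<in> diagrams n \<and> compose_diagrams n b c = d}"
  by (simp_all add: brauer_algebra_def)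

lemma S_carrier: "carrier S = fin_supp R (Sym n)"
  and S_zero: "\<zero>\<^bsub>S\<^esub> = (\<lambda>_. \<zero>)"
  and S_add: "add S = (\<lambda>x y u. x u \<oplus> y u)"
  and S_smult: "smult S = (\<lambda>r x u. r \<otimes> x u)"
  and S_mult: "(x \<otimes>\<^bsub>S\<^esub> y) u = finsum R (\<lambda>(g, h). x g \<otimes> y h)
       {(g, h). g \<in> Sym n \<and> h \<in> Sym n \<and> g \<circ> h = u}"
  by (simp_all add: sym_group_algebra_def sym_group_mult)

lemma B_scalar_one: "r \<in> carrier R \<Longrightarrow> r \<odot>\<^bsub>B\<^esub> \<one>\<^bsub>B\<^esub> = delta R (perm_diagram n id) r"
  and B_one: "\<one>\<^bsub>B\<^esub> = delta R (perm_diagram n id) \<one>"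
  by (auto simp: brauer_algebra_def delta_def)

lemma S_scalar_one: "r \<in> carrier R \<Longrightarrow> r \<odot>\<^bsub>S\<^esub> \<one>\<^bsub>S\<^esub> = delta R id r"
  and S_one: "\<one>\<^bsub>S\<^esub> = delta R id \<one>"
  by (auto simp: sym_group_algebra_def delta_def sym_group_one)

lemma B_abelian_group: "abelian_group B"
  by (rule fin_supp_abelian_group [OF is_cring B_carrier B_zero B_add])

lemma S_abelian_group: "abelian_group S"
  by (rule fin_supp_abelian_group [OF is_cring S_carrier S_zero S_add])

lemma B_coeff: "x \<in> carrier B \<Longrightarrow> x d \<in> carrier R"
  and S_coeff: "y \<in> carrier S \<Longrightarrow> y g \<in> carrier R"
  using fin_supp_closed [of x R "diagrams n" d] fin_supp_closed [of y R "Sym n" g]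
  by (simp_all add: B_carrier S_carrier)

lemma B_coeff_zero: "\<lbrakk>x \<in> carrier B; d \<notin> diagrams n\<rbrakk> \<Longrightarrow> x d = \<zero>"
  and S_coeff_zero: "\<lbrakk>y \<in> carrier S; g \<notin> Sym n\<rbrakk> \<Longrightarrow> y g = \<zero>"
  using fin_supp_zero [of x R "diagrams n" d] fin_supp_zero [of y R "Sym n" g]
  by (simp_all add: B_carrier S_carrier)

section \<open>Products in the Brauer algebra\<close>

lemma B_mult_support:
  assumes "x \<in> carrier B" "y \<in> carrier B" "(x \<otimes>\<^bsub>B\<^esub> y) d \<noteq> \<zero>"
  obtains b c where "b \<in> diagrams n" "c \<in> diagrams n" "compose_diagrams n b c = d" "x b \<noteq> \<zero>" "y c \<noteq> \<zero>"
proof (rule ccontr)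
  assume no: "\<not> thesis"
  note witness = that
  have "x b \<otimes> y c \<otimes> \<delta> [^] loops n b c = \<zero>"
    if "b \<in> diagrams n" "c \<in> diagrams n" "compose_diagrams n b c = d" for b c
  proof -
    have "x b = \<zero> \<or> y c = \<zero>" using no that witness by blast
    then show ?thesis using assms(1,2) B_coeff \<delta>_closed by auto
  qed
  then have "(x \<otimes>\<^bsub>B\<^esub> y) d = \<zero>"
    unfolding B_mult by (intro add.finprod_one_eqI) auto
  with assms show False by simp
qed

text \<open>If \<open>c\<close> fixes every diagram in the support of \<open>x\<close>, then only
  the pair \<open>(d, c)\<close> contributes to the coefficient at \<open>d\<close>. It is applied
  to cap diagrams and to the identity diagram.\<close>

lemma B_mult_delta_right:
  assumes x: "x \<in> carrier B" and c: "c \<in> diagrams n" and s: "s \<in> carrier R"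
    and fixed: "\<And>b. \<lbrakk>b \<in> diagrams n; x b \<noteq> \<zero>\<rbrakk> \<Longrightarrow> compose_diagrams n b c = b \<and> loops n b c = k"
  shows "x \<otimes>\<^bsub>B\<^esub> delta R c s = (\<lambda>d. x d \<otimes> s \<otimes> \<delta> [^] k)"
proof
  fix d
  let ?f = "\<lambda>(b, c'). x b \<otimes> delta R c s c' \<otimes> (\<delta> [^] loops n b c')"
  let ?Z = "{(b, c'). b \<in> diagrams n \<and> c' \<in> diagrams n \<and> compose_diagrams n b c' = d}"
  have closed: "x b \<otimes> delta R c s c' \<otimes> (\<delta> [^] loops n b c') \<in> carrier R" for b c'
    using B_coeff [OF x] s \<delta>_closed by (simp add: delta_def)
  have "?Z \<subseteq> diagrams n \<times> diagrams n" by auto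
  then have fin: "finite ?Z" using finite_diagrams finite_subset by blast
  have zero: "?f p = \<zero>" if "p \<in> ?Z" "p \<noteq> (d, c)" for p
  proof -
    obtain b c' where p: "p = (b, c')" by (cases p)
    then have "x b = \<zero> \<or> c' \<noteq> c" using that fixed [of b] by auto
    then show ?thesis using p B_coeff [OF x] s \<delta>_closed by (auto simp: delta_def)
  qed
  show "(x \<otimes>\<^bsub>B\<^esub> delta R c s) d = x d \<otimes> s \<otimes> \<delta> [^] k"
  proof (cases "x d = \<zero>")
    case True
    have "?f p = \<zero>" if "p \<in> ?Z" for p
      using zero [OF that] True s \<delta>_closed by (cases "p = (d, c)") (auto simp: delta_def)
    then have "(x \<otimes>\<^bsub>B\<^esub> delta R c s) d = \<zero>"
      unfolding B_mult by (rule add.finprod_one_eqI)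
    then show ?thesis using True s \<delta>_closed by simp
  next
    case False
    then have d: "d \<in> diagrams n" using B_coeff_zero [OF x] by blast
    have "finsum R ?f {(d, c)} = finsum R ?f ?Z"
      by (rule add.finprod_mono_neutral_cong_left [OF fin])
         (use d c fixed [OF d False] zero closed in auto)
    then show ?thesis
      unfolding B_mult using closed [of d c] fixed [OF d False] by (simp add: delta_def)
  qed
qed

lemma B_mult_scalar_left:
  assumes x: "x \<in> carrier B" and s: "s \<in> carrier R"
  shows "delta R (perm_diagram n id) s \<otimes>\<^bsub>B\<^esub> x = (\<lambda>d. s \<otimes> x d)"
proof
  fix d
  let ?i = "perm_diagram n id"
  let ?f = "\<lambda>(b, c'). delta R ?i s b \<otimes> x c' \<otimes> (\<delta> [^] loops n b c')"
  let ?Z = "{(b, c'). b \<in> diagrams n \<and> c' \<in> diagrams n \<and> compose_diagrams n b c' = d}"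
  have closed: "delta R ?i s b \<otimes> x c' \<otimes> (\<delta> [^] loops n b c') \<in> carrier R" for b c'
    using B_coeff [OF x] s \<delta>_closed by (simp add: delta_def)
  have "?Z \<subseteq> diagrams n \<times> diagrams n" by auto
  then have fin: "finite ?Z" using finite_diagrams finite_subset by blast
  have zero: "?f p = \<zero>" if "p \<in> ?Z" "p \<noteq> (?i, d)" for p
  proof -
    obtain b c' where p: "p = (b, c')" by (cases p)
    then have "b \<noteq> ?i" using that compose_id_left [of c' n] by auto
    then show ?thesis using p B_coeff [OF x] s \<delta>_closed by (auto simp: delta_def)
  qed
  show "(delta R ?i s \<otimes>\<^bsub>B\<^esub> x) d = s \<otimes> x d"
  proof (cases "d \<in> diagrams n")
    case False
    then have "?f p = \<zero>" if "p \<in> ?Z" for p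
      using zero [OF that] that by (cases "p = (?i, d)") auto
    then have "(delta R ?i s \<otimes>\<^bsub>B\<^esub> x) d = \<zero>"
      unfolding B_mult by (rule add.finprod_one_eqI)
    then show ?thesis using False B_coeff_zero [OF x] s by simp
  next
    case d: True
    have "finsum R ?f {(?i, d)} = finsum R ?f ?Z"
      by (rule add.finprod_mono_neutral_cong_left [OF fin])
         (use d compose_id_left [OF d] perm_diagram_in_diagrams [OF id_Sym] zero closed in auto)
    then show ?thesis
      unfolding B_mult using closed [of ?i d] loops_perm_diagram [OF id_Sym] s B_coeff [OF x]
      by (simp add: delta_def)
  qed
qed

text \<open>Together with \<open>B_scalar_left\<close> this shows that the scalars are central, so
  that acting by them gives chain maps and an action of \<open>R\<close> on Tor.\<close>

lemma B_scalar_right: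
  assumes x: "x \<in> carrier B" and r: "r \<in> carrier R"
  shows "x \<otimes>\<^bsub>B\<^esub> (r \<odot>\<^bsub>B\<^esub> \<one>\<^bsub>B\<^esub>) = r \<odot>\<^bsub>B\<^esub> x"
  unfolding B_scalar_one [OF r] unfolding B_smult
  using B_mult_delta_right [OF x perm_diagram_in_diagrams [OF id_Sym] r, of 0]
    compose_id_right loops_id_right B_coeff [OF x] r by (simp add: m_comm)

lemma B_scalar_left:
  assumes "x \<in> carrier B" and r: "r \<in> carrier R"
  shows "(r \<odot>\<^bsub>B\<^esub> \<one>\<^bsub>B\<^esub>) \<otimes>\<^bsub>B\<^esub> x = r \<odot>\<^bsub>B\<^esub> x"
  unfolding B_scalar_one [OF r] unfolding B_smult using assms by (rule B_mult_scalar_left)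

lemma B_scalar_one_closed: "r \<in> carrier R \<Longrightarrow> r \<odot>\<^bsub>B\<^esub> \<one>\<^bsub>B\<^esub> \<in> carrier B"
  unfolding B_scalar_one B_carrier
  using perm_diagram_in_diagrams [OF id_Sym] by (rule U.delta_fin_supp)

sublocale B: left_unital_algebra B
proof (intro left_unital_algebra.intro left_unital_algebra_axioms.intro B_abelian_group)
  show "\<one>\<^bsub>B\<^esub> \<in> carrier B"
    unfolding B_one B_carrier
    by (rule U.delta_fin_supp [OF perm_diagram_in_diagrams [OF id_Sym] one_closed])
  show "\<one>\<^bsub>B\<^esub> \<otimes>\<^bsub>B\<^esub> a = a" if "a \<in> carrier B" for a
    unfolding B_one using B_mult_scalar_left [OF that one_closed] B_coeff [OF that] by simp
  show "\<zero>\<^bsub>B\<^esub> \<otimes>\<^bsub>B\<^esub> a = \<zero>\<^bsub>B\<^esub>" if "a \<in> carrier B" for a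
  proof
    show "(\<zero>\<^bsub>B\<^esub> \<otimes>\<^bsub>B\<^esub> a) d = \<zero>\<^bsub>B\<^esub> d" for d
      unfolding B_mult using B_coeff [OF that] \<delta>_closed
      by (simp add: B_zero) (rule add.finprod_one_eqI, auto)
  qed
qed

section \<open>The maps \<iota> and \<pi>\<close>

lemma proj_coeff: "g \<in> Sym n \<Longrightarrow> \<pi> x g = x (perm_diagram n g)"
  and proj_coeff_zero: "g \<notin> Sym n \<Longrightarrow> \<pi> x g = \<zero>"
  by (simp_all add: brauer_proj_def)

lemma incl_coeff:
  assumes "x \<in> carrier S" "g \<in> Sym n"
  shows "\<iota> x (perm_diagram n g) = x g"
proof -
  have "{h \<in> Sym n. perm_diagram n h = perm_diagram n g} = {g}"
    using perm_diagram_inj assms(2) by blast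
  then show ?thesis using S_coeff [OF assms(1)] by (simp add: brauer_incl_def)
qed

lemma incl_coeff_zero: "d \<notin> perm_diagrams n \<Longrightarrow> \<iota> x d = \<zero>"
proof -
  assume "d \<notin> perm_diagrams n"
  then have "{h \<in> Sym n. perm_diagram n h = d} = {}" by (auto simp: perm_diagrams_def)
  then show ?thesis unfolding brauer_incl_def by (simp only: finsum_empty)
qed

lemma finite_Sym: "finite (Sym n)"
  by (simp add: sym_group_def finite_permutations)

lemma proj_closed: "x \<in> carrier B \<Longrightarrow> \<pi> x \<in> carrier S"
  using B_coeff finite_Sym unfolding S_carrier fin_supp_def
  by (auto simp: brauer_proj_def intro: finite_subset [of _ "Sym n"])

lemma incl_closed:
  assumes "x \<in> carrier S"
  shows "\<iota> x \<in> carrier B"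
proof -
  have "\<iota> x d \<in> carrier R" for d
    using incl_coeff [OF assms] incl_coeff_zero [of d] S_coeff [OF assms]
    by (cases "d \<in> perm_diagrams n") (auto simp: perm_diagrams_def)
  moreover have "{d. \<iota> x d \<noteq> \<zero>} \<subseteq> diagrams n"
    using incl_coeff_zero perm_diagrams_subset by blast
  ultimately show ?thesis
    using finite_subset [OF _ finite_diagrams] incl_coeff_zero perm_diagrams_subset
    unfolding B_carrier fin_supp_def by blast
qed

lemma proj_incl: "x \<in> carrier S \<Longrightarrow> \<pi> (\<iota> x) = x"
  by (auto simp: brauer_proj_def incl_coeff S_coeff_zero)

text \<open>Only pairs of permutation diagrams compose to a permutation diagram, and they create no
  loops. The sum for the product in the Brauer algebra thus becomes the one in the group algebra
  after reindexing by pairs of permutations.\<close>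

lemma proj_mult:
  assumes x: "x \<in> carrier B" and y: "y \<in> carrier B"
  shows "\<pi> (x \<otimes>\<^bsub>B\<^esub> y) = \<pi> x \<otimes>\<^bsub>S\<^esub> \<pi> y"
proof
  fix u
  let ?Z = "{(g, h). g \<in> Sym n \<and> h \<in> Sym n \<and> g \<circ> h = u}"
  show "\<pi> (x \<otimes>\<^bsub>B\<^esub> y) u = (\<pi> x \<otimes>\<^bsub>S\<^esub> \<pi> y) u"
  proof (cases "u \<in> Sym n")
    case False
    have "?Z = {}"
      using False by (auto simp: sym_group_carrier permutes_compose)
    then show ?thesis
      unfolding proj_coeff_zero [OF False] S_mult by (simp only: finsum_empty)
  next
    case u: True
    let ?P = "map_prod (perm_diagram n) (perm_diagram n)"
    let ?f = "\<lambda>(b, c). x b \<otimes> y c \<otimes> (\<delta> [^] loops n b c)"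
    have "{(b, c). b \<in> diagrams n \<and> c \<in> diagrams n \<and> compose_diagrams n b c = perm_diagram n u} = ?P ` ?Z"
    proof (intro equalityI subsetI)
      fix p assume "p \<in> {(b, c). b \<in> diagrams n \<and> c \<in> diagrams n \<and> compose_diagrams n b c = perm_diagram n u}"
      then obtain b c where bc: "p = (b, c)" "b \<in> diagrams n" "c \<in> diagrams n"
        "compose_diagrams n b c = perm_diagram n u" by blast
      then have "b \<in> perm_diagrams n" "c \<in> perm_diagrams n"
        using compose_perm_diagramsD [OF bc(2,3)] u by (auto simp: perm_diagrams_def)
      then obtain g h where gh: "g \<in> Sym n" "h \<in> Sym n" "b = perm_diagram n g" "c = perm_diagram n h"
        by (auto simp: perm_diagrams_def)
      then have "g \<circ> h \<in> Sym n" by (simp add: sym_group_carrier permutes_compose)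
      then have "g \<circ> h = u"
        using perm_diagram_inj u bc(4) gh compose_perm_perm [OF gh(1,2)] by metis
      then show "p \<in> ?P ` ?Z" using gh bc by force
    next
      fix p assume "p \<in> ?P ` ?Z"
      then show "p \<in> {(b, c). b \<in> diagrams n \<and> c \<in> diagrams n \<and> compose_diagrams n b c = perm_diagram n u}"
        using perm_diagram_in_diagrams compose_perm_perm by auto
    qed
    then have "\<pi> (x \<otimes>\<^bsub>B\<^esub> y) u = finsum R ?f (?P ` ?Z)"
      using u by (simp add: proj_coeff B_mult)
    also have "\<dots> = finsum R (\<lambda>p. ?f (?P p)) ?Z"
    proof (rule add.finprod_reindex)
      show "?f \<in> ?P ` ?Z \<rightarrow> carrier R"
        using B_coeff x y \<delta>_closed by auto
      show "inj_on ?P ?Z"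
        using perm_diagram_inj by (auto simp: inj_on_def)
    qed
    also have "\<dots> = (\<pi> x \<otimes>\<^bsub>S\<^esub> \<pi> y) u"
      unfolding S_mult
      by (rule add.finprod_cong')
         (auto simp: loops_perm_diagram proj_coeff B_coeff [OF x] B_coeff [OF y])
    finally show ?thesis .
  qed
qed

text \<open>At permutation diagrams both coefficients are determined by their images under
  \<open>\<pi>\<close>, which is multiplicative with \<open>\<pi> \<circ> \<iota> = id\<close>. At
  all other diagrams both vanish, because permutation diagrams are closed under composition.\<close>

lemma incl_mult:
  assumes x: "x \<in> carrier S" and y: "y \<in> carrier S"
  shows "\<iota> (x \<otimes>\<^bsub>S\<^esub> y) = \<iota> x \<otimes>\<^bsub>B\<^esub> \<iota> y"
proof
  fix d
  have xy: "\<pi> (\<iota> x \<otimes>\<^bsub>B\<^esub> \<iota> y) = x \<otimes>\<^bsub>S\<^esub> y"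
    using proj_mult [OF incl_closed [OF x] incl_closed [OF y]] x y by (simp add: proj_incl)
  show "\<iota> (x \<otimes>\<^bsub>S\<^esub> y) d = (\<iota> x \<otimes>\<^bsub>B\<^esub> \<iota> y) d"
  proof (cases "d \<in> perm_diagrams n")
    case True
    then obtain g where g: "g \<in> Sym n" "d = perm_diagram n g" by (auto simp: perm_diagrams_def)
    have "{h \<in> Sym n. perm_diagram n h = d} = {g}"
      using perm_diagram_inj g by blast
    moreover have "(x \<otimes>\<^bsub>S\<^esub> y) g \<in> carrier R"
      unfolding S_mult using S_coeff x y by (intro add.finprod_closed) auto
    ultimately show ?thesis
      using fun_cong [OF xy, of g] g by (simp add: brauer_incl_def proj_coeff)
  next
    case False
    have "(\<iota> x \<otimes>\<^bsub>B\<^esub> \<iota> y) d = \<zero>"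
    proof (rule ccontr)
      assume "(\<iota> x \<otimes>\<^bsub>B\<^esub> \<iota> y) d \<noteq> \<zero>"
      then obtain b c where bc: "compose_diagrams n b c = d" "\<iota> x b \<noteq> \<zero>" "\<iota> y c \<noteq> \<zero>"
        by (rule B_mult_support [OF incl_closed [OF x] incl_closed [OF y]])
      then have "b \<in> perm_diagrams n" "c \<in> perm_diagrams n"
        using incl_coeff_zero [of b x] incl_coeff_zero [of c y] by blast+
      then obtain g h where gh: "g \<in> Sym n" "h \<in> Sym n" "b = perm_diagram n g" "c = perm_diagram n h"
        by (auto simp: perm_diagrams_def)
      then have "d = perm_diagram n (g \<circ> h)" "g \<circ> h \<in> Sym n"
        using bc compose_perm_perm by (auto simp: sym_group_carrier permutes_compose)
      with False show False by (auto simp: perm_diagrams_def)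
    qed
    then show ?thesis using incl_coeff_zero [OF False] by simp
  qed
qed

text \<open>It transfers unit laws, zero laws and centrality of scalars from the Brauer algebra to
  the group algebra.\<close>

lemma S_mult_eq: "\<lbrakk>x \<in> carrier S; y \<in> carrier S\<rbrakk> \<Longrightarrow> x \<otimes>\<^bsub>S\<^esub> y = \<pi> (\<iota> x \<otimes>\<^bsub>B\<^esub> \<iota> y)"
  by (simp add: proj_mult incl_closed proj_incl)

lemma incl_delta: "r \<in> carrier R \<Longrightarrow> \<iota> (r \<odot>\<^bsub>S\<^esub> \<one>\<^bsub>S\<^esub>) = r \<odot>\<^bsub>B\<^esub> \<one>\<^bsub>B\<^esub>"
  and S_scalar_one_closed: "r \<in> carrier R \<Longrightarrow> r \<odot>\<^bsub>S\<^esub> \<one>\<^bsub>S\<^esub> \<in> carrier S"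
proof -
  assume r: "r \<in> carrier R"
  show c: "r \<odot>\<^bsub>S\<^esub> \<one>\<^bsub>S\<^esub> \<in> carrier S"
    unfolding S_scalar_one [OF r] S_carrier by (rule U.delta_fin_supp [OF id_Sym r])
  show "\<iota> (r \<odot>\<^bsub>S\<^esub> \<one>\<^bsub>S\<^esub>) = r \<odot>\<^bsub>B\<^esub> \<one>\<^bsub>B\<^esub>"
  proof
    fix d
    show "\<iota> (r \<odot>\<^bsub>S\<^esub> \<one>\<^bsub>S\<^esub>) d = (r \<odot>\<^bsub>B\<^esub> \<one>\<^bsub>B\<^esub>) d"
    proof (cases "d \<in> perm_diagrams n")
      case True
      then obtain g where g: "g \<in> Sym n" "d = perm_diagram n g" by (auto simp: perm_diagrams_def)
      have "\<iota> (r \<odot>\<^bsub>S\<^esub> \<one>\<^bsub>S\<^esub>) d = (r \<odot>\<^bsub>S\<^esub> \<one>\<^bsub>S\<^esub>) g"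
        unfolding g(2) by (rule incl_coeff [OF c g(1)])
      then show ?thesis
        using perm_diagram_inj [OF g(1) id_Sym] g
        unfolding S_scalar_one [OF r] B_scalar_one [OF r] by (auto simp: delta_def)
    next
      case False
      then have "d \<noteq> perm_diagram n id" using id_Sym by (auto simp: perm_diagrams_def)
      then show ?thesis
        using incl_coeff_zero [OF False] unfolding B_scalar_one [OF r] by (simp add: delta_def)
    qed
  qed
qed

lemma proj_scalar: "r \<in> carrier R \<Longrightarrow> x \<in> carrier S \<Longrightarrow> \<pi> (r \<odot>\<^bsub>B\<^esub> \<iota> x) = r \<odot>\<^bsub>S\<^esub> x"
  by (auto simp: brauer_proj_def B_smult S_smult incl_coeff S_coeff_zero)

lemma S_scalar_right: "\<lbrakk>x \<in> carrier S; r \<in> carrier R\<rbrakk> \<Longrightarrow> x \<otimes>\<^bsub>S\<^esub> (r \<odot>\<^bsub>S\<^esub> \<one>\<^bsub>S\<^esub>) = r \<odot>\<^bsub>S\<^esub> x"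
  and S_scalar_left: "\<lbrakk>x \<in> carrier S; r \<in> carrier R\<rbrakk> \<Longrightarrow> (r \<odot>\<^bsub>S\<^esub> \<one>\<^bsub>S\<^esub>) \<otimes>\<^bsub>S\<^esub> x = r \<odot>\<^bsub>S\<^esub> x"
  by (simp_all add: S_mult_eq S_scalar_one_closed incl_delta B_scalar_right B_scalar_left
      incl_closed proj_scalar)

lemma incl_zero: "\<iota> \<zero>\<^bsub>S\<^esub> = \<zero>\<^bsub>B\<^esub>"
  by (auto simp: brauer_incl_def S_zero B_zero)

lemma proj_zero: "\<pi> \<zero>\<^bsub>B\<^esub> = \<zero>\<^bsub>S\<^esub>"
  by (auto simp: brauer_proj_def S_zero B_zero)

sublocale S: left_unital_algebra S
proof (intro left_unital_algebra.intro left_unital_algebra_axioms.intro S_abelian_group)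
  show one: "\<one>\<^bsub>S\<^esub> \<in> carrier S"
    unfolding S_one S_carrier by (rule U.delta_fin_supp [OF id_Sym one_closed])
  interpret SG: abelian_group S by (rule S_abelian_group)
  have smult_one: "\<one> \<odot>\<^bsub>S\<^esub> x = x" if "x \<in> carrier S" for x
    using S_coeff [OF that] by (simp add: S_smult)
  show "\<one>\<^bsub>S\<^esub> \<otimes>\<^bsub>S\<^esub> a = a" if "a \<in> carrier S" for a
    using S_scalar_left [OF that one_closed] smult_one [OF that] smult_one [OF one] by simp
  show "\<zero>\<^bsub>S\<^esub> \<otimes>\<^bsub>S\<^esub> a = \<zero>\<^bsub>S\<^esub>" if "a \<in> carrier S" for a
    using that by (simp add: S_mult_eq incl_zero B.zero_mult incl_closed proj_zero)
qed

sublocale \<pi>: algebra_map B S \<pi>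
proof (intro algebra_map.intro algebra_map_axioms.intro B.left_unital_algebra_axioms
    S.left_unital_algebra_axioms proj_closed proj_mult)
  show "\<pi> (a \<oplus>\<^bsub>B\<^esub> b) = \<pi> a \<oplus>\<^bsub>S\<^esub> \<pi> b" for a b
    by (auto simp: brauer_proj_def B_add S_add)
qed

sublocale \<iota>: algebra_map S B \<iota>
proof (intro algebra_map.intro algebra_map_axioms.intro B.left_unital_algebra_axioms
    S.left_unital_algebra_axioms incl_closed incl_mult)
  show "\<iota> (a \<oplus>\<^bsub>S\<^esub> b) = \<iota> a \<oplus>\<^bsub>B\<^esub> \<iota> b" if "a \<in> carrier S" "b \<in> carrier S" for a b
    using S_coeff that unfolding brauer_incl_def B_add S_add by (auto intro!: ext add.finprod_multf)
qed

lemma proj_scalar_one: "r \<in> carrier R \<Longrightarrow> \<pi> (r \<odot>\<^bsub>B\<^esub> \<one>\<^bsub>B\<^esub>) = r \<odot>\<^bsub>S\<^esub> \<one>\<^bsub>S\<^esub>"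
  using proj_incl [OF S_scalar_one_closed] by (simp add: incl_delta)

end

subsection \<open>The trivial modules\<close>

context brauer
begin

lemma \<delta>_pow_unit: "\<delta> [^] (k::nat) \<in> Units R"
  by (induction k) (simp_all add: \<delta>_unit)

lemma TB_abelian_group: "abelian_group TB"
  by (rule abelian_groupI) (auto simp: triv_brauer_def a_ac intro: l_neg bexI [where x = "\<ominus> x" for x])

lemma TS_abelian_group: "abelian_group TS"
  by (rule abelian_groupI) (auto simp: triv_sym_def a_ac intro: l_neg bexI [where x = "\<ominus> x" for x])

lemma TB_carrier: "carrier TB = carrier R" and TB_zero: "\<zero>\<^bsub>TB\<^esub> = \<zero>" and TB_add: "add TB = add R"
  and TB_smult: "x \<odot>\<^bsub>TB\<^esub> t = (\<Oplus>d\<in>perm_diagrams n. x d) \<otimes> t"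
  by (simp_all add: triv_brauer_def)

lemma TS_carrier: "carrier TS = carrier R" and TS_zero: "\<zero>\<^bsub>TS\<^esub> = \<zero>" and TS_add: "add TS = add R"
  and TS_smult: "y \<odot>\<^bsub>TS\<^esub> t = (\<Oplus>g\<in>Sym n. y g) \<otimes> t"
  by (simp_all add: triv_sym_def)

lemma TB_act_closed: "\<lbrakk>x \<in> carrier B; t \<in> carrier TB\<rbrakk> \<Longrightarrow> x \<odot>\<^bsub>TB\<^esub> t \<in> carrier TB"
  using B_coeff by (simp add: TB_carrier TB_smult)

lemma TS_act_closed: "\<lbrakk>x \<in> carrier S; t \<in> carrier TS\<rbrakk> \<Longrightarrow> x \<odot>\<^bsub>TS\<^esub> t \<in> carrier TS"
  using S_coeff by (simp add: TS_carrier TS_smult)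

lemma TB_act_zero_coeffs:
  assumes "\<And>d. d \<in> perm_diagrams n \<Longrightarrow> x d = \<zero>" "t \<in> carrier TB"
  shows "x \<odot>\<^bsub>TB\<^esub> t = \<zero>\<^bsub>TB\<^esub>"
proof -
  have "(\<Oplus>d\<in>perm_diagrams n. x d) = \<zero>"
    using assms(1) by (rule add.finprod_one_eqI)
  then show ?thesis using assms(2) by (simp add: TB_smult TB_carrier TB_zero)
qed

lemma TB_zero_act: "t \<in> carrier TB \<Longrightarrow> \<zero>\<^bsub>B\<^esub> \<odot>\<^bsub>TB\<^esub> t = \<zero>\<^bsub>TB\<^esub>"
  by (rule TB_act_zero_coeffs) (simp_all add: B_zero)

lemma TS_zero_act: "t \<in> carrier TS \<Longrightarrow> \<zero>\<^bsub>S\<^esub> \<odot>\<^bsub>TS\<^esub> t = \<zero>\<^bsub>TS\<^esub>"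
  by (simp add: TS_smult S_zero TS_carrier TS_zero)

lemma sum_perm_diagrams:
  assumes "x \<in> carrier B"
  shows "(\<Oplus>d\<in>perm_diagrams n. x d) = (\<Oplus>g\<in>Sym n. x (perm_diagram n g))"
  unfolding perm_diagrams_def
  using perm_diagram_inj B_coeff [OF assms] by (intro add.finprod_reindex) (auto simp: inj_on_def)

lemma proj_act:
  assumes "x \<in> carrier B"
  shows "\<pi> x \<odot>\<^bsub>TS\<^esub> t = x \<odot>\<^bsub>TB\<^esub> t"
proof -
  have "(\<Oplus>g\<in>Sym n. \<pi> x g) = (\<Oplus>g\<in>Sym n. x (perm_diagram n g))"
    by (rule add.finprod_cong') (auto simp: proj_coeff B_coeff [OF assms])
  then show ?thesis by (simp add: TS_smult TB_smult sum_perm_diagrams [OF assms])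
qed

lemma incl_act: "x \<in> carrier S \<Longrightarrow> \<iota> x \<odot>\<^bsub>TB\<^esub> t = x \<odot>\<^bsub>TS\<^esub> t"
  using proj_act [OF incl_closed, of x t] by (simp add: proj_incl)

subsection \<open>Left ideals spanned by diagrams\<close>

definition supported :: "int set set set \<Rightarrow> (int set set \<Rightarrow> 'r) set" where
  "supported D = {a \<in> carrier B. \<forall>d. a d \<noteq> \<zero> \<longrightarrow> d \<in> D}"

lemma supported_closed: "supported D \<subseteq> carrier B"
  by (auto simp: supported_def)

lemma supported_Int: "supported D \<inter> supported D' = supported (D \<inter> D')"
  by (auto simp: supported_def)

lemma supported_left_absorbing:
  assumes "\<And>b c. \<lbrakk>b \<in> diagrams n; c \<in> diagrams n; c \<in> D\<rbrakk> \<Longrightarrow> compose_diagrams n b c \<in> D"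
  shows "left_absorbing B (supported D)"
  unfolding left_absorbing_def
proof (intro conjI ballI impI)
  show "supported D \<subseteq> carrier B" by (rule supported_closed)
  show "\<zero>\<^bsub>B\<^esub> \<in> supported D"
    using B.zero_closed unfolding supported_def by (simp add: B_zero)
  show "a \<oplus>\<^bsub>B\<^esub> b \<in> supported D" if "a \<in> supported D" "b \<in> supported D" for a b
  proof -
    have ab: "a \<in> carrier B" "b \<in> carrier B" using that by (auto simp: supported_def)
    have "d \<in> D" if "(a \<oplus>\<^bsub>B\<^esub> b) d \<noteq> \<zero>" for d
    proof (rule ccontr)
      assume "d \<notin> D"
      then have "a d = \<zero>" "b d = \<zero>"
        using \<open>a \<in> supported D\<close> \<open>b \<in> supported D\<close> unfolding supported_def by blast+
      then show False using that by (simp add: B_add)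
    qed
    then show ?thesis using B.add.m_closed [OF ab] unfolding supported_def by blast
  qed
  fix b a assume b: "b \<in> carrier B" and a: "a \<in> supported D" and ba: "b \<otimes>\<^bsub>B\<^esub> a \<in> carrier B"
  have ac: "a \<in> carrier B" using a by (simp add: supported_def)
  have "d \<in> D" if d: "(b \<otimes>\<^bsub>B\<^esub> a) d \<noteq> \<zero>" for d
  proof (rule B_mult_support [OF b ac d])
    fix p c assume "p \<in> diagrams n" "c \<in> diagrams n" "compose_diagrams n p c = d" "a c \<noteq> \<zero>"
    moreover from this have "c \<in> D" using a unfolding supported_def by blast
    ultimately show ?thesis using assms by blast
  qed
  then show "b \<otimes>\<^bsub>B\<^esub> a \<in> supported D" using ba unfolding supported_def by blast
qed

text \<open>\<open>supported (containing {T})\<close> is the left ideal \<open>L_T\<close> of the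
  overview, and a family \<open>F\<close> gives the sum of the \<open>L_T\<close> with
  \<open>T \<in> F\<close>.\<close>

definition containing :: "int set set set \<Rightarrow> int set set set" where
  "containing F = {d. \<exists>T\<in>F. T \<subseteq> d}"

lemma containing_left_absorbing:
  assumes F: "F \<subseteq> Pow (right_arcs n)"
  shows "left_absorbing B (supported (containing F))"
proof (rule supported_left_absorbing)
  fix b c assume c: "c \<in> diagrams n" "c \<in> containing F"
  then obtain T where T: "T \<in> F" "T \<subseteq> c" by (auto simp: containing_def)
  have "t \<in> compose_diagrams n b c" if "t \<in> T" for t
    using compose_right_arc [OF c(1)] that T F by (force simp: right_arcs_def)
  then show "compose_diagrams n b c \<in> containing F" using T by (auto simp: containing_def)
qed

definition nonperm_ideal :: "(int set set \<Rightarrow> 'r) set" where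
  "nonperm_ideal = supported (- perm_diagrams n)"

text \<open>A diagram is a permutation precisely if it has no right arc, so the ideal is the sum of
  the \<open>L_T\<close> over single arcs.\<close>

lemma ideal_eq: "nonperm_ideal = supported (containing ((\<lambda>t. {t}) ` right_arcs n))"
proof -
  have "d \<notin> perm_diagrams n \<longleftrightarrow> d \<in> containing ((\<lambda>t. {t}) ` right_arcs n)" if d: "d \<in> diagrams n" for d
  proof
    assume "d \<notin> perm_diagrams n"
    then show "d \<in> containing ((\<lambda>t. {t}) ` right_arcs n)"
      using perm_diagram_if_no_right_arc [OF d] by (auto simp: containing_def)
  next
    assume "d \<in> containing ((\<lambda>t. {t}) ` right_arcs n)"
    then obtain t where "t \<in> right_arcs n" "t \<in> d" by (auto simp: containing_def)
    then have "t \<subseteq> {0<..}" "t \<in> d" by (auto simp: right_arcs_def)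
    then show "d \<notin> perm_diagrams n" using perm_diagrams_no_arc(1) by blast
  qed
  then show ?thesis
    unfolding nonperm_ideal_def supported_def using B_coeff_zero by blast
qed

lemma ideal_left_absorbing: "left_absorbing B nonperm_ideal"
  unfolding ideal_eq by (rule containing_left_absorbing) auto

text \<open>If a product of diagrams is a permutation, so is its left factor. Absorption from the
  right is what turns \<open>Q I\<close> into a submodule.\<close>

lemma ideal_right:
  assumes b: "b \<in> nonperm_ideal" and a: "a \<in> carrier B" and ba: "b \<otimes>\<^bsub>B\<^esub> a \<in> carrier B"
  shows "b \<otimes>\<^bsub>B\<^esub> a \<in> nonperm_ideal"
proof -
  have bc: "b \<in> carrier B" using b by (simp add: nonperm_ideal_def supported_def)
  have "d \<notin> perm_diagrams n" if d: "(b \<otimes>\<^bsub>B\<^esub> a) d \<noteq> \<zero>" for d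
  proof (rule B_mult_support [OF bc a d])
    fix p c assume *: "p \<in> diagrams n" "c \<in> diagrams n" "compose_diagrams n p c = d" "b p \<noteq> \<zero>"
    then have "p \<notin> perm_diagrams n" using b unfolding nonperm_ideal_def supported_def by blast
    then show ?thesis using compose_perm_diagramsD(1) [OF *(1,2)] *(3) by blast
  qed
  then show ?thesis using ba unfolding nonperm_ideal_def supported_def by blast
qed

lemma ideal_act:
  assumes "a \<in> nonperm_ideal" "t \<in> carrier TB"
  shows "a \<odot>\<^bsub>TB\<^esub> t = \<zero>\<^bsub>TB\<^esub>"
  by (rule TB_act_zero_coeffs) (use assms in \<open>auto simp: nonperm_ideal_def supported_def\<close>)

text \<open>The scalars \<open>\<iota> (\<pi> a)\<close> and \<open>a\<close> act alike modulo
  \<open>Q I\<close>; this is the source of the linearity of \<open>f \<circ> g\<close> modulo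
  \<open>Q I\<close>.\<close>

lemma incl_proj_minus_ideal:
  assumes "a \<in> carrier B"
  shows "\<iota> (\<pi> a) \<ominus>\<^bsub>B\<^esub> a \<in> nonperm_ideal"
proof -
  let ?x = "\<iota> (\<pi> a) \<ominus>\<^bsub>B\<^esub> a"
  have c: "\<iota> (\<pi> a) \<in> carrier B" using assms by (intro incl_closed proj_closed)
  then have x: "?x \<in> carrier B" using assms by simp
  have "\<iota> (\<pi> a) = ?x \<oplus>\<^bsub>B\<^esub> a"
    using c assms by (simp add: a_minus_def B.a_assoc B.l_neg)
  then have eq: "\<iota> (\<pi> a) d = ?x d \<oplus> a d" for d by (metis B_add)
  have "?x d = \<zero>" if d: "d \<in> perm_diagrams n" for d
  proof -
    obtain g where g: "g \<in> Sym n" "d = perm_diagram n g" using d by (auto simp: perm_diagrams_def)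
    then have "\<iota> (\<pi> a) d = a d"
      using incl_coeff [OF proj_closed [OF assms] g(1)] by (simp add: proj_coeff)
    then have "?x d \<oplus> a d = \<zero> \<oplus> a d" using eq [of d] B_coeff [OF assms] by simp
    then show ?thesis
      using add.right_cancel [OF B_coeff [OF assms] B_coeff [OF x] zero_closed] by blast
  qed
  then show ?thesis using x unfolding nonperm_ideal_def supported_def by blast
qed

end

locale brauer_resolution = brauer R n \<delta>
  for R :: "('r, 's) ring_scheme" (structure) and n \<delta> +
  fixes Q :: "(int set set \<Rightarrow> 'r, 'q, 'r) resolution"
  assumes Q_resolution: "projective_resolution B TB Q"
begin

sublocale Q: unital_resolution B TB Q
  by (intro unital_resolution.intro B.left_unital_algebra_axioms proj_resolution.intro Q_resolution)

lemma acyclic_containing_one: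
  assumes T: "T \<subseteq> right_arcs n" "T \<noteq> {}"
  shows "Q.acyclic_span (supported (containing {T}))"
proof (cases "\<exists>b\<in>diagrams n. T \<subseteq> b")
  \<comment> \<open>Arcs of \<open>T\<close> that meet in a node, for instance, lie in no common
    diagram. The left ideal is then zero.\<close>
  case False
  have "a = \<zero>\<^bsub>B\<^esub>" if "a \<in> supported (containing {T})" for a
  proof
    fix d
    show "a d = \<zero>\<^bsub>B\<^esub> d"
      using that False B_coeff_zero [of a d] by (auto simp: supported_def containing_def B_zero)
  qed
  then show ?thesis by (intro Q.acyclic_span_zero) blast
next
  case True
  then obtain b where b: "b \<in> diagrams n" "T \<subseteq> b" by blast
  let ?u = "inv (\<delta> [^] card T)"
  let ?e = "delta R (cap_diagram n T) ?u"
  have unit: "\<delta> [^] card T \<in> Units R" by (rule \<delta>_pow_unit)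
  then have uc: "?u \<in> carrier R" by (rule Units_inv_closed)
  have cap: "cap_diagram n T \<in> diagrams n" by (rule cap_diagram_in_diagrams [OF b T(1)])
  have ec: "?e \<in> carrier B" unfolding B_carrier using cap uc by (rule U.delta_fin_supp)
  have e: "?e \<in> supported (containing {T})"
    using ec by (auto simp: supported_def containing_def delta_def cap_diagram_def)
  show ?thesis
  proof (rule Q.acyclic_span_idempotent [OF supported_closed e])
    fix a assume a: "a \<in> supported (containing {T})"
    then have ac: "a \<in> carrier B" by (simp add: supported_def)
    have "a \<otimes>\<^bsub>B\<^esub> ?e = (\<lambda>d. a d \<otimes> ?u \<otimes> \<delta> [^] card T)"
    proof (rule B_mult_delta_right [OF ac cap uc])
      fix c assume c: "c \<in> diagrams n" "a c \<noteq> \<zero>"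
      then have "T \<subseteq> c" using a by (auto simp: supported_def containing_def)
      then show "compose_diagrams n c (cap_diagram n T) = c \<and> loops n c (cap_diagram n T) = card T"
        using compose_cap_diagram [OF c(1) _ T(1)] loops_cap_diagram [OF c(1) _ T(1)] by simp
    qed
    also have "\<dots> = a"
      using unit uc Units_l_inv [OF unit] B_coeff [OF ac] Units_closed [OF unit] by (auto simp: m_assoc)
    finally show "a \<otimes>\<^bsub>B\<^esub> ?e = a" .
  next
    fix t assume "t \<in> carrier TB"
    then show "?e \<odot>\<^bsub>TB\<^esub> t = \<zero>\<^bsub>TB\<^esub>"
    proof (rule TB_act_zero_coeffs [rotated])
      fix d assume d: "d \<in> perm_diagrams n"
      \<comment> \<open>Here \<open>T \<noteq> {}\<close> enters: the cap diagram then has a right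
        arc, so it is no permutation diagram and acts as zero on the trivial module.\<close>
      obtain t where "t \<in> T" using T by blast
      then have "t \<subseteq> {0<..}" "t \<in> cap_diagram n T" using T by (force simp: right_arcs_def, simp add: cap_diagram_def)
      then have "d \<noteq> cap_diagram n T" using perm_diagrams_no_arc(1) [OF d] by blast
      then show "?e d = \<zero>" by (simp add: delta_def)
    qed
  qed
qed

text \<open>Splitting off one \<open>T\<close> leaves the smaller family \<open>?F\<close>. A
  diagram contains \<open>T\<close> and some member \<open>U\<close> of \<open>?F\<close> precisely
  if it contains \<open>T \<union> U\<close>, so the intersection of the two ideals belongs to
  \<open>?G\<close>, which has at most as many members as \<open>?F\<close>. The induction therefore
  runs over families of arbitrary nonempty arc sets.\<close>

lemma acyclic_containing:
  assumes "finite F" "F \<subseteq> Pow (right_arcs n) - {{}}"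
  shows "Q.acyclic_span (supported (containing F))"
  using assms
proof (induction "card F" arbitrary: F rule: less_induct)
  case less
  show ?case
  proof (cases "F = {}")
    case True
    have "supported (containing F) \<subseteq> {\<zero>\<^bsub>B\<^esub>}"
      using True by (auto simp: supported_def containing_def B_zero)
    then show ?thesis by (rule Q.acyclic_span_zero)
  next
    case False
    then obtain T where T: "T \<in> F" by blast
    let ?F = "F - {T}"
    let ?G = "(\<union>) T ` ?F"
    have card: "card ?F < card F" using T less.prems(1) by (intro psubset_card_mono) auto
    have cardG: "card ?G < card F"
      using card card_image_le [of ?F "(\<union>) T"] less.prems(1) by simp
    have TF: "T \<subseteq> right_arcs n" "T \<noteq> {}" "?F \<subseteq> Pow (right_arcs n) - {{}}" "?G \<subseteq> Pow (right_arcs n) - {{}}"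
      using less.prems(2) T by auto
    have G: "supported (containing {T}) \<inter> supported (containing ?F) = supported (containing ?G)"
      unfolding supported_Int by (rule arg_cong [of _ _ supported]) (auto simp: containing_def)
    show ?thesis
    proof (rule Q.acyclic_span_sum [of "supported (containing {T})" "supported (containing ?F)"])
      show "left_absorbing B (supported (containing {T}))" "left_absorbing B (supported (containing ?F))"
        using TF by (auto intro!: containing_left_absorbing)
      show "supported (containing F) \<subseteq> carrier B" by (rule supported_closed)
      show "supported (containing {T}) \<subseteq> supported (containing F)"
        "supported (containing ?F) \<subseteq> supported (containing F)"
        using T unfolding supported_def containing_def by blast+
      show "Q.acyclic_span (supported (containing {T}))" by (rule acyclic_containing_one [OF TF(1,2)])
      show "Q.acyclic_span (supported (containing ?F))"
        using less.hyps [OF card _ TF(3)] less.prems(1) by simp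
      show "Q.acyclic_span (supported (containing {T}) \<inter> supported (containing ?F))"
        unfolding G using less.hyps [OF cardG _ TF(4)] less.prems(1) by simp
      fix a assume a: "a \<in> supported (containing F)"
      let ?b = "\<lambda>d. if T \<subseteq> d then a d else \<zero>" and ?c = "\<lambda>d. if T \<subseteq> d then \<zero> else a d"
      have ac: "a \<in> carrier B" using a by (simp add: supported_def)
      have closed: "x \<in> carrier B" if "\<And>d. x d = a d \<or> x d = \<zero>" for x
      proof -
        have sub: "{d. x d \<noteq> \<zero>} \<subseteq> {d. a d \<noteq> \<zero>}"
        proof
          fix d assume "d \<in> {d. x d \<noteq> \<zero>}"
          then show "d \<in> {d. a d \<noteq> \<zero>}" using that [of d] by auto
        qed
        have "x d \<in> carrier R" for d using that [of d] B_coeff [OF ac, of d] by auto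
        moreover have "x d = \<zero>" if "d \<notin> diagrams n" for d
          using sub B_coeff_zero [OF ac that] by blast
        moreover have "finite {d. x d \<noteq> \<zero>}"
          using finite_subset [OF sub] ac unfolding B_carrier by (simp add: fin_supp_finite)
        ultimately show ?thesis
          unfolding B_carrier fin_supp_def by blast
      qed
      have "?b \<in> supported (containing {T})"
        using closed [of ?b] by (auto simp: supported_def containing_def)
      moreover have "?c \<in> supported (containing ?F)"
        using closed [of ?c] a by (auto simp: supported_def containing_def)
      moreover have "a = ?b \<oplus>\<^bsub>B\<^esub> ?c"
        using B_coeff [OF ac] by (auto simp: B_add)
      ultimately show "\<exists>b\<in>supported (containing {T}). \<exists>c\<in>supported (containing ?F). a = b \<oplus>\<^bsub>B\<^esub> c"
        by blast
    qed
  qed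
qed

lemma acyclic_ideal: "Q.acyclic_span nonperm_ideal"
  unfolding ideal_eq by (rule acyclic_containing) (auto simp: finite_right_arcs)

lemma ideal_submodule: "act_submodule B (res_obj Q k) (act_span (res_obj Q k) nonperm_ideal)"
  by (rule B.span_act_submodule [OF Q.proj ideal_left_absorbing ideal_right])

end

subsection \<open>Mutually inverse maps\<close>

lemma (in tensor_resolution) central_chain_map:
  assumes c: "c \<in> carrier A" and central: "\<And>a. a \<in> carrier A \<Longrightarrow> a \<otimes>\<^bsub>A\<^esub> c = c \<otimes>\<^bsub>A\<^esub> a"
  shows "tensor_chain_map A P N A P N (\<lambda>a. a) (\<lambda>k x. c \<odot>\<^bsub>res_obj P k\<^esub> x) (\<lambda>y. y)"
proof
  fix k
  interpret M: right_module A "res_obj P k"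
    using pair by (simp add: tensor_pair_def)
  have "c \<odot>\<^bsub>res_obj P k\<^esub> (a \<odot>\<^bsub>res_obj P k\<^esub> x) = a \<odot>\<^bsub>res_obj P k\<^esub> (c \<odot>\<^bsub>res_obj P k\<^esub> x)"
    if "a \<in> carrier A" "x \<in> carrier (res_obj P k)" for a x
    using M.act_mult [OF that(1) c that(2)] M.act_mult [OF c that] central [OF that(1)] by simp
  then show "(\<lambda>x. c \<odot>\<^bsub>res_obj P k\<^esub> x) \<in> linear_maps A (res_obj P k) (res_obj P k)"
    using c by (auto simp: semilinear_def M.act_closed M.act_add)
  show "c \<odot>\<^bsub>res_obj P k\<^esub> res_diff P k x = res_diff P k (c \<odot>\<^bsub>res_obj P (Suc k)\<^esub> x)"
    if "x \<in> carrier (res_obj P (Suc k))" for x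
    using semilinear_act [OF diff c that] by simp
qed auto

text \<open>For \<open>c\<close> a scalar multiple of the unit this is \<open>R\<close>-linearity of
  the map on Tor: \<open>f\<close> is semilinear, so acting by \<open>c\<close> before it equals
  acting by \<open>\<phi> c\<close> after it.\<close>

lemma (in tensor_chain_map) Tor_map_central:
  assumes c: "c \<in> carrier A" and central: "\<And>a. a \<in> carrier A \<Longrightarrow> a \<otimes>\<^bsub>A\<^esub> c = c \<otimes>\<^bsub>A\<^esub> a"
    and central': "\<And>b. b \<in> carrier B \<Longrightarrow> b \<otimes>\<^bsub>B\<^esub> \<phi> c = \<phi> c \<otimes>\<^bsub>B\<^esub> b"
    and x: "x \<in> carrier (Tor A P N k)"
  shows "Tor_map B Q N' f h k (Tor_map A P N (\<lambda>k x. c \<odot>\<^bsub>res_obj P k\<^esub> x) (\<lambda>y. y) k x) =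
    Tor_map B Q N' (\<lambda>k x. \<phi> c \<odot>\<^bsub>res_obj Q k\<^esub> x) (\<lambda>y. y) k (Tor_map B Q N' f h k x)"
proof -
  note cP = S.central_chain_map [OF c central]
  note cQ = T.central_chain_map [OF \<phi>_closed [OF c] central']
  note f = tensor_chain_map_axioms
  note fc = Tor_map_comp [OF cP f x] and cf = Tor_map_comp [OF f cQ x]
  show ?thesis
    by (rule trans [OF fc(1) trans [OF Tor_map_cong [OF fc(2) cf(2) _ _ x] cf(1) [symmetric]]])
      (simp_all add: semilinear_act [OF f_semilinear c])
qed

lemma (in abelian_group) plus_minus_cancel:
  "\<lbrakk>x \<in> carrier G; y \<in> carrier G\<rbrakk> \<Longrightarrow> (x \<oplus> y) \<ominus> y = x"
  by (simp add: a_minus_def a_assoc r_neg)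

lemma Tor_map_scale:
  fixes A :: "('r, 'a, 'c) module_scheme" and B :: "('r, 'b, 'd) module_scheme"
  assumes map: "tensor_chain_map A P N B Q N' \<phi> f h"
    and c: "r \<odot>\<^bsub>A\<^esub> \<one>\<^bsub>A\<^esub> \<in> carrier A"
    and central: "\<And>a. a \<in> carrier A \<Longrightarrow> a \<otimes>\<^bsub>A\<^esub> (r \<odot>\<^bsub>A\<^esub> \<one>\<^bsub>A\<^esub>) = (r \<odot>\<^bsub>A\<^esub> \<one>\<^bsub>A\<^esub>) \<otimes>\<^bsub>A\<^esub> a"
    and central': "\<And>b. b \<in> carrier B \<Longrightarrow> b \<otimes>\<^bsub>B\<^esub> (r \<odot>\<^bsub>B\<^esub> \<one>\<^bsub>B\<^esub>) = (r \<odot>\<^bsub>B\<^esub> \<one>\<^bsub>B\<^esub>) \<otimes>\<^bsub>B\<^esub> b"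
    and \<phi>: "\<phi> (r \<odot>\<^bsub>A\<^esub> \<one>\<^bsub>A\<^esub>) = r \<odot>\<^bsub>B\<^esub> \<one>\<^bsub>B\<^esub>"
    and x: "x \<in> carrier (Tor A P N k)"
  shows "Tor_map B Q N' f h k (Tor_scale A P N r k x) = Tor_scale B Q N' r k (Tor_map B Q N' f h k x)"
  unfolding Tor_scale_def
  using tensor_chain_map.Tor_map_central [OF map c central _ x] central' unfolding \<phi> by blast

locale brauer_resolutions = brauer_resolution R n \<delta> Q
  for R :: "('r, 's) ring_scheme" (structure) and n \<delta>
    and Q :: "(int set set \<Rightarrow> 'r, 'q, 'r) resolution" +
  fixes P :: "((nat \<Rightarrow> nat) \<Rightarrow> 'r, 'p, 'r) resolution"
  assumes P_resolution: "projective_resolution S TS P"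
begin

sublocale P: proj_resolution S TS P
  by (rule proj_resolution.intro) (rule P_resolution)

sublocale TP: tensor_resolution S P TS
proof (rule tensor_resolution.intro)
  fix k
  interpret right_module S "res_obj P k" by (rule P.obj)
  interpret TS: abelian_group TS by (rule TS_abelian_group)
  show "tensor_pair S (res_obj P k) TS"
    by unfold_locales (rule TS_act_closed)
qed (use P.diff P.diff_diff in auto)

sublocale TQ: tensor_resolution B Q TB
proof (rule tensor_resolution.intro)
  fix k
  interpret right_module B "res_obj Q k" by (rule Q.obj)
  interpret TB: abelian_group TB by (rule TB_abelian_group)
  show "tensor_pair B (res_obj Q k) TB"
    by unfold_locales (rule TB_act_closed)
qed (use Q.diff Q.diff_diff in auto)

lemma incl_cover_exists: "\<exists>f. covers S \<iota> (\<lambda>t. t) P Q f"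
proof (rule \<iota>.chain_map_exists [OF P_resolution Q_resolution TS_abelian_group TB_abelian_group
      TB_act_closed TB_zero_act])
  show "(\<lambda>t. t) \<in> semilinear S \<iota> TS TB"
    by (auto simp: semilinear_def incl_act TS_carrier TB_carrier TS_add TB_add)
qed

lemma proj_cover_exists: "\<exists>g. covers B \<pi> (\<lambda>t. t) Q P g"
proof (rule \<pi>.chain_map_exists [OF Q_resolution P_resolution TB_abelian_group TS_abelian_group
      TS_act_closed TS_zero_act])
  show "(\<lambda>t. t) \<in> semilinear B \<pi> TB TS"
    by (auto simp: semilinear_def proj_act TS_carrier TB_carrier TS_add TB_add)
qed

lemma incl_chain_map:
  assumes "covers S \<iota> (\<lambda>t. t) P Q f"
  shows "tensor_chain_map S P TS B Q TB \<iota> f (\<lambda>t. t)"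
  by unfold_locales
     (use assms in \<open>auto simp: covers_def incl_closed incl_act TS_carrier TB_carrier TS_add TB_add\<close>)

lemma proj_chain_map:
  assumes "covers B \<pi> (\<lambda>t. t) Q P g"
  shows "tensor_chain_map B Q TB S P TS \<pi> g (\<lambda>t. t)"
  by unfold_locales
     (use assms in \<open>auto simp: covers_def proj_closed proj_act TS_carrier TB_carrier TS_add TB_add\<close>)

text \<open>A scalar \<open>a\<close> of the ideal moves across the tensor sign, where it acts on
  the trivial module as zero.\<close>

lemma pure_tensor_ideal:
  assumes "z \<in> act_span (res_obj Q k) nonperm_ideal" "t \<in> carrier TB"
  shows "pure_tensor B (res_obj Q k) TB z t = \<one>\<^bsub>tensor B (res_obj Q k) TB\<^esub>"
proof -
  interpret T: tensor_pair B "res_obj Q k" TB by (rule TQ.pair)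
  interpret G: comm_group "tensor B (res_obj Q k) TB" by (rule T.tensor_comm_group)
  have I: "nonperm_ideal \<subseteq> carrier B" unfolding nonperm_ideal_def by (rule supported_closed)
  show ?thesis
    using assms(1)
  proof induction
    case zero
    then show ?case using assms(2) by (rule T.pure_zero_left)
  next
    case (add x q a)
    have a: "a \<in> carrier B" "x \<in> carrier (res_obj Q k)"
      using add I T.M.span_closed [OF I] by auto
    then have "pure_tensor B (res_obj Q k) TB (a \<odot>\<^bsub>res_obj Q k\<^esub> q) t = \<one>\<^bsub>tensor B (res_obj Q k) TB\<^esub>"
      using T.pure_act [OF a(1) add.hyps(2) assms(2)] ideal_act [OF add.hyps(3) assms(2)]
        T.pure_zero_right [OF add.hyps(2)] by simp
    then show ?case
      using T.pure_add_left [OF a(2) T.M.act_closed [OF a(1) add.hyps(2)] assms(2)] add.IH by simp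
  qed
qed

lemma pure_tensor_mod_ideal:
  assumes x: "x \<in> carrier (res_obj Q k)" and y: "y \<in> carrier (res_obj Q k)"
    and xy: "x \<ominus>\<^bsub>res_obj Q k\<^esub> y \<in> act_span (res_obj Q k) nonperm_ideal" and t: "t \<in> carrier TB"
  shows "pure_tensor B (res_obj Q k) TB x t = pure_tensor B (res_obj Q k) TB y t"
proof -
  interpret T: tensor_pair B "res_obj Q k" TB by (rule TQ.pair)
  interpret G: comm_group "tensor B (res_obj Q k) TB" by (rule T.tensor_comm_group)
  have "x = (x \<ominus>\<^bsub>res_obj Q k\<^esub> y) \<oplus>\<^bsub>res_obj Q k\<^esub> y"
    using x y by (simp add: a_minus_def T.M.a_assoc T.M.l_neg)
  then have "pure_tensor B (res_obj Q k) TB x t =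
      pure_tensor B (res_obj Q k) TB (x \<ominus>\<^bsub>res_obj Q k\<^esub> y) t \<otimes>\<^bsub>tensor B (res_obj Q k) TB\<^esub>
      pure_tensor B (res_obj Q k) TB y t"
    using T.pure_add_left [of "x \<ominus>\<^bsub>res_obj Q k\<^esub> y" y t] x y t by simp
  then show ?thesis
    using pure_tensor_ideal [OF xy t] T.pure_closed [OF y t] by simp
qed

context
  fixes f g
  assumes f: "covers S \<iota> (\<lambda>t. t) P Q f" and g: "covers B \<pi> (\<lambda>t. t) Q P g"
begin

interpretation f: tensor_chain_map S P TS B Q TB \<iota> f "\<lambda>t. t"
  by (rule incl_chain_map [OF f])

interpretation g: tensor_chain_map B Q TB S P TS \<pi> g "\<lambda>t. t"
  by (rule proj_chain_map [OF g])

lemma f_aug: "x \<in> carrier (res_obj P 0) \<Longrightarrow> res_aug Q (f 0 x) = res_aug P x"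
  and g_aug: "y \<in> carrier (res_obj Q 0) \<Longrightarrow> res_aug P (g 0 y) = res_aug Q y"
  using f g by (simp_all add: covers_def)

text \<open>Since \<open>\<pi> \<circ> \<iota> = id\<close>, the composite
  \<open>g \<circ> f\<close> is honestly linear, and the homotopy lemma applies with zero
  submodules.\<close>

lemma Tor_proj_incl:
  assumes x: "x \<in> carrier (Tor S P TS k)"
  shows "Tor_map S P TS g (\<lambda>t. t) k (Tor_map B Q TB f (\<lambda>t. t) k x) = x"
proof -
  note gf = Tor_map_comp [OF f.tensor_chain_map_axioms g.tensor_chain_map_axioms x]
  have "\<exists>s. mod_homotopy S P (\<lambda>k. {\<zero>\<^bsub>res_obj P k\<^esub>}) (\<lambda>k x. g k (f k x)) s"
  proof (rule S.homotopy_mod_exists [OF P_resolution TS_abelian_group])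
    fix k
    note act_closed = right_module.act_closed [OF P.obj]
    note minus_eq_zero_iff = abelian_group.minus_eq_zero_iff [OF P.grp]
    show "act_submodule S (res_obj P k) {\<zero>\<^bsub>res_obj P k\<^esub>}"
      using right_module.act_zero [OF P.obj [of k]] abelian_group.axioms(1) [OF P.grp [of k]]
      by (auto simp: act_submodule_def abelian_monoid.zero_closed abelian_monoid.l_zero)
    show "\<exists>y\<in>carrier (res_obj P (Suc (Suc k))).
        x \<ominus>\<^bsub>res_obj P (Suc k)\<^esub> res_diff P (Suc k) y \<in> {\<zero>\<^bsub>res_obj P (Suc k)\<^esub>}"
      if x: "x \<in> carrier (res_obj P (Suc k))" "res_diff P k x \<in> {\<zero>\<^bsub>res_obj P k\<^esub>}" for x
    proof -
      obtain y where "y \<in> carrier (res_obj P (Suc (Suc k)))" "x = res_diff P (Suc k) y"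
        using P.exact [OF x(1)] x(2) by blast
      then show ?thesis using minus_eq_zero_iff [OF x(1) x(1)] by auto
    qed
    show "g k (f k (a \<odot>\<^bsub>res_obj P k\<^esub> x)) \<ominus>\<^bsub>res_obj P k\<^esub> a \<odot>\<^bsub>res_obj P k\<^esub> g k (f k x) \<in> {\<zero>\<^bsub>res_obj P k\<^esub>}"
      if "a \<in> carrier S" "x \<in> carrier (res_obj P k)" for a x
      using that semilinear_act [OF f.f_semilinear that] semilinear_act [OF g.f_semilinear incl_closed [OF that(1)] f.f_closed [OF that(2)]]
        minus_eq_zero_iff act_closed [OF that(1) g.f_closed [OF f.f_closed [OF that(2)]]]
      by (simp add: proj_incl)
  qed (simp_all add: f.f_closed g.f_closed semilinear_add [OF f.f_semilinear] semilinear_add [OF g.f_semilinear]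
      f.f_diff g.f_diff f_aug g_aug)
  then obtain s where "mod_homotopy S P (\<lambda>k. {\<zero>\<^bsub>res_obj P k\<^esub>}) (\<lambda>k x. g k (f k x)) s" by blast
  then have s: "\<And>k. s k \<in> linear_maps S (res_obj P k) (res_obj P (Suc k))"
    and s0: "\<And>x. x \<in> carrier (res_obj P 0) \<Longrightarrow> g 0 (f 0 x) \<ominus>\<^bsub>res_obj P 0\<^esub>
      (res_diff P 0 (s 0 x) \<oplus>\<^bsub>res_obj P 0\<^esub> x) = \<zero>\<^bsub>res_obj P 0\<^esub>"
    and sS: "\<And>k x. x \<in> carrier (res_obj P (Suc k)) \<Longrightarrow> g (Suc k) (f (Suc k) x) \<ominus>\<^bsub>res_obj P (Suc k)\<^esub>
      (res_diff P (Suc k) (s (Suc k) x) \<oplus>\<^bsub>res_obj P (Suc k)\<^esub>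
        (s k (res_diff P k x) \<oplus>\<^bsub>res_obj P (Suc k)\<^esub> x)) = \<zero>\<^bsub>res_obj P (Suc k)\<^esub>"
    by (simp_all add: mod_homotopy_def)
  have ds: "res_diff P k (s k x) \<in> carrier (res_obj P k)" if "x \<in> carrier (res_obj P k)" for k x
    using P.diff_closed [OF semilinear_closed [OF s that]] .
  have sd: "s k (res_diff P k x) \<in> carrier (res_obj P (Suc k))" if "x \<in> carrier (res_obj P (Suc k))" for k x
    using semilinear_closed [OF s P.diff_closed [OF that]] .
  have e0: "g 0 (f 0 x) = res_diff P 0 (s 0 x) \<oplus>\<^bsub>res_obj P 0\<^esub> x" if x: "x \<in> carrier (res_obj P 0)" for x
  proof -
    note G = P.grp [of 0]
    show ?thesis using abelian_group.minus_eq_zero_iff [OF G] s0 [OF x] ds [OF x] x g.f_closed f.f_closed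
        abelian_groupE(1) [OF G] by simp
  qed
  have eS: "g (Suc k) (f (Suc k) x) = res_diff P (Suc k) (s (Suc k) x) \<oplus>\<^bsub>res_obj P (Suc k)\<^esub>
        (s k (res_diff P k x) \<oplus>\<^bsub>res_obj P (Suc k)\<^esub> x)" if x: "x \<in> carrier (res_obj P (Suc k))" for k x
  proof -
    note G = P.grp [of "Suc k"]
    show ?thesis using abelian_group.minus_eq_zero_iff [OF G] sS [OF x] ds [OF x] sd [OF x] x g.f_closed
        f.f_closed abelian_groupE(1) [OF G] by simp
  qed
  show ?thesis
    unfolding gf(1) by (rule TP.Tor_map_homotopic_id [OF gf(2) s _ _ x]) (simp_all add: e0 eS)
qed

text \<open>
  The composite \<open>f \<circ> g\<close> is only semilinear over \<open>\<iota> \<circ> \<pi>\<close>, but it is linear modulo \<open>Q I\<close>, and it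
  is homotopic to the identity modulo \<open>Q I\<close> because \<open>Q / Q I\<close> is exact in positive degrees.
  This suffices since \<open>Q I\<close> vanishes after tensoring with the trivial module.
\<close>

lemma Tor_incl_proj:
  assumes x: "x \<in> carrier (Tor B Q TB k)"
  shows "Tor_map B Q TB f (\<lambda>t. t) k (Tor_map S P TS g (\<lambda>t. t) k x) = x"
proof -
  note fg = Tor_map_comp [OF g.tensor_chain_map_axioms f.tensor_chain_map_axioms x]
  have I: "nonperm_ideal \<subseteq> carrier B" unfolding nonperm_ideal_def by (rule supported_closed)
  have "\<exists>s. mod_homotopy B Q (\<lambda>k. act_span (res_obj Q k) nonperm_ideal) (\<lambda>k x. f k (g k x)) s"
  proof (rule B.homotopy_mod_exists [OF Q_resolution TB_abelian_group])
    fix k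
    show "act_submodule B (res_obj Q k) (act_span (res_obj Q k) nonperm_ideal)" by (rule ideal_submodule)
    show "\<exists>y\<in>carrier (res_obj Q (Suc (Suc k))).
        x \<ominus>\<^bsub>res_obj Q (Suc k)\<^esub> res_diff Q (Suc k) y \<in> act_span (res_obj Q (Suc k)) nonperm_ideal"
      if "x \<in> carrier (res_obj Q (Suc k))" "res_diff Q k x \<in> act_span (res_obj Q k) nonperm_ideal" for x
      using Q.acyclic_span_exact [OF I acyclic_ideal that] .
    show "f k (g k (a \<odot>\<^bsub>res_obj Q k\<^esub> x)) \<ominus>\<^bsub>res_obj Q k\<^esub> a \<odot>\<^bsub>res_obj Q k\<^esub> f k (g k x) \<in> act_span (res_obj Q k) nonperm_ideal"
      if a: "a \<in> carrier B" and x: "x \<in> carrier (res_obj Q k)" for a x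
    proof -
      note M_act_closed = right_module.act_closed [OF Q.obj [of k]]
      note M_grp = Q.grp [of k]
      \<comment> \<open>The composite turns the scalar \<open>a\<close> into
        \<open>\<iota> (\<pi> a) = ?i \<oplus> a\<close>, so its failure to be linear is
        \<open>?i\<close> acting on \<open>?y\<close>, an element of \<open>Q I\<close>.\<close>
      let ?y = "f k (g k x)" and ?i = "\<iota> (\<pi> a) \<ominus>\<^bsub>B\<^esub> a"
      have y: "?y \<in> carrier (res_obj Q k)" using f.f_closed [OF g.f_closed [OF x]] .
      have i: "?i \<in> nonperm_ideal" by (rule incl_proj_minus_ideal [OF a])
      have ipc: "\<iota> (\<pi> a) \<in> carrier B" using incl_closed [OF proj_closed [OF a]] .
      then have "\<iota> (\<pi> a) = ?i \<oplus>\<^bsub>B\<^esub> a"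
        using a by (simp add: a_minus_def B.a_assoc B.l_neg)
      moreover have "f k (g k (a \<odot>\<^bsub>res_obj Q k\<^esub> x)) = \<iota> (\<pi> a) \<odot>\<^bsub>res_obj Q k\<^esub> ?y"
        using semilinear_act [OF g.f_semilinear a x]
          semilinear_act [OF f.f_semilinear proj_closed [OF a] g.f_closed [OF x]] by simp
      ultimately have "f k (g k (a \<odot>\<^bsub>res_obj Q k\<^esub> x)) = ?i \<odot>\<^bsub>res_obj Q k\<^esub> ?y \<oplus>\<^bsub>res_obj Q k\<^esub> a \<odot>\<^bsub>res_obj Q k\<^esub> ?y"
        using right_module.act_add_scalar [OF Q.obj _ a y, of ?i] i I by auto
      then have "f k (g k (a \<odot>\<^bsub>res_obj Q k\<^esub> x)) \<ominus>\<^bsub>res_obj Q k\<^esub> a \<odot>\<^bsub>res_obj Q k\<^esub> ?y = ?i \<odot>\<^bsub>res_obj Q k\<^esub> ?y"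
        using abelian_group.plus_minus_cancel [OF M_grp M_act_closed [OF subsetD [OF I i] y] M_act_closed [OF a y]]
        by simp
      then show ?thesis using right_module.span_act [OF Q.obj I i y] by simp
    qed
  qed (simp_all add: f.f_closed g.f_closed semilinear_add [OF f.f_semilinear] semilinear_add [OF g.f_semilinear]
      f.f_diff g.f_diff f_aug g_aug)
  then obtain s where "mod_homotopy B Q (\<lambda>k. act_span (res_obj Q k) nonperm_ideal) (\<lambda>k x. f k (g k x)) s" by blast
  then have s: "\<And>k. s k \<in> linear_maps B (res_obj Q k) (res_obj Q (Suc k))"
    and s0: "\<And>x. x \<in> carrier (res_obj Q 0) \<Longrightarrow> f 0 (g 0 x) \<ominus>\<^bsub>res_obj Q 0\<^esub>
      (res_diff Q 0 (s 0 x) \<oplus>\<^bsub>res_obj Q 0\<^esub> x) \<in> act_span (res_obj Q 0) nonperm_ideal"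
    and sS: "\<And>k x. x \<in> carrier (res_obj Q (Suc k)) \<Longrightarrow> f (Suc k) (g (Suc k) x) \<ominus>\<^bsub>res_obj Q (Suc k)\<^esub>
      (res_diff Q (Suc k) (s (Suc k) x) \<oplus>\<^bsub>res_obj Q (Suc k)\<^esub>
        (s k (res_diff Q k x) \<oplus>\<^bsub>res_obj Q (Suc k)\<^esub> x)) \<in> act_span (res_obj Q (Suc k)) nonperm_ideal"
    by (simp_all add: mod_homotopy_def)
  have ds: "res_diff Q k (s k x) \<in> carrier (res_obj Q k)" if "x \<in> carrier (res_obj Q k)" for k x
    using Q.diff_closed [OF semilinear_closed [OF s that]] .
  have sd: "s k (res_diff Q k x) \<in> carrier (res_obj Q (Suc k))" if "x \<in> carrier (res_obj Q (Suc k))" for k x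
    using semilinear_closed [OF s Q.diff_closed [OF that]] .
  show ?thesis
    unfolding fg(1)
  proof (rule TQ.Tor_map_homotopic_id [OF fg(2) s _ _ x])
    fix x y assume xy: "x \<in> carrier (res_obj Q 0)" "y \<in> carrier TB"
    note G = Q.grp [of 0]
    show "pure_tensor B (res_obj Q 0) TB (f 0 (g 0 x)) y =
      pure_tensor B (res_obj Q 0) TB (res_diff Q 0 (s 0 x) \<oplus>\<^bsub>res_obj Q 0\<^esub> x) y"
      using xy ds [OF xy(1)] f.f_closed g.f_closed abelian_groupE(1) [OF G]
      by (intro pure_tensor_mod_ideal s0) auto
  next
    fix k x y assume xy: "x \<in> carrier (res_obj Q (Suc k))" "y \<in> carrier TB"
    note G = Q.grp [of "Suc k"]
    show "pure_tensor B (res_obj Q (Suc k)) TB (f (Suc k) (g (Suc k) x)) y =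
      pure_tensor B (res_obj Q (Suc k)) TB (res_diff Q (Suc k) (s (Suc k) x)
        \<oplus>\<^bsub>res_obj Q (Suc k)\<^esub> (s k (res_diff Q k x) \<oplus>\<^bsub>res_obj Q (Suc k)\<^esub> x)) y"
      using xy ds [OF xy(1)] sd [OF xy(1)] f.f_closed g.f_closed abelian_groupE(1) [OF G]
      by (intro pure_tensor_mod_ideal sS) auto
  qed
qed

lemma Tor_incl_closed: "x \<in> carrier (Tor S P TS k) \<Longrightarrow> Tor_map B Q TB f (\<lambda>t. t) k x \<in> carrier (Tor B Q TB k)"
  using f.Tor_map_hom by (auto simp: hom_def)

lemma Tor_proj_closed: "y \<in> carrier (Tor B Q TB k) \<Longrightarrow> Tor_map S P TS g (\<lambda>t. t) k y \<in> carrier (Tor S P TS k)"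
  using g.Tor_map_hom by (auto simp: hom_def)

lemma Tor_incl_iso: "Tor_module_iso R S P TS B Q TB k (Tor_map B Q TB f (\<lambda>t. t) k)"
  unfolding Tor_module_iso_def
proof (intro conjI ballI)
  have "bij_betw (Tor_map B Q TB f (\<lambda>t. t) k) (carrier (Tor S P TS k)) (carrier (Tor B Q TB k))"
    by (rule bij_betw_byWitness [where f' = "Tor_map S P TS g (\<lambda>t. t) k"])
       (auto simp: Tor_proj_incl Tor_incl_proj Tor_incl_closed Tor_proj_closed)
  then show "Tor_map B Q TB f (\<lambda>t. t) k \<in> iso (Tor S P TS k) (Tor B Q TB k)"
    using f.Tor_map_hom by (simp add: iso_def)
  show "Tor_map B Q TB f (\<lambda>t. t) k (Tor_scale S P TS r k x) =
      Tor_scale B Q TB r k (Tor_map B Q TB f (\<lambda>t. t) k x)"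
    if "r \<in> carrier R" "x \<in> carrier (Tor S P TS k)" for r x
    by (rule Tor_map_scale [OF f.tensor_chain_map_axioms _ _ _ _ that(2)])
       (simp_all add: that S_scalar_one_closed S_scalar_left S_scalar_right B_scalar_left B_scalar_right incl_delta)
qed

lemma Tor_proj_iso: "Tor_module_iso R B Q TB S P TS k (Tor_map S P TS g (\<lambda>t. t) k)"
  unfolding Tor_module_iso_def
proof (intro conjI ballI)
  have "bij_betw (Tor_map S P TS g (\<lambda>t. t) k) (carrier (Tor B Q TB k)) (carrier (Tor S P TS k))"
    by (rule bij_betw_byWitness [where f' = "Tor_map B Q TB f (\<lambda>t. t) k"])
       (auto simp: Tor_proj_incl Tor_incl_proj Tor_incl_closed Tor_proj_closed)
  then show "Tor_map S P TS g (\<lambda>t. t) k \<in> iso (Tor B Q TB k) (Tor S P TS k)"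
    using g.Tor_map_hom by (simp add: iso_def)
  show "Tor_map S P TS g (\<lambda>t. t) k (Tor_scale B Q TB r k x) =
      Tor_scale S P TS r k (Tor_map S P TS g (\<lambda>t. t) k x)"
    if "r \<in> carrier R" "x \<in> carrier (Tor B Q TB k)" for r x
    by (rule Tor_map_scale [OF g.tensor_chain_map_axioms _ _ _ _ that(2)])
       (simp_all add: that B_scalar_one_closed S_scalar_left S_scalar_right B_scalar_left B_scalar_right proj_scalar_one)
qed

end

end

text \<open>The resolutions and the covering chain maps that compute the maps on Tor are arbitrary;
  the two existence clauses ensure that the statement about all such chain maps is not
  vacuous.\<close>

theorem theoremA:
  fixes R :: "('r, 's) ring_scheme" and n :: nat and \<delta> :: 'r
    and P :: "((nat \<Rightarrow> nat) \<Rightarrow> 'r, 'p, 'r) resolution"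
    and Q :: "(int set set \<Rightarrow> 'r, 'q, 'r) resolution"
  defines "S \<equiv> sym_group_algebra R n" and "B \<equiv> brauer_algebra R n \<delta>"
    and "TS \<equiv> triv_sym R n" and "TB \<equiv> triv_brauer R n"
  assumes "cring R" and "\<delta> \<in> Units R"
    and "projective_resolution S TS P" and "projective_resolution B TB Q"
  shows "(\<exists>f. covers S (brauer_incl R n) (\<lambda>t. t) P Q f) \<and>
    (\<exists>g. covers B (brauer_proj R n) (\<lambda>t. t) Q P g) \<and>
    (\<forall>f g k. covers S (brauer_incl R n) (\<lambda>t. t) P Q f \<longrightarrow>
       covers B (brauer_proj R n) (\<lambda>t. t) Q P g \<longrightarrow>
         Tor_module_iso R S P TS B Q TB k (Tor_map B Q TB f (\<lambda>t. t) k) \<and>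
         Tor_module_iso R B Q TB S P TS k (Tor_map S P TS g (\<lambda>t. t) k) \<and>
         (\<forall>x\<in>carrier (Tor S P TS k).
            Tor_map S P TS g (\<lambda>t. t) k (Tor_map B Q TB f (\<lambda>t. t) k x) = x) \<and>
         (\<forall>y\<in>carrier (Tor B Q TB k).
            Tor_map B Q TB f (\<lambda>t. t) k (Tor_map S P TS g (\<lambda>t. t) k y) = y))"
proof -
  interpret L: brauer_resolutions R n \<delta> Q P
    using assms
    by (simp add: brauer_resolutions_def brauer_resolutions_axioms_def brauer_resolution_def
        brauer_resolution_axioms_def brauer_def brauer_axioms_def S_def B_def TS_def TB_def)
  show ?thesis
    unfolding S_def B_def TS_def TB_def
    using L.incl_cover_exists L.proj_cover_exists L.Tor_incl_iso L.Tor_proj_iso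
      L.Tor_proj_incl L.Tor_incl_proj by (intro conjI allI impI ballI) simp_all
qed

end
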